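(* Let $B^3\subset\mathbb R^3$ be the open unit ball and, for $1\le p<\infty$, let $L^p_{\mathbb Z}(B^3,\mathbb R^3)$ denote the class of vector fields $X\in L^p(B^3,\mathbb R^3)$ such that $$\int_{\partial B_r(a)} X\cdot\nu\, d\mathcal H^2\in\mathbb Z\quad\text{for all } a\in B^3 \text{ and almost every } 0<r<\operatorname{dist}(a,\partial B^3),$$ where $\nu:\partial B_r(a)\to S^2$ is the outward unit normal. (i) For $1<p<3/2$ the class $L^p_{\mathbb Z}(B^3,\mathbb R^3)$ is weakly sequentially closed: whenever $X_k\in L^p_{\mathbb Z}(B^3,\mathbb R^3)$ and $X_k\rightharpoonup X_\infty$ weakly in $L^p$, then $X_\infty\in L^p_{\mathbb Z}(B^3,\mathbb R^3)$. (ii) For $p=1$: given any vector-valued Radon measure $X=(\mu_1,\mu_2,\mu_3)$ on $B^3$, where each $\mu_i$ is a signed Radon measure on $B^3$, there exists a sequence $X_k\in L^1_{\mathbb Z}(B^3,\mathbb R^3)$ such that $X_k\rightharpoonup X$ weakly in the sense of measures.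
   Context: For an $L^p$ vector field the flux $\int_{\partial B_r(a)}X\cdot\nu$ is defined for almost every $r$ by Fubini's theorem. *)

theory Defs
  imports "HOL-Analysis.Analysis"
begin

definition B3 :: "(real^3) set" where
  "B3 = ball 0 1"

definition Lp :: "real \<Rightarrow> (real^3 \<Rightarrow> real^3) set" where
  "Lp p = {X. X \<in> borel_measurable (lebesgue_on B3) \<and>
              integrable (lebesgue_on B3) (\<lambda>x. norm (X x) powr p)}"

text \<open>Spherical-coordinate parametrisation of the unit sphere S^2 (outward normal at sph t is sph t).\<close>
definition sph :: "real \<times> real \<Rightarrow> real^3" where
  "sph t = (\<chi> i. if i = 1 then sin (fst t) * cos (snd t)
                  else if i = 2 then sin (fst t) * sin (snd t)
                  else cos (fst t))"

text \<open>Integrand of the flux of X through the sphere of radius r centred at a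
  (surface element r^2 sin theta dtheta dphi).\<close>
definition flux_density :: "(real^3 \<Rightarrow> real^3) \<Rightarrow> real^3 \<Rightarrow> real \<Rightarrow> real \<times> real \<Rightarrow> real" where
  "flux_density X a r t = (X (a + r *\<^sub>R sph t) \<bullet> sph t) * r\<^sup>2 * sin (fst t)"

definition sph_params :: "(real \<times> real) set" where
  "sph_params = {0..pi} \<times> {0..2*pi}"

definition flux_defined :: "(real^3 \<Rightarrow> real^3) \<Rightarrow> real^3 \<Rightarrow> real \<Rightarrow> bool" where
  "flux_defined X a r = set_integrable lebesgue sph_params (flux_density X a r)"

definition flux :: "(real^3 \<Rightarrow> real^3) \<Rightarrow> real^3 \<Rightarrow> real \<Rightarrow> real" where
  "flux X a r = (LINT t:sph_params|lebesgue. flux_density X a r t)"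

text \<open>L^p_Z(B^3,R^3): for every a in B3 and a.e. 0<r<dist(a, boundary B3) = 1 - |a|,
  the flux through the sphere is defined and is an integer.\<close>
definition LpZ :: "real \<Rightarrow> (real^3 \<Rightarrow> real^3) set" where
  "LpZ p = {X \<in> Lp p. \<forall>a\<in>B3. AE r in lborel. 0 < r \<and> r < 1 - norm a \<longrightarrow>
                 flux_defined X a r \<and> flux X a r \<in> \<int>}"

definition weak_Lp_conv :: "real \<Rightarrow> (nat \<Rightarrow> real^3 \<Rightarrow> real^3) \<Rightarrow> (real^3 \<Rightarrow> real^3) \<Rightarrow> bool" where
  "weak_Lp_conv p Xs X \<longleftrightarrow> (\<forall>k. Xs k \<in> Lp p) \<and> X \<in> Lp p \<and>
     (\<forall>g \<in> Lp (p / (p - 1)).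
        (\<lambda>k. integral\<^sup>L (lebesgue_on B3) (\<lambda>x. Xs k x \<bullet> g x))
          \<longlonglongrightarrow> integral\<^sup>L (lebesgue_on B3) (\<lambda>x. X x \<bullet> g x))"

text \<open>A (nonnegative) Radon measure on B3: a Borel measure on R^3 carried by B3 and finite on
  compact subsets of B3. A signed Radon measure on B3 is a difference of two such.\<close>
definition radon_on_B3 :: "(real^3) measure \<Rightarrow> bool" where
  "radon_on_B3 M \<longleftrightarrow> sets M = sets borel \<and> emeasure M (UNIV - B3) = 0 \<and>
     (\<forall>K. compact K \<and> K \<subseteq> B3 \<longrightarrow> emeasure M K < \<infinity>)"

definition Cc_B3 :: "(real^3 \<Rightarrow> real) set" where
  "Cc_B3 = {\<phi>. continuous_on UNIV \<phi> \<and> compact (closure {x. \<phi> x \<noteq> 0}) \<and>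
               closure {x. \<phi> x \<noteq> 0} \<subseteq> B3}"

end

theory Submission
  imports Defs
begin

text \<open>Weak closedness. Write \<open>F a r\<close> for the flux of \<open>X\<close> through the sphere of radius \<open>r\<close> about
  \<open>a\<close>, and formally \<open>\<mu>\<close> for the divergence of \<open>X\<close>. A nonzero integer is at least 1, so the flux
  through a small sphere is bounded by the integral of \<open>norm X powr p\<close> over that sphere, times a
  constant and \<open>r powr (2 * p - 2)\<close>. Integrating over the centre, the mollification of \<open>\<mu>\<close> at scale
  \<open>d\<close> has \<open>L\<^sup>1\<close> norm at most a constant times \<open>d powr (2 * p - 3)\<close>, uniformly on bounded sets of
  \<open>L\<^sup>p\<close>. The flux mollified in \<open>a\<close> at scale \<open>d\<close> is the integral of the mollified \<open>\<mu>\<close> over a ball.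
  Mollifying it a second time at scale \<open>e\<close> moves only the mass within \<open>2 * e\<close> of the sphere, and the
  order of the two mollifications is immaterial. Hence passing from scale \<open>d\<close> to \<open>d / 2\<close> costs at
  most \<open>d powr (2 * p - 2)\<close> in \<open>L\<^sup>1(dr)\<close>, which is summable over dyadic scales because \<open>p > 1\<close>: the
  mollified fluxes are close to integers uniformly along the sequence. They converge under weak
  convergence of the fields, so the limit has integer fluxes as well.

  Density for \<open>p = 1\<close>. A dipole of charges \<open>n\<close> and \<open>-n\<close> at distance \<open>norm v / n\<close>, joined by
  straight flow lines through a small ball, has integer fluxes and total mass comparable to
  \<open>norm v\<close>; as \<open>n\<close> grows it concentrates to the vector mass \<open>v\<close> at a point. Finite sums of dipoles
  on a grid approximate any vector-valued Radon measure.\<close>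

section \<open>Spherical coordinates\<close>

text \<open>The obstacle is that weak convergence says nothing about a single sphere: it controls
  fluxes only after averaging in the radius, which destroys integrality, and the distributional
  divergence is in general no measure, so there is no mass to bound. Averages of fluxes over radii
  between \<open>d\<close> and \<open>2 * d\<close> are the meeting point: they are pairings of the
  field with a bounded test field, hence pass to weak limits, and for integer fluxes they obey a
  bound of degree \<open>p\<close> in the field. The mollifier is therefore a truncated cone, whose
  gradient is, up to sign, the radial unit field on exactly that range of radii. The mass of the
  mollified divergence may blow up as \<open>d\<close> tends to 0, but only its part in a thin shell
  matters, and integrating over the radius of the sphere turns the thickness of the shell into a
  gain of one power of \<open>d\<close>. The limit field is not known to satisfy the flux bound;
  what it inherits from the sequence is the comparison of successive scales and the mean distance to
  the integers. The centre \<open>a\<close> is kept fixed, so the conclusion holds for every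
  \<open>a\<close>.\<close>

lemma borel_measurable_fst_borel [measurable]:
    "(fst :: 'a::topological_space \<times> 'b::topological_space \<Rightarrow> 'a) \<in> borel_measurable borel"
  and borel_measurable_snd_borel [measurable]:
    "(snd :: 'a::topological_space \<times> 'b::topological_space \<Rightarrow> 'b) \<in> borel_measurable borel"
  by (intro borel_measurable_continuous_onI continuous_intros)+

lemma borel_measurable_vec_component [measurable]:
  fixes f :: "'a \<Rightarrow> real^'n"
  assumes "f \<in> borel_measurable M"
  shows "(\<lambda>x. f x $ i) \<in> borel_measurable M"
  by (rule measurable_compose[OF assms borel_measurable_nth])

text \<open>Coordinates are needed in two shapes: as \<open>real^3\<close> for the change of
  variables, and as nested pairs for Fubini. This map passes from the second to the first.\<close>

definition vec3 :: "real \<times> real \<times> real \<Rightarrow> real^3" where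
  "vec3 x = vector [fst x, fst (snd x), snd (snd x)]"

lemma vec3_nth [simp]: "vec3 x $ 1 = fst x" "vec3 x $ 2 = fst (snd x)" "vec3 x $ 3 = snd (snd x)"
  by (simp_all add: vec3_def)

lemma borel_measurable_vec3 [measurable]: "vec3 \<in> borel_measurable borel"
proof -
  have "continuous_on UNIV (\<lambda>x. vec3 x $ i)" for i
    using exhaust_3[of i] by (elim disjE) (simp_all add: continuous_on_fst continuous_on_snd
        continuous_on_id)
  then have "continuous_on UNIV (\<lambda>x. \<chi> i. vec3 x $ i)"
    by (rule continuous_on_vec_lambda)
  then have "continuous_on UNIV vec3" by simp
  then show ?thesis by (rule borel_measurable_continuous_onI)
qed

lemma Basis_vec3: "(Basis :: (real^3) set) = {axis 1 1, axis 2 1, axis 3 1}"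
  unfolding Basis_vec_def by (auto simp: UNIV_3)

lemma prod_Basis_vec3: "(\<Prod>b\<in>(Basis :: (real^3) set). f b)
    = f (axis 1 1) * f (axis 2 1) * f (axis 3 1)"
  by (simp add: Basis_vec3 axis_eq_axis mult.assoc)

lemma emeasure_lborel_Times:
  fixes A :: "'a::euclidean_space set" and B :: "'b::euclidean_space set"
  assumes "A \<in> sets borel" "B \<in> sets borel"
  shows "emeasure lborel (A \<times> B) = emeasure lborel A * emeasure lborel B"
  using lborel.emeasure_pair_measure_Times[of A lborel B] assms by (simp add: lborel_prod)

text \<open>Boxes determine \<open>lborel\<close>, and a box pulls back to a product of three
  intervals.\<close>

lemma lborel_vec3: "distr lborel borel vec3 = lborel"
proof (rule lborel_eqI[symmetric])
  fix l u :: "real^3" assume le: "\<And>b. b \<in> Basis \<Longrightarrow> l \<bullet> b \<le> u \<bullet> b"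
  have le3: "l $ i \<le> u $ i" for i
    using le[of "axis i 1"] by (simp add: inner_axis)
  have *: "vec3 -` box l u = {l$1<..<u$1} \<times> {l$2<..<u$2} \<times> {l$3<..<u$3}"
    by (auto simp: mem_box_cart forall_3)
  have "emeasure (distr lborel borel vec3) (box l u) = emeasure lborel (vec3 -` box l u)"
    by (simp add: emeasure_distr)
  also have "\<dots> = ennreal (u$1 - l$1) * (ennreal (u$2 - l$2) * ennreal (u$3 - l$3))"
    unfolding * using le3 by (simp add: emeasure_lborel_Times borel_Times)
  also have "\<dots> = (\<Prod>b\<in>(Basis:: (real^3) set). (u - l) \<bullet> b)"
    using le3[of 1] le3[of 2] le3[of 3]
    by (simp add: prod_Basis_vec3 inner_axis ennreal_mult' mult.assoc)
  finally show "emeasure (distr lborel borel vec3) (box l u)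
      = (\<Prod>b\<in>(Basis:: (real^3) set). (u - l) \<bullet> b)" .
qed simp

definition polar3 :: "real^3 \<Rightarrow> real^3" where
  "polar3 x = x $ 1 *\<^sub>R sph (x $ 2, x $ 3)"

definition polar3_jac :: "real^3 \<Rightarrow> real^3^3" where
  "polar3_jac x = vector [
     vector [sin (x$2) * cos (x$3), x$1 * cos (x$2) * cos (x$3), - x$1 * sin (x$2) * sin (x$3)],
     vector [sin (x$2) * sin (x$3), x$1 * cos (x$2) * sin (x$3), x$1 * sin (x$2) * cos (x$3)],
     vector [cos (x$2), - x$1 * sin (x$2), 0]]"

lemma sph_nth [simp]: "sph t $ 1 = sin (fst t) * cos (snd t)"
   "sph t $ 2 = sin (fst t) * sin (snd t)" "sph t $ 3 = cos (fst t)"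
  by (simp_all add: sph_def)

lemma det_polar3_jac: "det (polar3_jac x) = (x$1)\<^sup>2 * sin (x$2)"
proof -
  have "det (polar3_jac x) = (x$1)\<^sup>2 * sin (x$2) * ((sin (x$2))\<^sup>2 + (cos (x$2))\<^sup>2) * ((sin (x$3))\<^sup>2
      + (cos (x$3))\<^sup>2)"
    unfolding polar3_jac_def det_3 vector_3 by algebra
  then show ?thesis by simp
qed

lemma has_derivative_polar3: "(polar3 has_derivative (*v) (polar3_jac x)) (at x within S)"
proof -
  have nth: "((\<lambda>x. x $ i) has_derivative (\<lambda>h. h $ i)) (at x within S)" for i :: 3
    by (rule bounded_linear_imp_has_derivative) (rule bounded_linear_vec_nth)
  have "((\<lambda>x. polar3 x $ i) has_derivative (\<lambda>h. (polar3_jac x *v h) $ i)) (at x within S)" for i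
    using exhaust_3[of i]
    by (auto simp: polar3_def polar3_jac_def matrix_vector_mult_def sum_3 
      intro!: derivative_eq_intros nth) (auto simp: fun_eq_iff algebra_simps)
  then show ?thesis
    unfolding has_derivative_componentwise_within[where f=polar3] Basis_vec_def
    by (auto simp: inner_axis)
qed

text \<open>Open ranges for the angles make \<open>polar3\<close> injective; the price is a half
  plane bounded by the axis, which is a null set.\<close>

definition polar3_dom :: "(real^3) set" where
  "polar3_dom = {x. 0 < x$1 \<and> 0 < x$2 \<and> x$2 < pi \<and> 0 < x$3 \<and> x$3 < 2 * pi}"

lemma norm_sph [simp]: "norm (sph t) = 1"
proof -
  have "(norm (sph t))\<^sup>2 = (sin (fst t))\<^sup>2 * ((cos (snd t))\<^sup>2 + (sin (snd t))\<^sup>2) + (cos (fst t))\<^sup>2"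
    unfolding power2_norm_eq_inner inner_vec_def sum_3 sph_nth inner_real_def by algebra
  then have "norm (sph t) = 1 \<or> norm (sph t) = - 1" by (simp add: power2_eq_1_iff)
  then show ?thesis using norm_ge_zero[of "sph t"] by linarith
qed

lemma inj_polar3: "inj_on polar3 polar3_dom"
proof (rule inj_onI)
  fix x y assume x: "x \<in> polar3_dom" and y: "y \<in> polar3_dom" and eq: "polar3 x = polar3 y"
  have r: "x$1 = y$1"
    using arg_cong[OF eq, of norm] x y by (simp add: polar3_def polar3_dom_def)
  have s: "sph (x$2, x$3) = sph (y$2,y$3)" using eq r x by (simp add: polar3_def polar3_dom_def)
  have "cos (x$2) = cos (y$2)" using arg_cong[OF s, of "\<lambda>v. v $ 3"] by simp
  then have th: "x$2 = y$2" using x y cos_inj_pi[of "x$2" "y$2"] by (simp add: polar3_dom_def)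
  have sn: "sin (x$2) > 0" using x by (intro sin_gt_zero) (auto simp: polar3_dom_def)
  have "cos (x$3) = cos (y$3)" "sin (x$3) = sin (y$3)"
    using arg_cong[OF s, of "\<lambda>v. v $ 1"] arg_cong[OF s, of "\<lambda>v. v $ 2"] th sn by simp_all
  then obtain n :: int where n: "x$3 = y$3 + 2 * pi * n"
    using sin_cos_eq_iff[of "x$3" "y$3"] by (auto simp: mult_ac)
  have "\<bar>2 * pi * n\<bar> < 2 * pi" using x y n unfolding polar3_dom_def by force
  then have "2 * pi * \<bar>real_of_int n\<bar> < 2 * pi * 1" by (simp add: abs_mult)
  then have "\<bar>real_of_int n\<bar> < 1" using pi_gt_zero mult_less_cancel_left_pos[of "2 * pi"] by simp
  then have "n = 0" by linarith
  then show "x = y" using r th n by (simp add: vec_eq_iff forall_3)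
qed

text \<open>Only a half plane is really missed, but discarding the whole plane
  \<open>x $ 2 = 0\<close> excludes the axis and the azimuths 0 and 2 pi in one stroke and is still
  negligible.\<close>

lemma polar3_image: "- {x. x $ 2 = 0} \<subseteq> polar3 ` polar3_dom"
proof
  fix x :: "real^3" assume "x \<in> - {x. x $ 2 = 0}"
  then have x2: "x $ 2 \<noteq> 0" by simp
  define q where "q = sqrt ((x$1)\<^sup>2 + (x$2)\<^sup>2)"
  define r where "r = norm x"
  have q: "q > 0" using x2 unfolding q_def by (simp add: sum_power2_gt_zero_iff)
  have r2: "r\<^sup>2 = q\<^sup>2 + (x$3)\<^sup>2" unfolding r_def q_def power2_norm_eq_inner inner_vec_def sum_3
    by (simp add: power2_eq_square)
  have r: "r > 0" unfolding r_def using x2 by auto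
  have "((x$3)/r)\<^sup>2 + (q/r)\<^sup>2 = 1" using r
      by (simp add: power_divide add_divide_distrib[symmetric] add.commute flip: r2)
  then obtain \<theta> where \<theta>: "0 \<le> \<theta>" "\<theta> \<le> pi" "x$3/r = cos \<theta>" "q/r = sin \<theta>"
    using sincos_total_pi[of "q/r" "x$3/r"] q r by auto
  have \<theta>': "0 < \<theta>" "\<theta> < pi"
    using \<theta> q r by (auto simp: less_le)
  have "(x$1/q)\<^sup>2 + (x$2/q)\<^sup>2 = 1"
    using q x2 by (simp add: power_divide add_divide_distrib[symmetric] q_def)
  then obtain \<phi> where \<phi>: "0 \<le> \<phi>" "\<phi> \<le> 2 * pi" "x$1/q = cos \<phi>" "x$2/q = sin \<phi>"
    using sincos_total_2pi_le by metis
  have \<phi>': "0 < \<phi>" "\<phi> < 2 * pi" using \<phi> x2 q by (auto simp: less_le)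
  have "x$3 = r * cos \<theta>" "q = r * sin \<theta>" "x$1 = q * cos \<phi>" "x$2 = q * sin \<phi>"
    using \<theta> \<phi> q r by (simp_all flip: \<theta>(3,4) \<phi>(3,4))
  then have "x = polar3 (vec3 (r, \<theta>, \<phi>))"
    by (simp add: vec_eq_iff forall_3 polar3_def)
  moreover have "vec3 (r, \<theta>, \<phi>) \<in> polar3_dom" using r \<theta>' \<phi>' by (simp add: polar3_dom_def)
  ultimately show "x \<in> polar3 ` polar3_dom" by blast
qed

lemma borel_measurable_sph [measurable]: "sph \<in> borel_measurable borel"
proof -
  have "continuous_on UNIV (\<lambda>t. sph t $ i)" for i
    using exhaust_3[of i] by (elim disjE) (simp_all, (intro continuous_intros)+)
  then have "continuous_on UNIV (\<lambda>t. \<chi> i. sph t $ i)"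
    by (rule continuous_on_vec_lambda)
  then show ?thesis by (simp add: borel_measurable_continuous_onI)
qed

lemma borel_measurable_polar3 [measurable]: "polar3 \<in> borel_measurable borel"
  unfolding polar3_def by measurable

lemma open_polar3_dom: "open polar3_dom"
  unfolding polar3_dom_def by (intro open_Collect_conj open_Collect_less continuous_intros)

lemma borel_polar3_dom [measurable]: "polar3_dom \<in> sets borel"
  by (intro borel_open open_polar3_dom)

lemma negligible_polar3_compl: "negligible (- polar3 ` polar3_dom)"
proof (rule negligible_subset)
  show "negligible {x :: real^3. x \<bullet> axis 2 1 = 0}"
    using negligible_standard_hyperplane[of "axis 2 1 :: real^3" 0] by (simp add: Basis_vec3)
  show "- polar3 ` polar3_dom \<subseteq> {x. x \<bullet> axis 2 1 = 0}"
    using polar3_image by (auto simp: inner_axis)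
qed

lemma lborel_polar3:
  "lborel = distr (density lborel (\<lambda>x. ennreal (indicator polar3_dom x * ((x$1)\<^sup>2
      * sin (x$2))))) borel polar3"
    (is "_ = ?N")
proof (rule lborel_eqI)
  fix l u :: "real^3" assume le: "\<And>b. b \<in> Basis \<Longrightarrow> l \<bullet> b \<le> u \<bullet> b"
  let ?c = "\<Prod>b\<in>(Basis:: (real^3) set). (u - l) \<bullet> b"
  let ?f = "indicat_real (box l u)"
  have "(?f has_integral ?c) UNIV"
  proof -
    have "(\<lambda>x. 1::real) integrable_on box l u" "integral (box l u) (\<lambda>x. 1::real) = ?c"
      using le by (auto simp: integral_open_interval content_cbox integrable_on_open_interval
          inner_diff_left)
    then have "((\<lambda>x. 1::real) has_integral ?c) (box l u)" by (simp add: has_integral_iff)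
    then have "((\<lambda>x. if x \<in> box l u then 1 else 0 :: real) has_integral ?c) UNIV"
      by (simp only: has_integral_restrict_UNIV)
    then show ?thesis by (rule has_integral_eq[rotated]) auto
  qed
  then have I: "(?f has_integral ?c) (polar3 ` polar3_dom)"
    by (subst has_integral_spike_set_eq[where T=UNIV]) (auto intro: negligible_subset[OF
        negligible_polar3_compl])
  then have "?f absolutely_integrable_on (polar3 ` polar3_dom)"
    by (intro nonnegative_absolutely_integrable_1) (auto simp: has_integral_iff)
  \<comment> \<open>The change-of-variables theorem is stated for functions into
    \<open>real^'n\<close>; the scalar indicator passes through it as a vector in
    \<open>real^1\<close>.\<close>
  with I have "(\<lambda>x. vec (?f x) :: real^1) absolutely_integrable_on (polar3 ` polar3_dom) \<and>
     integral (polar3 ` polar3_dom) (\<lambda>x. vec (?f x)) = (vec ?c :: real^1)"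
    by (simp add: absolutely_integrable_on_1_iff integral_on_1_eq has_integral_iff)
  then have "(\<lambda>x. \<bar>det (matrix ((*v) (polar3_jac x)))\<bar> *\<^sub>R (vec (?f (polar3 x)) :: real^1))
      absolutely_integrable_on polar3_dom \<and>
      integral polar3_dom (\<lambda>x. \<bar>det (matrix ((*v) (polar3_jac x)))\<bar> *\<^sub>R (vec (?f (polar3 x)) ::
          real^1)) = vec ?c"
    by (subst has_absolute_integral_change_of_variables)
      (auto intro: has_derivative_polar3 inj_polar3 lmeasurable_open simp: open_polar3_dom
          sets_completionI_sets)
  then have "((\<lambda>x. \<bar>(x$1)\<^sup>2 * sin (x$2)\<bar> * ?f (polar3 x)) has_integral ?c) polar3_dom"
    by (simp add: absolutely_integrable_on_1_iff integral_on_1_eq det_polar3_jac has_integral_iff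
       set_lebesgue_integral_eq_integral)
  then have J: "(\<integral>\<^sup>+x. ennreal (indicator polar3_dom x * (\<bar>(x$1)\<^sup>2 * sin (x$2)\<bar>
      * ?f (polar3 x))) \<partial>lborel) = ennreal ?c"
    by (intro nn_integral_has_integral_lebesgue) auto
  have "emeasure ?N (box l u) = (\<integral>\<^sup>+x. ennreal (indicator polar3_dom x * ((x$1)\<^sup>2 * sin (x$2)))
      * indicator (box l u) (polar3 x) \<partial>lborel)"
  proof -
    have [measurable]: "polar3 -` box l u \<in> sets borel"
      by (rule measurable_sets_borel[OF borel_measurable_polar3]) simp
    show ?thesis
      by (simp add: emeasure_distr) (subst emeasure_density, auto simp: indicator_def intro!:
          nn_integral_cong)
  qed
  also have "\<dots> = (\<integral>\<^sup>+x. ennreal (indicator polar3_dom x * (\<bar>(x$1)\<^sup>2 * sin (x$2)\<bar>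
      * ?f (polar3 x))) \<partial>lborel)"
  proof (rule nn_integral_cong)
    fix x
    have "sin (x$2) \<ge> 0" if "x \<in> polar3_dom"
      using that by (intro sin_ge_zero) (auto simp: polar3_dom_def)
    then show "ennreal (indicator polar3_dom x * ((x$1)\<^sup>2 * sin (x$2)))
        * indicator (box l u) (polar3 x)
      = ennreal (indicator polar3_dom x * (\<bar>(x$1)\<^sup>2 * sin (x$2)\<bar> * ?f (polar3 x)))"
      by (auto simp: indicator_def)
  qed
  finally show "emeasure ?N (box l u) = ennreal ?c" using J by simp
qed simp

text \<open>Surface measure of the unit sphere as a measure on all of \<open>real^3\<close>.
  Directions are then vectors, and once \<open>nn_integral_polar\<close> is proved the angles come
  back only in \<open>flux_eq_sflux\<close>.\<close>

definition sphere_measure :: "(real^3) measure" where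
  "sphere_measure = distr (density lborel (\<lambda>t. ennreal (indicator sph_params t
      * sin (fst t)))) borel sph"

lemma sets_sphere_measure [simp, measurable_cong]: "sets sphere_measure = sets borel"
  and space_sphere_measure [simp]: "space sphere_measure = UNIV"
  by (simp_all add: sphere_measure_def)

lemma borel_sph_params [measurable]: "sph_params \<in> sets borel"
  unfolding sph_params_def by (intro borel_Times) auto

lemma nn_integral_sphere_measure:
  assumes [measurable]: "f \<in> borel_measurable borel"
  shows "(\<integral>\<^sup>+x. f x \<partial>sphere_measure)
      = (\<integral>\<^sup>+t. ennreal (indicator sph_params t * sin (fst t)) * f (sph t) \<partial>lborel)"
  unfolding sphere_measure_def by (simp add: nn_integral_distr nn_integral_density)

lemma emeasure_sphere_measure_finite: "emeasure sphere_measure UNIV < \<infinity>"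
proof -
  have "emeasure sphere_measure UNIV = (\<integral>\<^sup>+x. 1 \<partial>sphere_measure)" by simp
  also have "\<dots> = (\<integral>\<^sup>+t. ennreal (indicator sph_params t * sin (fst t)) \<partial>lborel)"
    by (subst nn_integral_sphere_measure) auto
  also have "\<dots> \<le> (\<integral>\<^sup>+t. indicator sph_params t \<partial>lborel)"
    by (intro nn_integral_mono) (auto simp: indicator_def)
  also have "\<dots> = emeasure lborel sph_params" by simp
  also have "\<dots> < \<infinity>" unfolding sph_params_def
    by (subst emeasure_lborel_Times) (auto simp: ennreal_mult_less_top)
  finally show ?thesis .
qed

interpretation sphere_measure: finite_measure sphere_measure
  by standard (use emeasure_sphere_measure_finite in auto)

lemma AE_sphere_measure: "AE x in sphere_measure. norm x = 1"
  unfolding sphere_measure_def by (subst AE_distr_iff) (auto simp: AE_density)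

lemma AE_lborel_snd_neq: "AE t in (lborel :: (real \<times> real) measure). snd t \<noteq> c"
proof (rule AE_I)
  show "emeasure lborel (UNIV \<times> {c} :: (real\<times>real) set) = 0"
    by (subst emeasure_lborel_Times) auto
qed (auto simp: borel_Times)

lemma nn_integral_polar:
  assumes [measurable]: "f \<in> borel_measurable borel"
  shows "(\<integral>\<^sup>+x. f x \<partial>lborel) =
    (\<integral>\<^sup>+r. \<integral>\<^sup>+w. ennreal (indicator {0<..} r * r\<^sup>2) * f (r *\<^sub>R w) \<partial>sphere_measure \<partial>lborel)"
proof -
  let ?J = "\<lambda>x::real^3. ennreal (indicator polar3_dom x * ((x$1)\<^sup>2 * sin (x$2)))"
  let ?D = "\<lambda>t::real\<times>real. indicator {0<..<pi} (fst t) * indicator {0<..<2*pi} (snd t) :: real"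
  have "(\<integral>\<^sup>+x. f x \<partial>lborel) = (\<integral>\<^sup>+x. ?J x * f (polar3 x) \<partial>lborel)"
    by (subst lborel_polar3) (simp add: nn_integral_distr nn_integral_density)
  also have "\<dots> = (\<integral>\<^sup>+x. ?J (vec3 x) * f (polar3 (vec3 x)) \<partial>(lborel \<Otimes>\<^sub>M lborel))"
    unfolding lborel_prod by (subst lborel_vec3[symmetric], subst nn_integral_distr) auto
  also have "\<dots> = (\<integral>\<^sup>+r. \<integral>\<^sup>+t. ?J (vec3 (r,t)) * f (polar3 (vec3 (r,t))) \<partial>lborel \<partial>lborel)"
    by (subst lborel.nn_integral_fst[symmetric]) (unfold lborel_prod, auto)
  also have "\<dots> = (\<integral>\<^sup>+r. \<integral>\<^sup>+t. ennreal (indicator {0<..} r * r\<^sup>2) * (ennreal (indicator sph_params t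
      * sin (fst t)) * f (r *\<^sub>R sph t)) \<partial>lborel \<partial>lborel)"
  proof (rule nn_integral_cong, rule nn_integral_cong_AE)
    fix r :: real
    \<comment> \<open>The closed rectangle \<open>sph_params\<close> and the open angles of
      \<open>polar3_dom\<close> differ in edges: those of azimuth 0 and 2 pi are null, and on those
      of polar angle 0 and pi the sine makes both sides vanish.\<close>
    show "AE t in lborel. ?J (vec3 (r,t)) * f (polar3 (vec3 (r,t))) =
        ennreal (indicator {0<..} r * r\<^sup>2) * (ennreal (indicator sph_params t * sin (fst t))
            * f (r *\<^sub>R sph t))"
      using AE_lborel_snd_neq[of 0] AE_lborel_snd_neq[of "2*pi"]
    proof eventually_elim
      case (elim t)
      have "ennreal (indicator polar3_dom (vec3 (r,t)) * (r\<^sup>2 * sin (fst t)))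
        = ennreal (indicator {0<..} r * r\<^sup>2) * ennreal (indicator sph_params t * sin (fst t))"
      proof (cases "fst t = 0 \<or> fst t = pi")
        case True
        then have "sin (fst t) = 0" by (metis sin_zero sin_pi)
        then show ?thesis by simp
      next
        case False
        then have "vec3 (r,t) \<in> polar3_dom \<longleftrightarrow> r \<in> {0<..} \<and> t \<in> sph_params"
          using elim by (auto simp: polar3_dom_def sph_params_def mem_Times_iff)
        then have "indicator polar3_dom (vec3 (r,t)) * (r\<^sup>2 * sin (fst t))
          = (indicator {0<..} r * r\<^sup>2) * (indicator sph_params t * sin (fst t))"
          by (simp add: indicator_def)
        then show ?thesis by (simp only: ennreal_mult'[symmetric] zero_le_mult_iff zero_le_power2
            indicator_pos_le simp_thms)
      qed
      then show ?case by (simp add: polar3_def mult.assoc)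
    qed
  qed
  also have "\<dots> = (\<integral>\<^sup>+r. ennreal (indicator {0<..} r * r\<^sup>2) * (\<integral>\<^sup>+t. (ennreal (indicator sph_params t
      * sin (fst t)) * f (r *\<^sub>R sph t)) \<partial>lborel) \<partial>lborel)"
    by (simp add: nn_integral_cmult)
  also have "\<dots> = (\<integral>\<^sup>+r. ennreal (indicator {0<..} r * r\<^sup>2)
      * (\<integral>\<^sup>+w. f (r *\<^sub>R w) \<partial>sphere_measure) \<partial>lborel)"
    by (simp add: nn_integral_sphere_measure)
  also have "\<dots> = (\<integral>\<^sup>+r. \<integral>\<^sup>+w. ennreal (indicator {0<..} r * r\<^sup>2)
      * f (r *\<^sub>R w) \<partial>sphere_measure \<partial>lborel)"
    by (simp add: nn_integral_cmult)
  finally show ?thesis .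
qed

section \<open>Fluxes through spheres\<close>

interpretation polar: pair_sigma_finite lborel sphere_measure
  by unfold_locales

definition polar_measure :: "(real \<times> (real^3)) measure" where
  "polar_measure = density (lborel \<Otimes>\<^sub>M sphere_measure) (\<lambda>z. ennreal (indicator {0<..} (fst z)
      * (fst z)\<^sup>2))"

lemma sets_polar_measure [measurable_cong, simp]: "sets polar_measure = sets (borel \<Otimes>\<^sub>M borel)"
  unfolding polar_measure_def by (simp cong: sets_pair_measure_cong)

lemma nn_integral_lborel_translate:
  fixes f :: "'a::euclidean_space \<Rightarrow> ennreal"
  assumes [measurable]: "f \<in> borel_measurable borel"
  shows "(\<integral>\<^sup>+x. f (a + x) \<partial>lborel) = (\<integral>\<^sup>+x. f x \<partial>lborel)"
  by (subst (2) lborel_distr_plus[of a, symmetric]) (simp add: nn_integral_distr)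

text \<open>Stated as an equality of measures, so that null sets and Bochner integrability are
  transferred along with the values of integrals.\<close>

lemma lborel_eq_polar_measure: "lborel = distr polar_measure borel (\<lambda>z. a + fst z *\<^sub>R snd z)"
proof (rule measure_eqI)
  fix A :: "(real^3) set" assume "A \<in> sets lborel"
  then have A[measurable]: "A \<in> sets borel" by simp
  have "emeasure lborel A = (\<integral>\<^sup>+x. indicator A (a + x) \<partial>lborel)"
    by (subst nn_integral_lborel_translate) auto
  also have "\<dots> = (\<integral>\<^sup>+r. \<integral>\<^sup>+w. ennreal (indicator {0<..} r * r\<^sup>2) * indicator A (a
      + r *\<^sub>R w) \<partial>sphere_measure \<partial>lborel)"
    by (subst nn_integral_polar) auto
  also have "\<dots> = (\<integral>\<^sup>+z. ennreal (indicator {0<..} (fst z) * (fst z)\<^sup>2) * indicator A (a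
      + fst z *\<^sub>R snd z) \<partial>(lborel \<Otimes>\<^sub>M sphere_measure))"
    by (subst sphere_measure.nn_integral_fst[symmetric]) auto
  also have "\<dots> = (\<integral>\<^sup>+z. indicator A (a + fst z *\<^sub>R snd z) \<partial>polar_measure)"
    unfolding polar_measure_def by (subst nn_integral_density) auto
  also have "\<dots> = (\<integral>\<^sup>+x. indicator A x \<partial>distr polar_measure borel (\<lambda>z. a + fst z *\<^sub>R snd z))"
    by (subst nn_integral_distr) auto
  also have "\<dots> = emeasure (distr polar_measure borel (\<lambda>z. a + fst z *\<^sub>R snd z)) A"
    by simp
  finally show "emeasure lborel A
      = emeasure (distr polar_measure borel (\<lambda>z. a + fst z *\<^sub>R snd z)) A" .
qed simp

lemma nn_integral_polar':
  assumes [measurable]: "f \<in> borel_measurable borel"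
  shows "(\<integral>\<^sup>+x. f x \<partial>lborel) =
    (\<integral>\<^sup>+r. \<integral>\<^sup>+w. ennreal (indicator {0<..} r * r\<^sup>2) * f (a + r *\<^sub>R w) \<partial>sphere_measure \<partial>lborel)"
  using nn_integral_polar[of "\<lambda>x. f (a + x)"] nn_integral_lborel_translate[of f a] by simp

text \<open>This is what makes the flux independent of the representative of the field for almost
  every radius.\<close>

lemma AE_polar:
  assumes "AE y in lborel. P y"
  shows "AE r in lborel. r > 0 \<longrightarrow> (AE w in sphere_measure. P (a + r *\<^sub>R w))"
proof -
  have "AE y in distr polar_measure borel (\<lambda>z. a + fst z *\<^sub>R snd z). P y"
    by (subst lborel_eq_polar_measure[of a, symmetric]) (rule assms)
  then have "AE z in polar_measure. P (a + fst z *\<^sub>R snd z)"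
    by (rule AE_distrD[rotated]) simp
  then have "AE z in lborel \<Otimes>\<^sub>M sphere_measure. 0 < ennreal (indicator {0<..} (fst z) * (fst z)\<^sup>2)
      \<longrightarrow> P (a + fst z *\<^sub>R snd z)"
    unfolding polar_measure_def by (subst (asm) AE_density) auto
  from polar.AE_pair[OF this] show ?thesis
    by (auto elim!: eventually_mono)
qed

lemma
  fixes h :: "real^3 \<Rightarrow> 'b::{banach, second_countable_topology}"
  assumes h: "integrable lborel h"
  shows integrable_polar: "integrable (lborel \<Otimes>\<^sub>M sphere_measure) (\<lambda>(r, w). (indicator {0<..} r
      * r\<^sup>2) *\<^sub>R h (a + r *\<^sub>R w))"
    and integral_polar: "(LINT y|lborel. h y)
        = (LINT r|lborel. LINT w|sphere_measure. (indicator {0<..} r * r\<^sup>2) *\<^sub>R h (a + r *\<^sub>R w))"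
proof -
  have [measurable]: "h \<in> borel_measurable borel" using h by auto
  have "integrable polar_measure (\<lambda>z. h (a + fst z *\<^sub>R snd z))"
    using h by (subst (asm) lborel_eq_polar_measure[of a]) (subst (asm) integrable_distr_eq, auto)
  then show *: "integrable (lborel \<Otimes>\<^sub>M sphere_measure) (\<lambda>(r, w). (indicator {0<..} r * r\<^sup>2) *\<^sub>R h (a
      + r *\<^sub>R w))"
    unfolding polar_measure_def split_beta by (subst (asm) integrable_density) auto
  have "(LINT y|lborel. h y) = (LINT z|polar_measure. h (a + fst z *\<^sub>R snd z))"
    by (subst lborel_eq_polar_measure[of a]) (subst integral_distr, auto)
  also have "\<dots> = (LINT z|(lborel \<Otimes>\<^sub>M sphere_measure). (indicator {0<..} (fst z) * (fst z)\<^sup>2) *\<^sub>R h (a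
      + fst z *\<^sub>R snd z))"
    unfolding polar_measure_def split_beta by (subst integral_density) auto
  also have "\<dots> = (LINT r|lborel. LINT w|sphere_measure. (indicator {0<..} r * r\<^sup>2) *\<^sub>R h (a
      + r *\<^sub>R w))"
    using polar.integral_fst'[OF *[unfolded case_prod_unfold]] by simp
  finally show "(LINT y|lborel. h y)
      = (LINT r|lborel. LINT w|sphere_measure. (indicator {0<..} r * r\<^sup>2) *\<^sub>R h (a + r *\<^sub>R w))" .
qed

text \<open>The flux as a total function. On spheres where the integrand is not integrable the
  Bochner integral yields 0; for an integrable field \<open>AE_integrable_sphere\<close> confines
  them to a null set of radii.\<close>

definition sflux :: "(real^3 \<Rightarrow> real^3) \<Rightarrow> real^3 \<Rightarrow> real \<Rightarrow> real" where
  "sflux X a r = r\<^sup>2 * (LINT w|sphere_measure. X (a + r *\<^sub>R w) \<bullet> w)"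

lemma borel_measurable_sflux [measurable]:
  assumes [measurable]: "X \<in> borel_measurable borel"
  shows "(\<lambda>z. sflux X (fst z) (snd z)) \<in> borel_measurable (borel \<Otimes>\<^sub>M borel)"
proof -
  have [measurable]: "(\<lambda>z. LINT w|sphere_measure. X (fst z + snd z *\<^sub>R w)
      \<bullet> w) \<in> borel_measurable (borel \<Otimes>\<^sub>M borel)"
    by (rule sphere_measure.borel_measurable_lebesgue_integral) (simp add: split_beta)
  show ?thesis unfolding sflux_def by measurable
qed

lemma borel_measurable_sflux2 [measurable]:
  assumes [measurable]: "X \<in> borel_measurable borel" "f \<in> borel_measurable M" "g \<in> borel_measurable M"
  shows "(\<lambda>z. sflux X (f z) (g z)) \<in> borel_measurable M"
  using measurable_compose[OF _ borel_measurable_sflux[OF assms(1)], of "\<lambda>z. (f z, g z)" M] by simp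

lemma integrable_bounded_mult:
  fixes f :: "'a \<Rightarrow> real"
  assumes "integrable M f" and [measurable]: "w \<in> borel_measurable M" and "\<And>x. \<bar>w x\<bar> \<le> B"
  shows "integrable M (\<lambda>x. w x * f x)"
proof (rule Bochner_Integration.integrable_bound)
  show "integrable M (\<lambda>x. B * f x)" using assms by simp
  have "\<bar>w x * f x\<bar> \<le> \<bar>B * f x\<bar>" for x
    using assms(3)[of x] by (auto simp: abs_mult intro!: mult_right_mono)
  then show "AE x in M. norm (w x * f x) \<le> norm (B * f x)" by simp
qed (use assms in auto)

lemma integrable_inner_bounded:
  fixes X :: "'a \<Rightarrow> 'b::euclidean_space"
  assumes X: "integrable M X" and [measurable]: "u \<in> borel_measurable M" and "\<And>x. norm (u x) \<le> B"
  shows "integrable M (\<lambda>x. X x \<bullet> u x)"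
proof (rule Bochner_Integration.integrable_bound)
  show "integrable M (\<lambda>x. B *\<^sub>R X x)" using assms by simp
  have "\<bar>X x \<bullet> u x\<bar> \<le> norm (B *\<^sub>R X x)" for x
    using assms(3)[of x] order_trans[OF Cauchy_Schwarz_ineq2[of "X x" "u x"] mult_left_mono[OF
        assms(3)[of x], of "norm (X x)"]] norm_ge_zero[of "u x"]
    by (auto simp: mult.commute intro: order_trans[OF _ mult_right_mono])
  then show "AE x in M. norm (X x \<bullet> u x) \<le> norm (B *\<^sub>R X x)" by simp
qed (use assms in auto)

context
  fixes X :: "real^3 \<Rightarrow> real^3" and w :: "real \<Rightarrow> real" and B :: real and a :: "real^3"
  assumes X: "integrable lborel X" and w [measurable]: "w \<in> borel_measurable borel" and B: "\<And>r. \<bar>w r\<bar>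
      \<le> B"
begin

lemma integrable_radial: "integrable lborel (\<lambda>y. X y \<bullet> (w (norm (y - a)) *\<^sub>R sgn (y - a)))"
proof (rule integrable_inner_bounded[OF X])
  fix x show "norm (w (norm (x - a)) *\<^sub>R sgn (x - a)) \<le> B"
    using B[of "norm (x - a)"] by (auto simp: norm_sgn)
qed simp

lemma AE_sphere_measure_radial: "r > 0
    \<Longrightarrow> AE \<omega> in sphere_measure. (indicator {0<..} r * r\<^sup>2) *\<^sub>R (X (a + r *\<^sub>R \<omega>) \<bullet> (w (norm (a + r *\<^sub>R \<omega>
    - a)) *\<^sub>R sgn (a + r *\<^sub>R \<omega> - a)))
   = (w r * r\<^sup>2) * (X (a + r *\<^sub>R \<omega>) \<bullet> \<omega>)"
  using AE_sphere_measure by eventually_elim (auto simp: sgn_div_norm)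

lemma radial_inner: "(LINT \<omega>|sphere_measure. (indicator {0<..} r * r\<^sup>2) *\<^sub>R (X (a + r *\<^sub>R \<omega>)
    \<bullet> (w (norm (a + r *\<^sub>R \<omega> - a)) *\<^sub>R sgn (a + r *\<^sub>R \<omega> - a))))
   = indicator {0<..} r * (w r * sflux X a r)"
proof (cases "r > 0")
  case True
  have [measurable]: "X \<in> borel_measurable borel" using X by auto
  have "(LINT \<omega>|sphere_measure. (indicator {0<..} r * r\<^sup>2) *\<^sub>R (X (a + r *\<^sub>R \<omega>) \<bullet> (w (norm (a
      + r *\<^sub>R \<omega> - a)) *\<^sub>R sgn (a + r *\<^sub>R \<omega> - a))))
     = (LINT \<omega>|sphere_measure. (w r * r\<^sup>2) * (X (a + r *\<^sub>R \<omega>) \<bullet> \<omega>))"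
    by (intro integral_cong_AE AE_sphere_measure_radial True) auto
  then show ?thesis using True by (simp add: sflux_def)
qed simp

text \<open>On the sphere of radius \<open>r\<close> about \<open>a\<close> the vector
  \<open>sgn (y - a)\<close> is the outward normal, so the inner integral in polar coordinates is
  the flux.\<close>

lemma integral_radial: "(LINT y|lborel. X y \<bullet> (w (norm (y - a)) *\<^sub>R sgn (y - a)))
    = (LINT r|lborel. indicator {0<..} r * (w r * sflux X a r))"
  by (subst integral_polar[OF integrable_radial, of a], subst radial_inner) simp

lemma integrable_sflux: "integrable lborel (\<lambda>r. indicator {0<..} r * (w r * sflux X a r))"
  using polar.integrable_fst'[OF integrable_polar[OF integrable_radial, of a]]
  unfolding case_prod_conv radial_inner .

end

lemma AE_integrable_sphere:
  assumes X: "integrable lborel X"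
  shows "AE r in lborel. r > 0 \<longrightarrow> integrable sphere_measure (\<lambda>w. X (a + r *\<^sub>R w) \<bullet> w)"
proof -
  have [measurable]: "X \<in> borel_measurable borel" using X by auto
  have "integrable lborel (\<lambda>y. X y \<bullet> (1 *\<^sub>R sgn (y - a)))"
    by (rule integrable_radial[OF X, of "\<lambda>_. 1" 1 a]) auto
  from polar.AE_integrable_fst'[OF integrable_polar[OF this, of a]] show ?thesis
  proof eventually_elim
    case (elim r)
    show ?case
    proof
      assume r: "r > 0"
      have ae: "AE \<omega> in sphere_measure. (indicator {0<..} r * r\<^sup>2) *\<^sub>R (X (a + r *\<^sub>R \<omega>)
          \<bullet> (1 *\<^sub>R sgn (a + r *\<^sub>R \<omega> - a)))
          = (1 * r\<^sup>2) * (X (a + r *\<^sub>R \<omega>) \<bullet> \<omega>)"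
        by (rule AE_sphere_measure_radial[OF X, of "\<lambda>_. 1" 1 r a]) (use r in auto)
      have "(\<lambda>\<omega>. (indicator {0<..} r * r\<^sup>2) *\<^sub>R (X (a + r *\<^sub>R \<omega>) \<bullet> (1 *\<^sub>R sgn (a + r *\<^sub>R \<omega>
          - a)))) \<in> borel_measurable sphere_measure"
        "(\<lambda>\<omega>. (1 * r\<^sup>2) * (X (a + r *\<^sub>R \<omega>) \<bullet> \<omega>)) \<in> borel_measurable sphere_measure"
        by measurable
      from iffD1[OF integrable_cong_AE[OF this ae] elim[unfolded case_prod_conv]]
      have "integrable sphere_measure (\<lambda>w. (1 * r\<^sup>2) * (X (a + r *\<^sub>R w) \<bullet> w))" .
      then show "integrable sphere_measure (\<lambda>w. X (a + r *\<^sub>R w) \<bullet> w)"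
        using r by simp
    qed
  qed
qed

text \<open>No measurability of \<open>X\<close> is assumed: \<open>lebesgue\<close> is complete, so
  the integrand of \<open>flux\<close>, which agrees almost everywhere with a Borel function,
  inherits measurability and integrability from it.\<close>

lemma flux_eq_sflux:
  assumes [measurable]: "X' \<in> borel_measurable borel"
    and ae: "AE w in sphere_measure. X (a + r *\<^sub>R w) = X' (a + r *\<^sub>R w)"
    and int: "integrable sphere_measure (\<lambda>w. X' (a + r *\<^sub>R w) \<bullet> w)"
  shows "flux_defined X a r \<and> flux X a r = sflux X' a r"
proof -
  let ?J = "\<lambda>t. indicator sph_params t * sin (fst t)"
  let ?h = "\<lambda>w. X' (a + r *\<^sub>R w) \<bullet> w"
  have J: "?J t \<ge> 0" for t
    by (cases t) (auto simp: indicator_def sph_params_def intro: sin_ge_zero)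
  have int': "integrable lborel (\<lambda>t. ?J t *\<^sub>R ?h (sph t))"
    using int unfolding sphere_measure_def
    by (subst (asm) integrable_distr_eq) (auto simp: integrable_density J)
  have eq: "integral\<^sup>L sphere_measure ?h = integral\<^sup>L lborel (\<lambda>t. ?J t *\<^sub>R ?h (sph t))"
    unfolding sphere_measure_def by (subst integral_distr) (auto simp: integral_density J)
  have "AE t in lborel. 0 < ennreal (?J t) \<longrightarrow> X (a + r *\<^sub>R sph t) = X' (a + r *\<^sub>R sph t)"
  proof -
    have "AE t in density lborel (\<lambda>t. ennreal (?J t)). X (a + r *\<^sub>R sph t) = X' (a + r *\<^sub>R sph t)"
      by (rule AE_distrD[OF _ ae[unfolded sphere_measure_def]]) simp
    then show ?thesis by (subst (asm) AE_density) auto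
  qed
  then have "AE t in lborel. r\<^sup>2 * (?J t *\<^sub>R ?h (sph t))
      = indicator sph_params t *\<^sub>R flux_density X a r t"
  proof eventually_elim
    case (elim t)
    then show ?case using J[of t] by (cases "?J t = 0") (auto simp: flux_density_def mult_ac)
  qed
  then have ae': "AE t in lebesgue. r\<^sup>2 * (?J t *\<^sub>R ?h (sph t))
      = indicator sph_params t *\<^sub>R flux_density X a r t"
    by (rule AE_completion)
  have m: "(\<lambda>t. r\<^sup>2 * (?J t *\<^sub>R ?h (sph t))) \<in> borel_measurable lborel" by measurable
  have m': "(\<lambda>t. indicator sph_params t *\<^sub>R flux_density X a r t) \<in> borel_measurable lebesgue"
    by (rule borel_measurable_AE[OF measurable_completion[OF m] ae'])
  have "integrable lebesgue (\<lambda>t. r\<^sup>2 * (?J t *\<^sub>R ?h (sph t)))"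
    using int' m by (subst integrable_completion) auto
  then have "integrable lebesgue (\<lambda>t. indicator sph_params t *\<^sub>R flux_density X a r t)"
    using integrable_cong_AE[OF measurable_completion[OF m] m' ae'] by simp
  moreover have "(LINT t|lebesgue. indicator sph_params t *\<^sub>R flux_density X a r t)
      = (LINT t|lebesgue. r\<^sup>2 * (?J t *\<^sub>R ?h (sph t)))"
    using integral_cong_AE[OF measurable_completion[OF m] m' ae'] by simp
  moreover have "(LINT t|lebesgue. r\<^sup>2 * (?J t *\<^sub>R ?h (sph t))) = sflux X' a r"
    unfolding sflux_def eq using m by (subst integral_completion) auto
  ultimately show ?thesis
    by (simp add: flux_defined_def flux_def set_integrable_def set_lebesgue_integral_def)
qed

lemma flux_AE_sflux:
  assumes X': "integrable lborel X'" and ae: "AE y in lborel. y \<in> B3 \<longrightarrow> X y = X' y"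
  shows "AE r in lborel. 0 < r \<and> r < 1 - norm a \<longrightarrow> flux_defined X a r \<and> flux X a r = sflux X' a r"
  using AE_polar[OF ae, of a] AE_integrable_sphere[OF X', of a]
proof eventually_elim
  case (elim r)
  show ?case
  proof
    assume r: "0 < r \<and> r < 1 - norm a"
    with elim have "AE w in sphere_measure. a + r *\<^sub>R w \<in> B3 \<longrightarrow> X (a + r *\<^sub>R w) = X' (a + r *\<^sub>R w)"
      by blast
    then have "AE w in sphere_measure. X (a + r *\<^sub>R w) = X' (a + r *\<^sub>R w)"
      using AE_sphere_measure
    proof eventually_elim
      case (elim w)
      have "norm (a + r *\<^sub>R w) < 1" using r elim norm_triangle_ineq[of a "r *\<^sub>R w"] by simp
      then show ?case using elim by (simp add: B3_def)
    qed
    then show "flux_defined X a r \<and> flux X a r = sflux X' a r"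
      using elim r X' by (intro flux_eq_sflux) auto
  qed
qed

text \<open>The components are corrected on null sets one by one. The final factor
  \<open>indicator S\<close> makes the extension by zero exact outside \<open>S\<close>, not merely
  almost everywhere.\<close>

lemma ex_borel_version:
  fixes X :: "'a::euclidean_space \<Rightarrow> real^'n"
  assumes "X \<in> borel_measurable (lebesgue_on S)" and [measurable]: "S \<in> sets borel"
  obtains X' where "X' \<in> borel_measurable borel" "AE y in lborel. y \<in> S \<longrightarrow> X y = X' y" "\<And>y. y \<notin> S
      \<Longrightarrow> X' y = 0"
proof -
  from measurable_compose[OF assms(1) borel_measurable_nth]
  have "(\<lambda>y. indicator S y * (X y $ i)) \<in> borel_measurable lebesgue" for i
    using borel_measurable_restrict_space_iff[of S lebesgue "\<lambda>y. X y $ i"] 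
    by (auto simp: sets_completionI_sets)
  then have "\<forall>i. \<exists>g\<in>borel_measurable lborel. AE y in lborel. indicator S y * (X y $ i) = g y"
    by (intro allI completion_ex_borel_measurable_real)
  then obtain g where g: "\<And>i. g i \<in> borel_measurable lborel" "\<And>i. AE y in lborel. indicator S y
      * (X y $ i) = g i y"
    by metis
  have g1 [measurable]: "g i \<in> borel_measurable borel" for i using g(1)[of i] by simp
  define X' where "X' y = (\<chi> i. indicator S y * g i y)" for y
  have "(\<lambda>y. X' y \<bullet> b) \<in> borel_measurable borel" if "b \<in> Basis" for b
    using that unfolding X'_def by (auto simp: Basis_vec_def inner_axis)
  then have "X' \<in> borel_measurable borel" by (subst borel_measurable_euclidean_space) auto
  moreover have "AE y in lborel. \<forall>i. indicator S y * (X y $ i) = g i y"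
    using g(2) by (subst AE_all_countable) auto
  then have "AE y in lborel. y \<in> S \<longrightarrow> X y = X' y"
    by eventually_elim (auto simp: X'_def vec_eq_iff)
  ultimately show ?thesis using that[of X'] by (auto simp: X'_def vec_eq_iff)
qed

text \<open>The positive and the negative part of \<open>f\<close> are densities of measures that
  are finite and equal on all half-lines, hence equal, and densities are unique almost
  everywhere.\<close>

lemma AE_zero_if_intervals_zero:
  fixes f :: "real \<Rightarrow> real"
  assumes f: "integrable lborel f" and supp: "\<And>r. r \<notin> {0<..T} \<Longrightarrow> f r = 0"
    and zero: "\<And>s. 0 \<le> s \<Longrightarrow> s < T \<Longrightarrow> (LINT r|lborel. indicator {s..T} r * f r) = 0"
  shows "AE r in lborel. f r = 0"
proof -
  have [measurable]: "f \<in> borel_measurable borel" using f by auto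
  have int: "integrable lborel (\<lambda>r. indicator {x<..} r * f r)" for x
    by (rule integrable_bounded_mult[OF f, of _ 1]) (auto simp: indicator_def)
  have z: "(LINT r|lborel. indicator {x<..} r * f r) = 0" for x
  proof (cases "x < T")
    case True
    have "AE r in lborel. indicator {x<..} r * f r = indicator {max x 0..T} r * f r"
      using AE_lborel_singleton[of "max x 0"]
    proof eventually_elim
      case (elim r)
      then show ?case using supp[of r] by (auto simp: indicator_def)
    qed
    then have "(LINT r|lborel. indicator {x<..} r * f r)
        = (LINT r|lborel. indicator {max x 0..T} r * f r)"
      by (intro integral_cong_AE) auto
    also have "\<dots> = 0"
    proof (cases "max x 0 < T")
      case True then show ?thesis by (intro zero) auto
    next
      case False
      then have "f r = 0" for r using True supp[of r] by auto
      then show ?thesis by simp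
    qed
    finally show ?thesis .
  next
    case False
    then have "(\<lambda>r. indicator {x<..} r * f r) = (\<lambda>_. 0)" using supp
        by (auto simp: indicator_def fun_eq_iff)
    then show ?thesis by (simp only: integral_zero)
  qed
  let ?P = "\<lambda>x. (\<integral>\<^sup>+r. ennreal (indicator {x<..} r * f r) \<partial>lborel)"
  let ?N = "\<lambda>x. (\<integral>\<^sup>+r. ennreal (- (indicator {x<..} r * f r)) \<partial>lborel)"
  have eq: "(?P x) = (?N x)"
     and fin: "(?P x) < \<infinity>" for x
  proof -
    have "enn2real (?P x) = enn2real (?N x)"
      using z[of x] real_lebesgue_integral_def[OF int[of x]] by simp
    moreover have "(?P x) < \<infinity>" "(?N x) < \<infinity>"
      using int[of x] unfolding real_integrable_def by (auto simp: less_top)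
    ultimately show "(?P x) = (?N x)"
      "(?P x) < \<infinity>"
      by (metis ennreal_enn2real infinity_ennreal_def)+
  qed
  have *: "emeasure (density lborel (\<lambda>r. ennreal (g r))) {x<..}
      = (\<integral>\<^sup>+r. ennreal (indicator {x<..} r * g r) \<partial>lborel)"
    if [measurable]: "g \<in> borel_measurable borel" for g :: "real \<Rightarrow> real" and x
    by (subst emeasure_density) (auto simp: indicator_def intro!: nn_integral_cong)
  have "density lborel (\<lambda>r. ennreal (f r)) = density lborel (\<lambda>r. ennreal (- f r))"
  proof (rule measure_eqI_lessThan)
    show "emeasure (density lborel (\<lambda>r. ennreal (f r))) {x<..} < \<infinity>" for x
      using fin[of x] by (simp add: *)
    show "emeasure (density lborel (\<lambda>r. ennreal (f r))) {x<..}
        = emeasure (density lborel (\<lambda>r. ennreal (- f r))) {x<..}" for x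
      using eq[of x] by (simp add: *)
  qed auto
  then have "AE r in lborel. ennreal (f r) = ennreal (- f r)"
    by (intro sigma_finite_measure.density_unique[OF sigma_finite_lborel]) auto
  \<comment> \<open>\<open>ennreal\<close> cuts negative numbers off at 0, so the two sides can only
    agree when \<open>f r = 0\<close>.\<close>
  then show ?thesis
    by eventually_elim (metis abs_of_nonneg abs_of_nonpos ennreal_eq_0_iff ennreal_neg
        less_eq_real_def linear neg_0_less_iff_less not_less)
qed

section \<open>Tent functions and integration by parts\<close>

text \<open>\<open>tent s t\<close> is the Lipschitz radial test function with gradient \<open>- rad s t\<close>: testing the
  divergence with it integrates the flux over radii in \<open>{s..t}\<close>.\<close>
definition tent :: "real \<Rightarrow> real \<Rightarrow> 'a::real_normed_vector \<Rightarrow> real" where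
  "tent s t z = max 0 (min (t - s) (t - norm z))"

definition rad :: "real \<Rightarrow> real \<Rightarrow> 'a::real_normed_vector \<Rightarrow> 'a" where
  "rad s t z = indicator {s..t} (norm z) *\<^sub>R sgn z"

lemma borel_measurable_tent [measurable]: "tent s t \<in> borel_measurable borel"
  unfolding tent_def by measurable

lemma borel_measurable_rad [measurable]: "(rad s t :: 'a::euclidean_space \<Rightarrow> 'a) \<in> borel_measurable
    borel"
  unfolding rad_def by measurable

lemma tent_nonneg [simp]: "0 \<le> tent s t z" by (simp add: tent_def)
lemma tent_le: "s \<le> t \<Longrightarrow> tent s t z \<le> t - s" by (simp add: tent_def)
lemma tent_minus [simp]: "tent s t (- z) = tent s t z" by (simp add: tent_def)
lemma tent_commute: "tent s t (a - b) = tent s t (b - a)" by (simp add: tent_def norm_minus_commute)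
lemma tent_eq_0: "norm z \<ge> t \<Longrightarrow> tent s t z = 0" by (simp add: tent_def)
lemma tent_Lipschitz: "\<bar>tent s t x - tent s t y\<bar> \<le> norm (x - y)"
  using norm_triangle_ineq3[of x y] by (auto simp: tent_def max_def min_def)

lemma norm_rad_le: "norm (rad s t z) \<le> 1" by (auto simp: rad_def norm_sgn indicator_def)
lemma rad_minus [simp]: "rad s t (- z) = - rad s t z" by (simp add: rad_def sgn_minus)

lemma has_derivative_tent:
  fixes z :: "'a::real_inner"
  assumes "z \<noteq> 0" "norm z \<noteq> s" "norm z \<noteq> t" "s \<le> t"
  shows "(tent s t has_derivative (\<lambda>h. - (rad s t z \<bullet> h))) (at z)"
proof -
  consider "norm z < s" | "s < norm z" "norm z < t" | "t < norm z" using assms by linarith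
  then show ?thesis
  proof cases
    case 1
    have "((\<lambda>_. t - s) has_derivative (\<lambda>h. - (rad s t z \<bullet> h))) (at z)"
      using 1 by (simp add: rad_def)
    moreover have "open {x::'a. norm x < s}" by (intro open_Collect_less continuous_intros)
    ultimately show ?thesis
      by (rule has_derivative_transform_within_open) (use 1 assms in \<open>auto simp: tent_def\<close>)
  next
    case 2
    have "((\<lambda>x. t - norm x) has_derivative (\<lambda>h. - (rad s t z \<bullet> h))) (at z)"
      using 2 assms by (auto simp: rad_def inner_commute intro!: derivative_eq_intros
          has_derivative_norm)
    moreover have "open {x::'a. s < norm x \<and> norm x < t}"
      by (intro open_Collect_conj open_Collect_less continuous_intros)
    ultimately show ?thesis
      by (rule has_derivative_transform_within_open) (use 2 assms in \<open>auto simp: tent_def\<close>)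
  next
    case 3
    have "((\<lambda>_. 0) has_derivative (\<lambda>h. - (rad s t z \<bullet> h))) (at z)"
      using 3 by (simp add: rad_def)
    moreover have "open {x::'a. t < norm x}" by (intro open_Collect_less continuous_intros)
    ultimately show ?thesis
      by (rule has_derivative_transform_within_open) (use 3 assms in \<open>auto simp: tent_def\<close>)
  qed
qed

lemma AE_norm_diff_neq: "AE y in lborel. norm (y - a :: 'a::euclidean_space) \<noteq> c"
proof -
  have "AE z in lebesgue. z \<notin> sphere a c"
    using negligible_sphere[of a c] unfolding negligible_iff_null_sets by (rule AE_not_in)
  then show ?thesis by (auto simp: AE_completion_iff dist_norm norm_minus_commute)
qed

lemma AE_norm_neq: "AE z in lborel. norm (z :: 'a::euclidean_space) \<noteq> c"
  using AE_norm_diff_neq[of 0 c] by simp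

lemma LIMSEQ_tent_quotient:
  fixes z e :: "'a::real_inner"
  assumes "z \<noteq> 0" "norm z \<noteq> s" "norm z \<noteq> t" "s \<le> t"
  shows "(\<lambda>n. (tent s t (z + inverse (real (Suc n)) *\<^sub>R e) - tent s t z) / inverse (real (Suc n)))
     \<longlonglongrightarrow> - (rad s t z \<bullet> e)"
proof -
  have "((\<lambda>h. z + h *\<^sub>R e) has_derivative (\<lambda>h. h *\<^sub>R e)) (at 0)"
    by (auto intro!: derivative_eq_intros)
  then have **: "((\<lambda>h. tent s t (z + h *\<^sub>R e)) has_derivative (\<lambda>h. - (rad s t z \<bullet> (h *\<^sub>R e)))) (at 0)"
    by (rule has_derivative_compose) (use has_derivative_tent[OF assms] in simp)
  have "((\<lambda>h. tent s t (z + h *\<^sub>R e)) has_field_derivative (- (rad s t z \<bullet> e))) (at 0)"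
  proof -
    have "(\<lambda>h. - (rad s t z \<bullet> (h *\<^sub>R e))) = (*) (- (rad s t z \<bullet> e))" by (simp add: fun_eq_iff)
    then show ?thesis using ** unfolding has_field_derivative_def by metis
  qed
  then have *: "((\<lambda>h. (tent s t (z + h *\<^sub>R e) - tent s t z) / h) \<longlongrightarrow> - (rad s t z \<bullet> e)) (at 0)"
    by (simp add: DERIV_def)
  have "filterlim (\<lambda>n. inverse (real (Suc n))) (at 0) sequentially"
    by (intro filterlim_atI LIMSEQ_inverse_real_of_nat) auto
  from filterlim_compose[OF * this] show ?thesis .
qed

lemma integrable_bounded_support:
  fixes f :: "'a::euclidean_space \<Rightarrow> 'b::{banach, second_countable_topology}"
  assumes [measurable]: "f \<in> borel_measurable borel" and "\<And>x. norm (f x) \<le> B" "\<And>x. x \<notin> cball a R \<Longrightarrow> f x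
      = 0"
  shows "integrable lborel f"
proof (rule Bochner_Integration.integrable_bound)
  show "integrable lborel (\<lambda>x. indicator (cball a R) x * B)"
    by (intro integrable_mult_left integrable_real_indicator) (auto simp:
        emeasure_lborel_cball_finite[unfolded infinity_ennreal_def])
  show "AE x in lborel. norm (f x) \<le> norm (indicator (cball a R) x * B)"
  proof (rule AE_I2)
    fix x show "norm (f x) \<le> norm (indicator (cball a R) x * B)"
      using assms(2)[of x] assms(3)[of x] norm_ge_zero[of "f x"] by (cases "x \<in> cball a R") auto
  qed
qed simp

text \<open>Dominated convergence needs a sequence of step lengths; the Lipschitz bound of the tent
  gives the majorant, and the kinks lie on null spheres.\<close>

lemma LIMSEQ_integral_tent_quotient:
  fixes e :: "'a::euclidean_space"
  assumes [measurable]: "g \<in> borel_measurable borel" and B: "\<And>u. \<bar>g u\<bar> \<le> B" and R: "\<And>u. u \<notin> cball a R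
      \<Longrightarrow> g u = 0"
    and st: "s \<le> t"
  shows "(\<lambda>n. LINT u|lborel. g u * ((tent s t (u + inverse (real (Suc n)) *\<^sub>R e) - tent s t u)
      / inverse (real (Suc n))))
      \<longlonglongrightarrow> (LINT u|lborel. g u * - (rad s t u \<bullet> e))"
proof (rule integral_dominated_convergence)
  show "integrable lborel (\<lambda>u. \<bar>g u\<bar> * norm e)"
    using integrable_bounded_support[of g B a R] B R
        by (auto intro!: integrable_mult_left integrable_abs)
  show "AE u in lborel. (\<lambda>n. g u * ((tent s t (u + inverse (real (Suc n)) *\<^sub>R e) - tent s t u)
      / inverse (real (Suc n)))) \<longlonglongrightarrow> g u * - (rad s t u \<bullet> e)"
    using AE_norm_neq[of 0] AE_norm_neq[of s] AE_norm_neq[of t]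
  proof eventually_elim
    case (elim u)
    then show ?case using st by (intro tendsto_mult tendsto_const LIMSEQ_tent_quotient) auto
  qed
  fix n
  have "\<bar>(tent s t (u + inverse (real (Suc n)) *\<^sub>R e) - tent s t u) / inverse (real (Suc n))\<bar>
      \<le> norm e" for u
  proof -
    define h where "h = inverse (real (Suc n))"
    have h: "h > 0" by (simp add: h_def)
    have "\<bar>tent s t (u + h *\<^sub>R e) - tent s t u\<bar> \<le> h * norm e"
      using tent_Lipschitz[of s t "u + h *\<^sub>R e" u] h by simp
    then have "\<bar>(tent s t (u + h *\<^sub>R e) - tent s t u) / h\<bar> \<le> norm e"
      using h by (simp add: abs_divide pos_divide_le_eq mult.commute)
    then show ?thesis unfolding h_def .
  qed
  then show "AE u in lborel. norm (g u * ((tent s t (u + inverse (real (Suc n)) *\<^sub>R e) - tent s t u)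
      / inverse (real (Suc n)))) \<le> \<bar>g u\<bar> * norm e"
    by (intro AE_I2) (simp only: real_norm_def abs_mult mult_left_mono abs_ge_zero)
qed measurable

lemma integral_lborel_translate:
  fixes f :: "'a::euclidean_space \<Rightarrow> 'b::{banach, second_countable_topology}"
  assumes [measurable]: "f \<in> borel_measurable borel"
  shows "(LINT x|lborel. f (a + x)) = (LINT x|lborel. f x)"
  by (subst (2) lborel_distr_plus[of a, symmetric]) (simp add: integral_distr)

lemma lborel_distr_reflect: "distr lborel borel (\<lambda>x. a - x) = (lborel :: 'a::euclidean_space measure)"
  by (subst (2) lborel_affine[of "-1" a]) (auto simp: density_1)

lemma integral_lborel_reflect:
  fixes f :: "'a::euclidean_space \<Rightarrow> 'b::{banach, second_countable_topology}"
  assumes [measurable]: "f \<in> borel_measurable borel"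
  shows "(LINT x|lborel. f (a - x)) = (LINT x|lborel. f x)"
  by (subst (2) lborel_distr_reflect[of a, symmetric]) (simp add: integral_distr)

lemma tent_bound: "s \<le> t \<Longrightarrow> \<bar>tent s t z\<bar> \<le> t - s"
  using tent_le[of s t z] by simp

text \<open>Integration by parts, with the gradients replaced by difference quotients.\<close>
lemma tent_rad_inner:
  fixes z e :: "'a::euclidean_space"
  assumes st: "s \<le> t" "s' \<le> t'"
  shows "(LINT u|lborel. tent s t (z + u) * (rad s' t' u \<bullet> e))
      = - (LINT v|lborel. tent s' t' (v - z) * (rad s t v \<bullet> e))"
proof -
  let ?h = "\<lambda>n. inverse (real (Suc n))"
  have int: "integrable lborel (\<lambda>u. tent s t (a + u) * tent s' t' (b + u))" for a b :: 'a
  proof (rule integrable_bounded_support[of _ "(t - s) * (t' - s')" "- a" t])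
    show "norm (tent s t (a + u) * tent s' t' (b + u)) \<le> (t - s) * (t' - s')" for u
      using tent_le[of s t "a+u"] tent_le[of s' t' "b+u"] st
          by (auto simp: abs_mult intro!: mult_mono)
    show "tent s t (a + u) * tent s' t' (b + u) = 0" if "u \<notin> cball (- a) t" for u
      using that by (auto simp: dist_norm tent_eq_0 norm_minus_commute algebra_simps)
  qed measurable
  have A: "(\<lambda>n. LINT u|lborel. tent s t (z + u) * ((tent s' t' (u + ?h n *\<^sub>R e) - tent s' t' u)
      / ?h n))
      \<longlonglongrightarrow> (LINT u|lborel. tent s t (z + u) * - (rad s' t' u \<bullet> e))"
  proof (rule LIMSEQ_integral_tent_quotient[of _ "t - s" "- z" t])
    show "\<bar>tent s t (z + u)\<bar> \<le> t - s" for u using tent_bound[OF st(1)] .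
    show "tent s t (z + u) = 0" if "u \<notin> cball (- z) t" for u
      using that norm_minus_cancel[of "z + u"] by (intro tent_eq_0) (simp add: dist_norm)
  qed (use st in auto)
  \<comment> \<open>Moving a difference quotient from one factor to the other by translation
    reverses the step, hence the direction \<open>- e\<close>.\<close>
  have B: "(\<lambda>n. LINT v|lborel. tent s' t' (v - z) * ((tent s t (v + ?h n *\<^sub>R (- e)) - tent s t v)
      / ?h n))
      \<longlonglongrightarrow> (LINT v|lborel. tent s' t' (v - z) * - (rad s t v \<bullet> (- e)))"
  proof (rule LIMSEQ_integral_tent_quotient[of _ "t' - s'" z t'])
    show "\<bar>tent s' t' (v - z)\<bar> \<le> t' - s'" for v using tent_bound[OF st(2)] .
    show "tent s' t' (v - z) = 0" if "v \<notin> cball z t'" for v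
      using that by (intro tent_eq_0) (simp add: dist_norm norm_minus_commute)
  qed (use st in auto)
  have "(LINT u|lborel. tent s t (z + u) * ((tent s' t' (u + ?h n *\<^sub>R e) - tent s' t' u) / ?h n)) =
     (LINT v|lborel. tent s' t' (v - z) * ((tent s t (v + ?h n *\<^sub>R (- e)) - tent s t v)
         / ?h n))" for n
  proof -
    define h where "h = ?h n"
    have "(LINT u|lborel. tent s t (z + u) * ((tent s' t' (u + h *\<^sub>R e) - tent s' t' u) / h))
      = (LINT u|lborel. (tent s t (z + u) * tent s' t' (h *\<^sub>R e + u) - tent s t (z + u)
          * tent s' t' (0 + u)) / h)"
      by (simp add: right_diff_distrib add.commute)
    also have "\<dots> = ((LINT u|lborel. tent s t (z + u) * tent s' t' (h *\<^sub>R e + u))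
        - (LINT u|lborel. tent s t (z + u) * tent s' t' (0 + u))) / h"
      by (subst integral_divide_zero, subst Bochner_Integration.integral_diff[OF int int]) (rule refl)
    also have "(LINT u|lborel. tent s t (z + u) * tent s' t' (h *\<^sub>R e + u))
        = (LINT v|lborel. tent s t (- h *\<^sub>R e + v) * tent s' t' (- z + v))"
      using integral_lborel_translate[of "\<lambda>v. tent s t (- h *\<^sub>R e + v) * tent s' t' (- z + v)" "z
          + h *\<^sub>R e"]
      by (simp add: algebra_simps)
    also have "(LINT u|lborel. tent s t (z + u) * tent s' t' (0 + u))
        = (LINT v|lborel. tent s t (0 + v) * tent s' t' (- z + v))"
      using integral_lborel_translate[of "\<lambda>v. tent s t (0 + v) * tent s' t' (- z + v)" z] by simp
    also have "((LINT v|lborel. tent s t (- h *\<^sub>R e + v) * tent s' t' (- z + v))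
        - (LINT v|lborel. tent s t (0 + v) * tent s' t' (- z + v))) / h
       = (LINT v|lborel. (tent s t (- h *\<^sub>R e + v) * tent s' t' (- z + v) - tent s t (0 + v)
           * tent s' t' (- z + v)) / h)"
      by (subst integral_divide_zero, subst Bochner_Integration.integral_diff[OF int int]) (rule refl)
    also have "\<dots> = (LINT v|lborel. tent s' t' (v - z) * ((tent s t (v + h *\<^sub>R (- e)) - tent s t v)
        / h))"
      by (simp add: algebra_simps)
    finally show ?thesis by (simp add: h_def)
  qed
  then have "(LINT u|lborel. tent s t (z + u) * - (rad s' t' u \<bullet> e))
      = (LINT v|lborel. tent s' t' (v - z) * - (rad s t v \<bullet> (- e)))"
    using LIMSEQ_unique[OF A] B by simp
  then show ?thesis by simp
qed

lemma integrable_tent_rad: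
  fixes a y :: "'a::euclidean_space"
  assumes "s \<le> t" "s' \<le> t'"
  shows "integrable lborel (\<lambda>b. tent s t (a - b) *\<^sub>R rad s' t' (y - b))"
proof (rule integrable_bounded_support[of _ "t - s" a t])
  show "norm (tent s t (a - b) *\<^sub>R rad s' t' (y - b)) \<le> t - s" for b
    using mult_mono[OF tent_le[OF assms(1), of "a - b"] norm_rad_le[of s' t' "y - b"]] assms by simp
  show "tent s t (a - b) *\<^sub>R rad s' t' (y - b) = 0" if "b \<notin> cball a t" for b
    using that by (auto simp: dist_norm tent_eq_0)
qed measurable

text \<open>Tents are even, so both sides are minus the gradient in \<open>y\<close> of the
  convolution of the two tents at \<open>y - a\<close>, and that gradient may be placed on either
  factor.\<close>

lemma tent_rad_commute:
  fixes a y :: "'a::euclidean_space"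
  assumes st: "s \<le> t" "s' \<le> t'"
  shows "(LINT b|lborel. tent s t (a - b) *\<^sub>R rad s' t' (y - b))
      = (LINT b|lborel. tent s' t' (a - b) *\<^sub>R rad s t (y - b))"
    (is "?l = ?r")
proof (rule euclidean_eqI)
  fix e :: 'a assume "e \<in> Basis"
  have "?l \<bullet> e = (LINT b|lborel. tent s t (a - b) * (rad s' t' (y - b) \<bullet> e))"
    using integral_inner_left[of e, OF integrable_tent_rad[OF st, of a y]] by simp
  also have "\<dots> = (LINT u|lborel. tent s t ((a - y) + u) * (rad s' t' u \<bullet> e))"
    using integral_lborel_reflect[of "\<lambda>u. tent s t ((a - y) + u) * (rad s' t' u \<bullet> e)" y]
        by (simp add: algebra_simps)
  also have "\<dots> = - (LINT v|lborel. tent s' t' (v - (a - y)) * (rad s t v \<bullet> e))"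
    by (rule tent_rad_inner[OF st])
  also have "\<dots> = - (LINT b|lborel. tent s' t' (b - a) * (rad s t (b - y) \<bullet> e))"
    using integral_lborel_translate[of "\<lambda>v. tent s' t' (v - (a - y)) * (rad s t v \<bullet> e)" "- y"]
        by (simp add: algebra_simps)
  also have "\<dots> = (LINT b|lborel. tent s' t' (a - b) * (rad s t (y - b) \<bullet> e))"
  proof -
    have "tent s' t' (b - a) * (rad s t (b - y) \<bullet> e) = - (tent s' t' (a - b) * (rad s t (y - b) \<bullet> e))"
        for b
      using rad_minus[of s t "y - b"] by (simp add: tent_commute[of s' t' b a])
    then show ?thesis by simp
  qed
  also have "\<dots> = ?r \<bullet> e"
    using integral_inner_left[of e, OF integrable_tent_rad[OF st(2,1), of a y]] by simp
  finally show "?l \<bullet> e = ?r \<bullet> e" .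
qed

text \<open>Two readings: the distributional divergence of \<open>X\<close> tested with a tent
  centred at \<open>b\<close>, and, by \<open>Phi_eq_sflux\<close>, the flux about \<open>b\<close>
  integrated over radii. Mollification uses the first, integrality the second.\<close>

definition Phi :: "real \<Rightarrow> real \<Rightarrow> (real^3 \<Rightarrow> real^3) \<Rightarrow> real^3 \<Rightarrow> real" where
  "Phi s t X b = (LINT y|lborel. X y \<bullet> rad s t (y - b))"

lemma integrable_Phi: "integrable lborel X \<Longrightarrow> integrable lborel (\<lambda>y. X y \<bullet> rad s t (y - b))"
  by (rule integrable_inner_bounded[where B=1]) (auto intro: norm_rad_le)

lemma Phi_eq_sflux:
  assumes X: "integrable lborel X"
  shows "Phi s t X b = (LINT r|lborel. indicator {0<..} r * (indicator {s..t} r * sflux X b r))"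
  unfolding Phi_def rad_def by (rule integral_radial[OF X, of _ 1]) (auto simp: indicator_def)

lemma integrable_Phi_sflux:
  assumes X: "integrable lborel X"
  shows "integrable lborel (\<lambda>r. indicator {0<..} r * (indicator {s..t} r * sflux X b r))"
  by (rule integrable_sflux[OF X, of _ 1]) (auto simp: indicator_def)

lemma borel_measurable_Phi [measurable]:
  assumes [measurable]: "X \<in> borel_measurable borel"
  shows "Phi s t X \<in> borel_measurable borel"
  unfolding Phi_def by measurable

lemma Phi_bound:
  assumes X: "integrable lborel X"
  shows "\<bar>Phi s t X b\<bar> \<le> (LINT y|lborel. norm (X y))"
proof -
  have "\<bar>X y \<bullet> rad s t (y - b)\<bar> \<le> norm (X y)" for y
    using order_trans[OF Cauchy_Schwarz_ineq2[of "X y" "rad s t (y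
        - b)"] mult_left_mono[OF norm_rad_le, of "norm (X y)"]] by simp
  then show ?thesis unfolding Phi_def
    by (intro integral_abs_bound_integral integrable_Phi X integrable_norm) auto
qed

lemma integrable_tent_Phi_pair:
  assumes X: "integrable lborel X" and st: "s \<le> t"
  shows "integrable (lborel \<Otimes>\<^sub>M lborel) (\<lambda>(b, y). tent s t (a - b) * (X y \<bullet> rad s' t' (y - b)))"
proof -
  have [measurable]: "X \<in> borel_measurable borel" using X by auto
  have tn: "integrable lborel (\<lambda>b. tent s t (a - b))"
    by (rule integrable_bounded_support[of _ "t
        - s" a t]) (use tent_bound[OF st] in \<open>auto simp: tent_eq_0 dist_norm simp del: abs_of_nonneg\<close>)
  have bd: "norm (tent s t (a - b) * (X y \<bullet> rad s' t' (y - b))) \<le> tent s t (a - b) * norm (X y)"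
      for b y
    using order_trans[OF Cauchy_Schwarz_ineq2[of "X y" "rad s' t' (y
        - b)"] mult_left_mono[OF norm_rad_le, of "norm (X y)"]]
    by (auto simp: abs_mult intro!: mult_left_mono)
  show ?thesis
  proof (rule lborel_pair.Fubini_integrable)
    have "integrable lborel (\<lambda>b. tent s t (a - b) * (LINT y|lborel. norm (X y)))"
      using tn by simp
    then show "integrable lborel (\<lambda>b. LINT y|lborel. norm (case (b, y) of (b, y) \<Rightarrow> tent s t (a - b)
        * (X y \<bullet> rad s' t' (y - b))))"
    proof (rule Bochner_Integration.integrable_bound)
      have "(LINT y|lborel. norm (tent s t (a - b) * (X y \<bullet> rad s' t' (y - b))))
          \<le> tent s t (a - b) * (LINT y|lborel. norm (X y))" for b
        by (subst Bochner_Integration.integral_mult_right_zero[symmetric], rule integral_mono)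
           (use integrable_Phi[OF X] X bd in \<open>auto intro!: integrable_norm\<close>)
      then show "AE b in lborel. norm (LINT y|lborel. norm (case (b, y) of (b, y) \<Rightarrow> tent s t (a - b)
          * (X y \<bullet> rad s' t' (y - b))))
          \<le> norm (tent s t (a - b) * (LINT y|lborel. norm (X y)))"
        by (auto simp del: norm_mult)
    qed measurable
    show "AE b in lborel. integrable lborel (\<lambda>y. case (b, y) of (b, y) \<Rightarrow> tent s t (a - b) * (X y
        \<bullet> rad s' t' (y - b)))"
      using integrable_Phi[OF X] by auto
  qed measurable
qed

text \<open>Fubini turns both sides into \<open>X\<close> tested against the kernels of
  \<open>tent_rad_commute\<close>. With two mollifiers this says that mollifications commute; with
  one mollifier and one tent in the radius of the sphere it relates mollified fluxes to the original
  ones.\<close>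

lemma tent_Phi_commute:
  assumes X: "integrable lborel X" and st: "s \<le> t" "s' \<le> t'"
  shows "(LINT b|lborel. tent s t (a - b) * Phi s' t' X b)
      = (LINT b|lborel. tent s' t' (a - b) * Phi s t X b)"
proof -
  have *: "(LINT b|lborel. tent s t (a - b) * Phi s' t' X b)
      = (LINT y|lborel. X y \<bullet> (LINT b|lborel. tent s t (a - b) *\<^sub>R rad s' t' (y - b)))"
    if st: "s \<le> t" "s' \<le> t'" for s t s' t'
  proof -
    have "(LINT b|lborel. tent s t (a - b) * Phi s' t' X b)
        = (LINT b|lborel. LINT y|lborel. tent s t (a - b) * (X y \<bullet> rad s' t' (y - b)))"
      unfolding Phi_def by simp
    also have "\<dots> = (LINT y|lborel. LINT b|lborel. tent s t (a - b) * (X y \<bullet> rad s' t' (y - b)))"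
      by (rule lborel_pair.Fubini_integral[symmetric, OF integrable_tent_Phi_pair[OF X st(1)]])
    also have "\<dots> = (LINT y|lborel. X y \<bullet> (LINT b|lborel. tent s t (a - b) *\<^sub>R rad s' t' (y - b)))"
      using integral_inner_right[OF integrable_tent_rad[OF st, of a]] 
          by (intro Bochner_Integration.integral_cong) auto
    finally show ?thesis .
  qed
  show ?thesis unfolding *[OF st] *[OF st(2,1)] tent_rad_commute[OF st] ..
qed

section \<open>Mollified fluxes\<close>

text \<open>\<open>mdiv d X\<close> is the convolution of the distributional divergence of \<open>X\<close> with the probability
  density \<open>moll d\<close>, and \<open>mflux d X a r\<close> is its integral over the ball of radius \<open>r\<close> about \<open>a\<close>.\<close>
definition tent_mass :: "real \<Rightarrow> real" where
  "tent_mass d = (LINT z|lborel. tent d (2 * d) (z :: real^3))"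

definition moll :: "real \<Rightarrow> real^3 \<Rightarrow> real" where
  "moll d z = tent d (2 * d) z / tent_mass d"

definition mdiv :: "real \<Rightarrow> (real^3 \<Rightarrow> real^3) \<Rightarrow> real^3 \<Rightarrow> real" where
  "mdiv d X b = Phi d (2 * d) X b / tent_mass d"

definition mflux :: "real \<Rightarrow> (real^3 \<Rightarrow> real^3) \<Rightarrow> real^3 \<Rightarrow> real \<Rightarrow> real" where
  "mflux d X a r = (LINT b|lborel. indicator {..<r} (norm (a - b)) * mdiv d X b)"

lemma integrable_tent: "s \<le> t \<Longrightarrow> integrable lborel (tent s t :: 'a::euclidean_space \<Rightarrow> real)"
  by (rule integrable_bounded_support[of _ "t
      - s" 0 t]) (use tent_le[of s t] in \<open>auto simp: tent_eq_0\<close>)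

text \<open>The tent equals \<open>d\<close> on \<open>cball 0 d\<close>. The exponent 4, three
  dimensions and one height, is what leaves the factor \<open>1 / d\<close> in
  \<open>mdiv_L1_bound\<close>.\<close>

lemma tent_mass_ge:
  assumes d: "d > 0"
  shows "tent_mass d \<ge> unit_ball_vol 3 * d ^ 4"
proof -
  have "unit_ball_vol 3 * d ^ 4 = (LINT z|lborel. indicator (cball (0::real^3) d) z * d)"
    using d by (simp add: content_cball power4_eq_xxxx power3_eq_cube)
  also have "\<dots> \<le> tent_mass d" unfolding tent_mass_def
  proof (rule integral_mono)
    show "integrable lborel (\<lambda>z. indicator (cball (0::real^3) d) z * d)"
      by (rule integrable_bounded_support[of _ d 0 d]) (use d in \<open>auto simp: indicator_def\<close>)
    show "integrable lborel (\<lambda>z::real^3. tent d (2 * d) z)" using d by (simp add: integrable_tent)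
    show "indicator (cball (0::real^3) d) z * d \<le> tent d (2 * d) z" for z
      using d by (auto simp: tent_def indicator_def)
  qed
  finally show ?thesis .
qed

lemma tent_mass_pos: "d > 0 \<Longrightarrow> tent_mass d > 0"
  using tent_mass_ge[of d] by (smt (verit) unit_ball_vol_pos zero_less_power mult_pos_pos)

lemma borel_measurable_moll [measurable]: "moll d \<in> borel_measurable borel"
  unfolding moll_def by measurable

lemma moll_nonneg: "d > 0 \<Longrightarrow> moll d z \<ge> 0"
  using tent_mass_pos[of d] by (simp add: moll_def)

lemma moll_eq_0: "norm z \<ge> 2 * d \<Longrightarrow> moll d z = 0"
  by (simp add: moll_def tent_eq_0)

lemma moll_le: "d > 0 \<Longrightarrow> moll d z \<le> d / tent_mass d"
  using tent_mass_pos[of d] tent_le[of d "2*d" z] by (auto simp: moll_def intro!: divide_right_mono)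

lemma integrable_moll: "d > 0 \<Longrightarrow> integrable lborel (moll d)"
  unfolding moll_def by (intro integrable_divide_zero integrable_tent) auto

lemma integral_moll: "d > 0 \<Longrightarrow> (LINT z|lborel. moll d z) = 1"
  using tent_mass_pos[of d] by (simp add: moll_def tent_mass_def)

lemma integral_moll_translate: "d > 0 \<Longrightarrow> (LINT b|lborel. moll d (a - b)) = 1"
  by (subst integral_lborel_reflect) (auto simp: integral_moll)

lemma integrable_moll_translate: "d > 0 \<Longrightarrow> integrable lborel (\<lambda>b. moll d (a - b))"
  by (rule integrable_bounded_support[of _ "d / tent_mass d" a "2*d"])
    (use moll_le[of d] moll_nonneg[of d] in \<open>auto simp: dist_norm moll_eq_0\<close>)

lemma borel_measurable_mdiv [measurable]:
  assumes [measurable]: "X \<in> borel_measurable borel"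
  shows "mdiv d X \<in> borel_measurable borel"
  unfolding mdiv_def by measurable

lemma borel_measurable_mflux [measurable]:
  assumes [measurable]: "X \<in> borel_measurable borel" "f \<in> borel_measurable M" "g \<in> borel_measurable M"
  shows "(\<lambda>z. mflux d X (f z) (g z)) \<in> borel_measurable M"
  unfolding mflux_def indicator_def lessThan_iff by measurable

context
  fixes X :: "real^3 \<Rightarrow> real^3"
  assumes X: "integrable lborel X"
begin

lemma mdiv_bound: "d > 0 \<Longrightarrow> \<bar>mdiv d X b\<bar> \<le> (LINT y|lborel. norm (X y)) / tent_mass d"
  using Phi_bound[OF X, of d "2*d" b] tent_mass_pos[of d] by (simp add: mdiv_def divide_right_mono)

lemma moll_mdiv_commute:
  assumes "d > 0" "d' > 0"
  shows "(LINT b|lborel. moll d (a - b) * mdiv d' X b)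
      = (LINT b|lborel. moll d' (a - b) * mdiv d X b)"
  using tent_Phi_commute[OF X, of d "2*d" d' "2*d'" a] assms by (simp add: moll_def mdiv_def)

lemma integrable_mdiv_cut:
  assumes d: "d > 0" and [measurable]: "A \<in> sets borel" and A: "A \<subseteq> cball a R"
  shows "integrable lborel (\<lambda>b. indicator A b * mdiv d X b)"
proof (rule integrable_bounded_support)
  have [measurable]: "X \<in> borel_measurable borel" using X by auto
  show "(\<lambda>b. indicator A b * mdiv d X b) \<in> borel_measurable borel" by measurable
  show "norm (indicator A b * mdiv d X b) \<le> (LINT y|lborel. norm (X y)) / tent_mass d" for b
    using mdiv_bound[OF d, of b] by (auto simp: indicator_def)
  show "indicator A b * mdiv d X b = 0" if "b \<notin> cball a R" for b
    using that A by (auto simp: indicator_def)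
qed

lemma integrable_mdiv_norm:
  assumes d: "d > 0" and [measurable]: "S \<in> sets borel" and S: "S \<subseteq> {..R}"
  shows "integrable lborel (\<lambda>b. indicator S (norm (a - b)) * mdiv d X b)"
proof -
  have "{b. norm (a - b) \<in> S} \<in> sets borel" by measurable
  moreover have "{b. norm (a - b) \<in> S} \<subseteq> cball a R" using S by (auto simp: dist_norm)
  ultimately have "integrable lborel (\<lambda>b. indicator {b. norm (a - b) \<in> S} b * mdiv d X b)"
    using d by (intro integrable_mdiv_cut)
  then show ?thesis by (simp add: indicator_def)
qed

text \<open>Shifting the centre of the ball is the same as shifting the divergence. Each side is
  thus the integral over one fixed ball of the divergence mollified at both scales, which is
  symmetric by \<open>moll_mdiv_commute\<close>.\<close>

lemma moll_mflux_commute: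
  assumes d: "d > 0" "d' > 0"
  shows "(LINT h|lborel. moll d h * mflux d' X (a - h) r)
      = (LINT h|lborel. moll d' h * mflux d X (a - h) r)"
proof -
  have [measurable]: "X \<in> borel_measurable borel" using X by auto
  let ?I = "\<lambda>u. indicator {..<r} (norm (a - u)) :: real"
  have *: "(LINT h|lborel. moll d h * mflux d' X (a - h) r)
      = (LINT u|lborel. ?I u * (LINT b|lborel. moll d (u - b) * mdiv d' X b))"
    if d: "d > 0" "d' > 0" for d d'
  proof -
    define B where "B = d / tent_mass d * ((LINT y|lborel. norm (X y)) / tent_mass d')"
    have "(LINT h|lborel. moll d h * mflux d' X (a - h) r)
        = (LINT h|lborel. LINT u|lborel. moll d h * (?I u * mdiv d' X (u - h)))"
    proof (rule Bochner_Integration.integral_cong[OF refl])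
      fix h
      have "mflux d' X (a - h) r = (LINT u|lborel. ?I u * mdiv d' X (u - h))"
        unfolding mflux_def
        using integral_lborel_translate[of "\<lambda>b. indicator {..<r} (norm (a - h - b))
            * mdiv d' X b" "- h"] by simp
      then show "moll d h * mflux d' X (a - h) r
          = (LINT u|lborel. moll d h * (?I u * mdiv d' X (u - h)))"
        by simp
    qed
    also have "\<dots> = (LINT u|lborel. LINT h|lborel. moll d h * (?I u * mdiv d' X (u - h)))"
    proof (rule lborel_pair.Fubini_integral[symmetric], unfold lborel_prod)
      show "integrable lborel (\<lambda>(h, u). moll d h * (?I u * mdiv d' X (u - h)))"
      proof (rule integrable_bounded_support[of _ B "(0, a)" "2 * d + \<bar>r\<bar>"])
        show "(\<lambda>(h, u). moll d h * (?I u * mdiv d' X (u - h))) \<in> borel_measurable borel"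
          unfolding case_prod_unfold indicator_def by measurable
        show "norm (case z of (h, u) \<Rightarrow> moll d h * (?I u * mdiv d' X (u - h))) \<le> B" for z
        proof (cases z)
          case (Pair h u)
          have "\<bar>moll d h\<bar> * (\<bar>?I u\<bar> * \<bar>mdiv d' X (u - h)\<bar>)
              \<le> d / tent_mass d * (1 * ((LINT y|lborel. norm (X y)) / tent_mass d'))"
            using moll_le[OF d(1), of h] moll_nonneg[OF d(1), of h] mdiv_bound[OF d(2), of "u
                - h"] tent_mass_pos d
            by (intro mult_mono) (auto simp: indicator_def)
          then show ?thesis by (simp add: Pair B_def abs_mult)
        qed
        show "(case z of (h, u) \<Rightarrow> moll d h * (?I u * mdiv d' X (u - h))) = 0"
            if z: "z \<notin> cball (0, a) (2 * d + \<bar>r\<bar>)" for z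
        proof (cases z)
          case (Pair h u)
          show ?thesis
          proof (rule ccontr)
            assume "\<not> ?thesis"
            then have "moll d h \<noteq> 0" "?I u \<noteq> 0" by (auto simp: Pair)
            then have "norm h < 2 * d" "norm (a - u) < r" using moll_eq_0[of d h]
              by (auto simp: indicator_def not_le[symmetric] split: if_splits)
            then have "dist (0, a) (h, u) \<le> 2 * d + \<bar>r\<bar>"
              using norm_Pair_le[of "- h" "a - u"] by (auto simp: dist_norm)
            with z show False by (simp add: Pair)
          qed
        qed
      qed
    qed
    also have "\<dots> = (LINT u|lborel. ?I u * (LINT b|lborel. moll d (u - b) * mdiv d' X b))"
    proof (rule Bochner_Integration.integral_cong[OF refl])
      fix u
      have "(LINT h|lborel. moll d h * mdiv d' X (u - h))
          = (LINT b|lborel. moll d (u - b) * mdiv d' X b)"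
        using integral_lborel_reflect[of "\<lambda>h. moll d h * mdiv d' X (u - h)" u] by simp
      then show "(LINT h|lborel. moll d h * (?I u * mdiv d' X (u - h)))
          = ?I u * (LINT b|lborel. moll d (u - b) * mdiv d' X b)"
        by (simp add: mult.left_commute[of _ "?I u"])
    qed
    finally show ?thesis .
  qed
  show ?thesis unfolding *[OF d] *[OF d(2,1)] moll_mdiv_commute[OF d] ..
qed

text \<open>The mass in a shell of half-width \<open>e\<close> about the sphere: all that can enter
  or leave the ball when its centre moves by at most \<open>e\<close>.\<close>

definition osc :: "real \<Rightarrow> real \<Rightarrow> real^3 \<Rightarrow> real \<Rightarrow> real" where
  "osc d e a r = (LINT b|lborel. indicator {r - e..r + e} (norm (a - b)) * \<bar>mdiv d X b\<bar>)"

lemma integrable_osc: "d > 0 \<Longrightarrow> integrable lborel (\<lambda>b. indicator {r - e..r + e} (norm (a - b))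
    * \<bar>mdiv d X b\<bar>)"
  using integrable_abs[OF integrable_mdiv_norm[of d "{r - e..r + e}" "r + e" a]]
      by (auto simp: abs_mult)

lemma mflux_translate:
  assumes d: "d > 0" and h: "norm h \<le> e"
  shows "\<bar>mflux d X (a - h) r - mflux d X a r\<bar> \<le> osc d e a r"
proof -
  have int: "integrable lborel (\<lambda>b. indicator {..<r} (norm (c - b)) * mdiv d X b)" for c
    by (rule integrable_mdiv_norm[of d _ r]) (use d in auto)
  have "mflux d X (a - h) r - mflux d X a r
      = (LINT b|lborel. indicator {..<r} (norm (a - h - b)) * mdiv d X b - indicator {..<r} (norm (a
      - b)) * mdiv d X b)"
    unfolding mflux_def by (rule Bochner_Integration.integral_diff[symmetric]) (rule int)+
  also have "\<bar>\<dots>\<bar> \<le> osc d e a r" unfolding osc_def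
  proof (rule integral_abs_bound_integral)
    fix b
    have "\<bar>norm (a - h - b) - norm (a - b)\<bar> \<le> e"
      using norm_triangle_ineq3[of "a - h - b" "a - b"] h by simp
    then show "\<bar>indicator {..<r} (norm (a - h - b)) * mdiv d X b - indicator {..<r} (norm (a - b))
        * mdiv d X b\<bar>
        \<le> indicator {r - e..r + e} (norm (a - b)) * \<bar>mdiv d X b\<bar>"
      by (auto simp: indicator_def)
  qed (use int d integrable_osc in auto)
  finally show ?thesis .
qed

lemma moll_mflux_close:
  assumes d: "d > 0" and e: "e > 0"
  shows "\<bar>(LINT h|lborel. moll e h * mflux d X (a - h) r) - mflux d X a r\<bar> \<le> osc d (2 * e) a r"
proof -
  have [measurable]: "X \<in> borel_measurable borel" using X by auto
  have bd: "\<bar>moll e h * (mflux d X (a - h) r - mflux d X a r)\<bar> \<le> moll e h * osc d (2 * e) a r" for h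
  proof (cases "norm h \<le> 2 * e")
    case True
    then show ?thesis using mflux_translate[OF d True, of a r] moll_nonneg[OF e, of h]
      by (simp add: abs_mult mult_left_mono)
  next
    case False then show ?thesis by (simp add: moll_eq_0)
  qed
  have int1: "integrable lborel (\<lambda>h. moll e h * osc d (2 * e) a r)" using integrable_moll[OF e]
      by simp
  have int: "integrable lborel (\<lambda>h. moll e h * (mflux d X (a - h) r - mflux d X a r))"
  proof (rule Bochner_Integration.integrable_bound[OF int1])
    show "AE h in lborel. norm (moll e h * (mflux d X (a - h) r - mflux d X a r))
        \<le> norm (moll e h * osc d (2 * e) a r)"
      using bd by (intro AE_I2) (metis abs_ge_self order_trans real_norm_def)
  qed measurable
  have "(LINT h|lborel. moll e h * mflux d X (a - h) r)
      = (LINT h|lborel. moll e h * (mflux d X (a - h) r - mflux d X a r) + moll e h * mflux d X a r)"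
    by (simp add: algebra_simps)
  also have "\<dots> = (LINT h|lborel. moll e h * (mflux d X (a - h) r - mflux d X a r)) + mflux d X a r"
    using int integrable_moll[OF e]
        by (subst Bochner_Integration.integral_add) (auto simp: integral_moll[OF e])
  finally have "\<bar>(LINT h|lborel. moll e h * mflux d X (a - h) r) - mflux d X a r\<bar>
      = \<bar>LINT h|lborel. moll e h * (mflux d X (a - h) r - mflux d X a r)\<bar>"
    by simp
  also have "\<dots> \<le> (LINT h|lborel. moll e h * osc d (2 * e) a r)"
    by (rule integral_abs_bound_integral[OF int int1]) (rule bd)
  also have "\<dots> = osc d (2 * e) a r" by (simp add: integral_moll[OF e])
  finally show ?thesis .
qed

text \<open>Both fluxes are compared with the flux mollified at both scales, in whichever order.
  Since \<open>moll e\<close> is supported in radius \<open>2 * e\<close>, mollifying the flux of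
  scale \<open>d\<close> costs a shell of half-width \<open>2 * e\<close>, and conversely.\<close>

lemma mflux_diff_le:
  assumes d: "d > 0" and e: "e > 0"
  shows "\<bar>mflux d X a r - mflux e X a r\<bar> \<le> osc d (2 * e) a r + osc e (2 * d) a r"
  using moll_mflux_close[OF d e, of a r] moll_mflux_close[OF e d, of a r] moll_mflux_commute[OF d e,
      of a r] by linarith

text \<open>By Fubini: for fixed \<open>b\<close> the radii whose shell contains \<open>b\<close>
  form an interval of length \<open>2 * e\<close>. The condition on \<open>T\<close> keeps such
  \<open>b\<close> at distance more than \<open>2 * d\<close> from the unit sphere, where the flux
  hypothesis can be applied at scale \<open>d\<close>.\<close>

lemma nn_integral_osc:
  assumes d: "d > 0" and e: "e > 0" and T: "T + norm a + e + 2 * d < 1"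
  shows "(\<integral>\<^sup>+r. indicator {0<..T} r * ennreal (osc d e a r) \<partial>lborel)
      \<le> ennreal (2 * e) * (\<integral>\<^sup>+b. indicator (ball 0 (1 - 2 * d)) b * ennreal \<bar>mdiv d X b\<bar> \<partial>lborel)"
proof -
  have [measurable]: "X \<in> borel_measurable borel" using X by auto
  let ?o = "\<lambda>r b. (indicator {r - e..r + e} (norm (a - b)) * ennreal \<bar>mdiv d X b\<bar>)"
  let ?m = "\<lambda>b. (indicator (ball 0 (1 - 2 * d)) b * ennreal \<bar>mdiv d X b\<bar>)"
  have "(\<integral>\<^sup>+r. indicator {0<..T} r * ennreal (osc d e a r) \<partial>lborel)
      = (\<integral>\<^sup>+r. \<integral>\<^sup>+b. indicator {0<..T} r * (?o r b) \<partial>lborel \<partial>lborel)"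
  proof (rule nn_integral_cong)
    fix r
    have "ennreal (osc d e a r)
        = (\<integral>\<^sup>+b. ennreal (indicator {r - e..r + e} (norm (a - b)) * \<bar>mdiv d X b\<bar>) \<partial>lborel)"
      unfolding osc_def by (rule nn_integral_eq_integral[symmetric]) (use integrable_osc[OF d] in
          auto)
    also have "\<dots> = (\<integral>\<^sup>+b. indicator {r - e..r + e} (norm (a - b)) * ennreal \<bar>mdiv d X b\<bar> \<partial>lborel)"
      by (intro nn_integral_cong) (auto simp: indicator_def)
    finally show "indicator {0<..T} r * ennreal (osc d e a r)
        = (\<integral>\<^sup>+b. indicator {0<..T} r * (?o r b) \<partial>lborel)"
      by (simp add: nn_integral_cmult indicator_def)
  qed
  also have "\<dots> = (\<integral>\<^sup>+b. \<integral>\<^sup>+r. indicator {0<..T} r * (?o r b) \<partial>lborel \<partial>lborel)"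
    by (rule lborel_pair.Fubini'[symmetric]) (unfold indicator_def case_prod_unfold atLeastAtMost_iff,
        measurable)
  also have "\<dots> \<le> (\<integral>\<^sup>+b. ennreal (2 * e) * (?m b) \<partial>lborel)"
  proof (rule nn_integral_mono)
    fix b
    have "(\<integral>\<^sup>+r. indicator {0<..T} r * (?o r b) \<partial>lborel)
      \<le> (\<integral>\<^sup>+r. (?m b) * indicator {norm (a - b) - e..norm (a - b) + e} r \<partial>lborel)"
    proof (rule nn_integral_mono)
      fix r
      have "norm b < 1 - 2 * d" if "r \<le> T" "norm (a - b) \<le> r + e"
        using that T norm_triangle_ineq2[of b a] by (simp add: norm_minus_commute)
      then show "indicator {0<..T} r * (?o r b)
          \<le> (?m b) * indicator {norm (a - b) - e..norm (a - b) + e} r"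
        by (auto simp: indicator_def)
    qed
    also have "\<dots> = ennreal (2 * e) * (?m b)"
      using e by (subst nn_integral_cmult_indicator) (auto simp: mult.commute)
    finally show "(\<integral>\<^sup>+r. indicator {0<..T} r * (?o r b) \<partial>lborel)
      \<le> ennreal (2 * e) * (?m b)" .
  qed
  also have "\<dots> = ennreal (2 * e) * (\<integral>\<^sup>+b. indicator (ball 0 (1 - 2 * d)) b
      * ennreal \<bar>mdiv d X b\<bar> \<partial>lborel)"
  proof (rule nn_integral_cmult)
    have "ball (0::real^3) (1 - 2 * d) \<in> sets borel"
        "(\<lambda>b. ennreal \<bar>mdiv d X b\<bar>) \<in> borel_measurable borel"
      by simp measurable
    then show "(\<lambda>b. indicator (ball 0 (1 - 2 * d)) b
        * ennreal \<bar>mdiv d X b\<bar>) \<in> borel_measurable lborel"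
      by (intro borel_measurable_times_ennreal borel_measurable_indicator) simp_all
  qed
  finally show ?thesis .
qed

lemma borel_measurable_osc [measurable]: "(\<lambda>r. osc d e a r) \<in> borel_measurable borel"
proof -
  have [measurable]: "X \<in> borel_measurable borel" using X by auto
  show ?thesis unfolding osc_def indicator_def atLeastAtMost_iff by measurable
qed

end

section \<open>Convergence of the mollified fluxes\<close>

text \<open>The increments are summable in L1, hence absolutely summable almost everywhere, with sum
  \<open>G\<close>. Convergence of the integrals over intervals identifies \<open>f 0 + G\<close>
  with \<open>F\<close>, and the distance from \<open>f 0\<close> to \<open>F\<close> is bounded by
  the sum of the increments.\<close>

lemma L1_limit_bound:
  fixes f :: "nat \<Rightarrow> real \<Rightarrow> real"
  assumes f: "\<And>j. integrable lborel (f j)" and F: "integrable lborel F"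
    and eps: "\<And>j. (LINT r|lborel. \<bar>f j r - f (Suc j) r\<bar>) \<le> eps j" "summable eps"
    and supp: "\<And>j r. r \<notin> {0<..T} \<Longrightarrow> f j r = 0" "\<And>r. r \<notin> {0<..T} \<Longrightarrow> F r = 0"
    and lim: "\<And>s. 0 \<le> s \<Longrightarrow> s < T \<Longrightarrow> (\<lambda>j. LINT r|lborel. indicator {s..T} r * f j r)
        \<longlonglongrightarrow> (LINT r|lborel. indicator {s..T} r * F r)"
  shows "(LINT r|lborel. \<bar>f 0 r - F r\<bar>) \<le> suminf eps"
proof -
  define u where "u j r = f (Suc j) r - f j r" for j r
  have u: "integrable lborel (u j)" for j unfolding u_def using f by auto
  have [measurable]: "u j \<in> borel_measurable borel" "f j \<in> borel_measurable borel"
      "F \<in> borel_measurable borel" for j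
    using u[of j] f[of j] F by auto
  have uI: "(LINT r|lborel. \<bar>u j r\<bar>) \<le> eps j" for j
    using eps(1)[of j] by (simp add: u_def abs_minus_commute)
  have sumI: "summable (\<lambda>j. LINT r|lborel. \<bar>u j r\<bar>)"
    by (rule summable_comparison_test'[OF eps(2)]) (use uI in auto)
  have "(\<integral>\<^sup>+r. (\<Sum>j. ennreal \<bar>u j r\<bar>) \<partial>lborel) = (\<Sum>j. \<integral>\<^sup>+r. ennreal \<bar>u j r\<bar> \<partial>lborel)"
    by (rule nn_integral_suminf) auto
  also have "\<dots> = (\<Sum>j. ennreal (LINT r|lborel. \<bar>u j r\<bar>))"
    using u by (intro suminf_cong nn_integral_eq_integral) auto
  also have "\<dots> \<noteq> \<infinity>"
    by (subst suminf_ennreal2[OF _ sumI]) (rule integral_nonneg_AE, simp, rule ennreal_neq_top[folded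
        infinity_ennreal_def])
  finally have "AE r in lborel. (\<Sum>j. ennreal \<bar>u j r\<bar>) \<noteq> \<infinity>"
    by (intro nn_integral_PInf_AE) auto
  then have ae: "AE r in lborel. summable (\<lambda>j. \<bar>u j r\<bar>)"
    by eventually_elim (auto intro!: summable_suminf_not_top)
  define G where "G r = (\<Sum>j. u j r)" for r
  have iS: "integrable lborel (\<lambda>r. \<Sum>j. \<bar>u j r\<bar>)" "integral\<^sup>L lborel (\<lambda>r. \<Sum>j. \<bar>u j r\<bar>)
      = (\<Sum>j. LINT r|lborel. \<bar>u j r\<bar>)"
    using integrable_suminf[of lborel "\<lambda>j r. \<bar>u j r\<bar>"] integral_suminf[of lborel "\<lambda>j r. \<bar>u j r\<bar>"] u ae
        sumI by auto
  have G: "integrable lborel G"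
    unfolding G_def using integrable_suminf[of lborel u] u ae sumI by auto
  have Gind: "(\<lambda>j. LINT r|lborel. indicator {s..T} r * u j r) sums (LINT r|lborel. indicator {s..T} r
      * G r)" for s
  proof -
    have int: "integrable lborel (\<lambda>r. indicator {s..T} r * u j r)" for j
      by (rule integrable_bounded_mult[OF u, of _ 1]) (auto simp: indicator_def)
    have 1: "AE r in lborel. summable (\<lambda>j. norm (indicator {s..T} r * u j r))"
      using ae by eventually_elim (auto simp: abs_mult intro!: summable_mult)
    have 2: "summable (\<lambda>j. LINT r|lborel. norm (indicator {s..T} r * u j r))"
    proof (rule summable_comparison_test'[OF sumI])
      fix j
      have "(LINT r|lborel. \<bar>indicator {s..T} r * u j r\<bar>) \<le> (LINT r|lborel. \<bar>u j r\<bar>)"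
      proof (rule integral_mono[OF integrable_abs[OF int] integrable_abs[OF u]])
        fix r show "\<bar>indicator {s..T} r * u j r\<bar> \<le> \<bar>u j r\<bar>" by (cases "r \<in> {s..T}") auto
      qed
      then show "norm (LINT r|lborel. norm (indicator {s..T} r * u j r)) \<le> (LINT r|lborel. \<bar>u j r\<bar>)"
        by simp
    qed
    have "(\<lambda>j. LINT r|lborel. indicator {s..T} r * u j r) sums (LINT r|lborel. (\<Sum>j. indicator {s..T} r
        * u j r))"
      by (rule sums_integral[OF int 1 2])
    also have "(LINT r|lborel. (\<Sum>j. indicator {s..T} r * u j r))
        = (LINT r|lborel. indicator {s..T} r * G r)"
      using ae unfolding G_def
      by (intro integral_cong_AE) (auto elim!: eventually_mono intro: suminf_mult
          summable_rabs_cancel)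
    finally show ?thesis .
  qed
  have "AE r in lborel. F r - f 0 r - G r = 0"
  proof (rule AE_zero_if_intervals_zero[where T=T])
    show "integrable lborel (\<lambda>r. F r - f 0 r - G r)" using F f G by auto
    show "F r - f 0 r - G r = 0" if "r \<notin> {0<..T}" for r
      using supp[OF that] by (simp add: G_def u_def)
    fix s assume s: "0 \<le> s" "s < T"
    have int: "integrable lborel (\<lambda>r. indicator {s..T} r * g r)" if "integrable lborel g"
        for g :: "real \<Rightarrow> real"
      by (rule integrable_bounded_mult[OF that, of _ 1]) (auto simp: indicator_def)
    have "(\<lambda>n. \<Sum>j<n. LINT r|lborel. indicator {s..T} r * u j r)
        \<longlonglongrightarrow> (LINT r|lborel. indicator {s..T} r * F r) - (LINT r|lborel. indicator {s..T} r * f 0 r)"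
    proof -
      have "(LINT r|lborel. indicator {s..T} r * u j r)
          = (LINT r|lborel. indicator {s..T} r * f (Suc j) r) - (LINT r|lborel. indicator {s..T} r
          * f j r)" for j
        unfolding u_def right_diff_distrib by (intro Bochner_Integration.integral_diff int f)
      then have "(\<Sum>j<n. LINT r|lborel. indicator {s..T} r * u j r)
          = (LINT r|lborel. indicator {s..T} r * f n r) - (LINT r|lborel. indicator {s..T} r
          * f 0 r)" for n
        using sum_lessThan_telescope[of "\<lambda>j. LINT r|lborel. indicator {s..T} r * f j r" n] by simp
      then show ?thesis using lim[OF s] by (simp add: tendsto_diff)
    qed
    then have "(LINT r|lborel. indicator {s..T} r * G r)
        = (LINT r|lborel. indicator {s..T} r * F r) - (LINT r|lborel. indicator {s..T} r * f 0 r)"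
      using Gind[of s] LIMSEQ_unique unfolding sums_def by blast
    then show "(LINT r|lborel. indicator {s..T} r * (F r - f 0 r - G r)) = 0"
      unfolding right_diff_distrib using int[OF F] int[OF f[of 0]] int[OF G] by simp
  qed
  then have ae': "AE r in lborel. \<bar>f 0 r - F r\<bar> \<le> (\<Sum>j. \<bar>u j r\<bar>)"
    using ae
  proof eventually_elim
    case (elim r)
    then have "\<bar>f 0 r - F r\<bar> = \<bar>G r\<bar>" by simp
    also have "\<dots> \<le> (\<Sum>j. \<bar>u j r\<bar>)" unfolding G_def using elim by (intro summable_rabs)
    finally show ?case .
  qed
  have "(LINT r|lborel. \<bar>f 0 r - F r\<bar>) \<le> (\<Sum>j. LINT r|lborel. \<bar>u j r\<bar>)"
    unfolding iS(2)[symmetric] by (rule integral_mono_AE[OF _ iS(1) ae']) (use f F in auto)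
  also have "\<dots> \<le> suminf eps" by (rule suminf_le[OF uI sumI eps(2)])
  finally show ?thesis .
qed

text \<open>A layer-cake formula. It turns integrals over balls, once integrated in the radius, into
  pairings with tents, to which \<open>tent_Phi_commute\<close> applies.\<close>

lemma integral_tent_slices:
  assumes "s \<le> t"
  shows "(LINT r|lborel. indicator {s..t} r * indicator {..<r} (norm z)) = tent s t z"
proof (cases "norm z < s")
  case True
  have "(LINT r|lborel. indicator {s..t} r * indicator {..<r} (norm z))
      = (LINT r|lborel. indicator {s..t} r :: real)"
    by (rule Bochner_Integration.integral_cong) (use True in \<open>auto simp: indicator_def\<close>)
  then show ?thesis using True assms by (simp add: tent_def)
next
  case False
  have "(LINT r|lborel. indicator {s..t} r * indicator {..<r} (norm z))
      = (LINT r|lborel. indicator {norm z<..t} r :: real)"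
    by (rule Bochner_Integration.integral_cong) (use False in \<open>auto simp: indicator_def\<close>)
  also have "\<dots> = (if norm z \<le> t then t - norm z else 0)" by simp
  finally show ?thesis using False assms by (auto simp: tent_def)
qed

lemma isCont_rad:
  fixes z :: "'a::real_inner"
  assumes "z \<noteq> 0" "norm z \<noteq> s" "norm z \<noteq> t"
  shows "isCont (rad s t) z"
proof -
  consider "norm z < s" | "s < norm z" "norm z < t" | "t < norm z" using assms by linarith
  then show ?thesis
  proof cases
    case 1
    have "isCont (rad s t) z \<longleftrightarrow> isCont (\<lambda>_. 0::'a) z"
    proof (rule isCont_cong)
      have "open {x::'a. norm x < s}" by (intro open_Collect_less continuous_intros)
      then show "\<forall>\<^sub>F x in nhds z. rad s t x = 0"
        using 1 by (auto simp: eventually_nhds rad_def intro!: exI[of _ "{x. norm x < s}"])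
    qed
    then show ?thesis by simp
  next
    case 2
    have "isCont (rad s t) z \<longleftrightarrow> isCont sgn z"
    proof (rule isCont_cong)
      have "open {x::'a. s < norm x \<and> norm x < t}"
          by (intro open_Collect_conj open_Collect_less continuous_intros)
      then show "\<forall>\<^sub>F x in nhds z. rad s t x = sgn x"
        using 2 by (auto simp: eventually_nhds rad_def intro!: exI[of _ "{x. s < norm x
            \<and> norm x < t}"])
    qed
    then show ?thesis using assms by (simp add: isCont_sgn)
  next
    case 3
    have "isCont (rad s t) z \<longleftrightarrow> isCont (\<lambda>_. 0::'a) z"
    proof (rule isCont_cong)
      have "open {x::'a. t < norm x}" by (intro open_Collect_less continuous_intros)
      then show "\<forall>\<^sub>F x in nhds z. rad s t x = 0"
        using 3 by (auto simp: eventually_nhds rad_def intro!: exI[of _ "{x. t < norm x}"])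
    qed
    then show ?thesis by simp
  qed
qed

text \<open>The test field jumps only on null spheres, so dominated convergence applies. Continuity
  in the centre makes mollifications converge at every centre rather than almost every one, as the
  definition of \<open>LpZ\<close> demands.\<close>

lemma isCont_Phi:
  assumes X: "integrable lborel X"
  shows "isCont (Phi s t X) a"
  unfolding continuous_at_sequentially comp_def Phi_def
proof (intro allI impI)
  fix b assume b: "b \<longlonglongrightarrow> a"
  have [measurable]: "X \<in> borel_measurable borel" using X by auto
  show "(\<lambda>n. LINT y|lborel. X y \<bullet> rad s t (y - b n)) \<longlonglongrightarrow> (LINT y|lborel. X y \<bullet> rad s t (y - a))"
  proof (rule integral_dominated_convergence)
    show "integrable lborel (\<lambda>y. norm (X y))" using X by simp
    show "AE y in lborel. (\<lambda>n. X y \<bullet> rad s t (y - b n)) \<longlonglongrightarrow> X y \<bullet> rad s t (y - a)"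
      using AE_norm_diff_neq[of a 0] AE_norm_diff_neq[of a s] AE_norm_diff_neq[of a t]
    proof eventually_elim
      case (elim y)
      then have "isCont (rad s t) (y - a)" by (intro isCont_rad) auto
      moreover have "(\<lambda>n. y - b n) \<longlonglongrightarrow> y - a" using b by (intro tendsto_intros)
      ultimately have "(\<lambda>n. rad s t (y - b n)) \<longlonglongrightarrow> rad s t (y - a)" by (rule isCont_tendsto_compose)
      then show ?case by (intro tendsto_intros)
    qed
    fix n
    show "AE y in lborel. norm (X y \<bullet> rad s t (y - b n)) \<le> norm (X y)"
    proof (rule AE_I2)
      fix y show "norm (X y \<bullet> rad s t (y - b n)) \<le> norm (X y)"
        using order_trans[OF Cauchy_Schwarz_ineq2[of "X y" "rad s t (y
            - b n)"] mult_left_mono[OF norm_rad_le, of "norm (X y)"]] by simp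
    qed
  qed measurable
qed

context
  fixes X :: "real^3 \<Rightarrow> real^3"
  assumes X: "integrable lborel X"
begin

text \<open>Integration in \<open>r\<close> replaces the ball indicators by a tent, whose role is
  then exchanged with that of the mollifier.\<close>

lemma mflux_interval:
  assumes d: "d > 0" and st: "s \<le> t"
  shows "integrable lborel (\<lambda>r. indicator {s..t} r * mflux d X a r)"
    and "(LINT r|lborel. indicator {s..t} r * mflux d X a r)
        = (LINT b|lborel. moll d (a - b) * Phi s t X b)"
proof -
  have [measurable]: "X \<in> borel_measurable borel" using X by auto
  define B where "B = (LINT y|lborel. norm (X y)) / tent_mass d"
  let ?f = "\<lambda>(r, b). indicator {s..t} r * (indicator {..<r} (norm (a - b)) * mdiv d X b) :: real"
  have int: "integrable (lborel \<Otimes>\<^sub>M lborel) ?f"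
    unfolding lborel_prod
  proof (rule integrable_bounded_support[of _ B "(0, a)" "(\<bar>s\<bar> + \<bar>t\<bar>) + \<bar>t\<bar>"])
    show "?f \<in> borel_measurable borel"
      unfolding case_prod_unfold indicator_def lessThan_iff atLeastAtMost_iff by measurable
    show "norm (?f z) \<le> B" for z
      using mdiv_bound[OF X d, of "snd z"] tent_mass_pos[OF d] unfolding B_def
      by (cases z) (auto simp: indicator_def)
    show "?f z = 0" if z: "z \<notin> cball (0, a) ((\<bar>s\<bar> + \<bar>t\<bar>) + \<bar>t\<bar>)" for z
    proof (cases z)
      case (Pair r b)
      show ?thesis
      proof (rule ccontr)
        assume "\<not> ?thesis"
        then have "s \<le> r" "r \<le> t" "norm (a - b) < r"
          by (auto simp: Pair indicator_def split: if_splits)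
        then have "dist (0, a) (r, b) \<le> \<bar>s\<bar> + \<bar>t\<bar> + \<bar>t\<bar>"
          using norm_Pair_le[of "- r" "a - b"] by (auto simp: dist_norm)
        with z show False by (simp add: Pair)
      qed
    qed
  qed
  have inner: "(LINT b|lborel. indicator {s..t} r * (indicator {..<r} (norm (a - b)) * mdiv d X b))
      = indicator {s..t} r * mflux d X a r" for r
    by (simp add: mflux_def)
  show "integrable lborel (\<lambda>r. indicator {s..t} r * mflux d X a r)"
    using lborel_pair.integrable_fst[OF int] unfolding inner .
  have "(LINT r|lborel. indicator {s..t} r * mflux d X a r)
      = (LINT r|lborel. LINT b|lborel. indicator {s..t} r * (indicator {..<r} (norm (a - b))
      * mdiv d X b))"
    unfolding inner ..
  also have "\<dots> = (LINT b|lborel. LINT r|lborel. indicator {s..t} r * (indicator {..<r} (norm (a - b))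
      * mdiv d X b))"
    by (rule lborel_pair.Fubini_integral[symmetric]) (rule int)
  also have "\<dots> = (LINT b|lborel. tent s t (a - b) * mdiv d X b)"
    unfolding mult.assoc[symmetric] by (simp add: integral_tent_slices[OF st])
  also have "\<dots> = (LINT b|lborel. moll d (a - b) * Phi s t X b)"
    using tent_Phi_commute[OF X st, of d "2*d" a] d by (simp add: moll_def mdiv_def)
  finally show "(LINT r|lborel. indicator {s..t} r * mflux d X a r)
      = (LINT b|lborel. moll d (a - b) * Phi s t X b)" .
qed

lemma LIMSEQ_moll_Phi:
  assumes d: "\<And>j. d j > 0" "d \<longlonglongrightarrow> 0"
  shows "(\<lambda>j. LINT b|lborel. moll (d j) (a - b) * Phi s t X b) \<longlonglongrightarrow> Phi s t X a"
proof (rule LIMSEQ_I)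
  have [measurable]: "X \<in> borel_measurable borel" using X by auto
  fix e :: real assume e: "e > 0"
  obtain \<delta> where \<delta>: "\<delta> > 0" "\<And>b. dist b a < \<delta> \<Longrightarrow> dist (Phi s t X b) (Phi s t X a) < e / 2"
    using isCont_Phi[OF X, of a s t] e unfolding continuous_at_eps_delta
        by (metis half_gt_zero dist_norm)
  have "\<forall>\<^sub>F j in sequentially. d j < \<delta> / 2"
    using order_tendstoD(2)[OF d(2), of "\<delta>/2"] \<delta> by simp
  then obtain N where N: "\<And>j. j \<ge> N \<Longrightarrow> d j < \<delta> / 2" unfolding eventually_sequentially by auto
  show "\<exists>no. \<forall>n\<ge>no. norm ((LINT b|lborel. moll (d n) (a - b) * Phi s t X b) - Phi s t X a) < e"
  proof (intro exI[of _ N] allI impI)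
    fix n assume n: "n \<ge> N"
    have int1: "integrable lborel (\<lambda>b. moll (d n) (a - b) * Phi s t X b)"
      using integrable_bounded_mult[OF integrable_moll_translate[OF d(1)], of "Phi s t X"
          "LINT y|lborel. norm (X y)" n a] Phi_bound[OF X, of s t]
      by (simp add: mult.commute)
    have int2: "integrable lborel (\<lambda>b. moll (d n) (a - b) * c)" for c
      using integrable_moll_translate[OF d(1)] by simp
    have "(LINT b|lborel. moll (d n) (a - b) * Phi s t X b) - Phi s t X a
        = (LINT b|lborel. moll (d n) (a - b) * Phi s t X b - moll (d n) (a - b) * Phi s t X a)"
      using integral_moll_translate[OF d(1)]
          by (subst Bochner_Integration.integral_diff[OF int1 int2]) simp
    also have "\<bar>\<dots>\<bar> \<le> (LINT b|lborel. moll (d n) (a - b) * (e / 2))"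
    proof (rule integral_abs_bound_integral[OF Bochner_Integration.integrable_diff[OF int1 int2]
        int2])
      fix b
      show "\<bar>moll (d n) (a - b) * Phi s t X b - moll (d n) (a - b) * Phi s t X a\<bar>
          \<le> moll (d n) (a - b) * (e / 2)"
      proof (cases "norm (a - b) < 2 * d n")
        case True
        then have "dist b a < \<delta>" using N[OF n] by (simp add: dist_norm norm_minus_commute)
        then have "\<bar>Phi s t X b - Phi s t X a\<bar> \<le> e / 2" using \<delta>(2)[of b] by (simp add: dist_real_def)
        then show ?thesis using moll_nonneg[OF d(1), of n "a - b"]
          by (simp add: right_diff_distrib[symmetric] abs_mult mult_left_mono del:
              times_divide_eq_right)
      next
        case False then show ?thesis by (simp add: moll_eq_0)
      qed
    qed
    also have "\<dots> = e / 2" using integral_moll_translate[OF d(1)] by simp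
    finally show "norm ((LINT b|lborel. moll (d n) (a - b) * Phi s t X b) - Phi s t X a) < e"
      using e by simp
  qed
qed

lemma mflux_converges_on_intervals:
  assumes d: "\<And>j. d j > 0" "d \<longlonglongrightarrow> 0" and s: "0 \<le> s" "s < T"
  shows "(\<lambda>j. LINT r|lborel. indicator {s..T} r * (indicator {0<..T} r * mflux (d j) X a r))
    \<longlonglongrightarrow> (LINT r|lborel. indicator {s..T} r * (indicator {0<..T} r * sflux X a r))"
proof -
  have "(LINT r|lborel. indicator {s..T} r * (indicator {0<..T} r * mflux (d j) X a r))
      = (LINT r|lborel. indicator {s..T} r * mflux (d j) X a r)" for j
  proof (rule Bochner_Integration.integral_cong[OF refl])
    fix r
    \<comment> \<open>For \<open>s = 0\<close> the two integrands could differ at the radius 0,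
      where the open ball is empty.\<close>
    have "mflux (d j) X a 0 = 0" by (simp add: mflux_def)
    then show "indicator {s..T} r * (indicator {0<..T} r * mflux (d j) X a r)
        = indicator {s..T} r * mflux (d j) X a r"
      using s by (cases "r = 0") (auto simp: indicator_def)
  qed
  moreover have "(LINT r|lborel. indicator {s..T} r * (indicator {0<..T} r * sflux X a r))
      = Phi s T X a"
    unfolding Phi_eq_sflux[OF X]
        by (intro Bochner_Integration.integral_cong) (auto simp: indicator_def)
  ultimately show ?thesis
    using mflux_interval(2)[OF d(1), of s T] LIMSEQ_moll_Phi[OF d] s by simp
qed

lemma integrable_sflux_cut: "integrable lborel (\<lambda>r. indicator {0<..T} r * sflux X a r)"
proof -
  have "(\<lambda>r. indicator {0<..T} r * sflux X a r)
      = (\<lambda>r. indicator {0<..} r * (indicator {0..T} r * sflux X a r))"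
    by (auto simp: indicator_def fun_eq_iff)
  then show ?thesis using integrable_Phi_sflux[OF X, of 0 T a] by simp
qed

lemma integrable_mflux_cut:
  assumes d: "d > 0"
  shows "integrable lborel (\<lambda>r. indicator {0<..T} r * mflux d X a r)"
proof (cases "0 \<le> T")
  case True
  have "mflux d X a 0 = 0" by (simp add: mflux_def)
  then have "indicator {0<..T} r * mflux d X a r = indicator {0..T} r * mflux d X a r" for r
    by (cases "r = 0") (auto simp: indicator_def)
  then have "(\<lambda>r. indicator {0<..T} r * mflux d X a r) = (\<lambda>r. indicator {0..T} r * mflux d X a r)"
      by blast
  then show ?thesis using mflux_interval(1)[OF d True, of a] by simp
qed simp

lemma mflux_sflux_L1:
  assumes d: "\<And>j. d j > 0" "d \<longlonglongrightarrow> 0" and eps: "summable eps"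
    and step: "\<And>j. (LINT r|lborel. indicator {0<..T} r * \<bar>mflux (d j) X a r
        - mflux (d (Suc j)) X a r\<bar>) \<le> eps j"
  shows "(LINT r|lborel. indicator {0<..T} r * \<bar>mflux (d 0) X a r - sflux X a r\<bar>) \<le> suminf eps"
proof -
  have "(LINT r|lborel. \<bar>indicator {0<..T} r * mflux (d 0) X a r - indicator {0<..T} r * sflux X a r\<bar>)
      \<le> suminf eps"
  proof (rule L1_limit_bound[where T=T])
    fix j
    have "(LINT r|lborel. \<bar>indicator {0<..T} r * mflux (d j) X a r - indicator {0<..T} r
        * mflux (d (Suc j)) X a r\<bar>)
       = (LINT r|lborel. indicator {0<..T} r * \<bar>mflux (d j) X a r - mflux (d (Suc j)) X a r\<bar>)"
      by (intro Bochner_Integration.integral_cong) (auto simp: indicator_def)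
    then show "(LINT r|lborel. \<bar>indicator {0<..T} r * mflux (d j) X a r - indicator {0<..T} r
        * mflux (d (Suc j)) X a r\<bar>) \<le> eps j"
      using step[of j] by simp
  qed (use integrable_mflux_cut integrable_sflux_cut mflux_converges_on_intervals eps d in auto)
  also have "(LINT r|lborel. \<bar>indicator {0<..T} r * mflux (d 0) X a r - indicator {0<..T} r
      * sflux X a r\<bar>)
       = (LINT r|lborel. indicator {0<..T} r * \<bar>mflux (d 0) X a r - sflux X a r\<bar>)"
    by (intro Bochner_Integration.integral_cong) (auto simp: indicator_def)
  finally show ?thesis .
qed

end

section \<open>Integer fluxes\<close>

text \<open>This is \<open>2 * s powr (1 - p)\<close> for the cut-off \<open>s\<close> chosen in
  \<open>sflux_Ints_bound\<close>. Its order \<open>d powr (2 * p - 2)\<close> is the whole gain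
  over dyadic scales.\<close>

definition beta :: "real \<Rightarrow> real \<Rightarrow> real" where
  "beta p d = 2 * (8 * d\<^sup>2 * (measure sphere_measure UNIV + 1)) powr (p - 1)"

lemma sphere_measure_mass_pos: "measure sphere_measure UNIV + 1 > 0"
  by (rule add_nonneg_pos) auto

lemma beta_pos: "d > 0 \<Longrightarrow> beta p d > 0"
  using sphere_measure_mass_pos by (auto simp: beta_def)

lemma borel_measurable_indicator_times:
  fixes f :: "'a::topological_space \<Rightarrow> ennreal"
  assumes "A \<in> sets borel" "f \<in> borel_measurable borel"
  shows "(\<lambda>x. indicator A x * f x) \<in> borel_measurable borel"
  using assms by (intro borel_measurable_times_ennreal borel_measurable_indicator)

text \<open>Halving \<open>d\<close> divides its square by 4. For \<open>p > 1\<close> the resulting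
  ratio is below 1, so the errors of the dyadic scales form a convergent geometric series.\<close>

lemma beta_div_power:
  assumes d: "d > 0"
  shows "beta p (d / 2 ^ j) = beta p d * ((1/4) powr (p - 1)) ^ j"
proof -
  define M where "M = 8 * d\<^sup>2 * (measure sphere_measure UNIV + 1)"
  have M: "M > 0" unfolding M_def using d sphere_measure_mass_pos by simp
  have "8 * (d / 2 ^ j)\<^sup>2 * (measure sphere_measure UNIV + 1) = M * (1/4) ^ j"
  proof -
    have "(2 ^ j)\<^sup>2 = (4::real) ^ j" by (simp add: power2_eq_square flip: power_mult_distrib)
    then show ?thesis by (simp add: M_def power_divide power_one_over)
  qed
  then have "beta p (d / 2 ^ j) = 2 * (M * (1/4) ^ j) powr (p - 1)" by (simp add: beta_def)
  also have "\<dots> = 2 * M powr (p - 1) * ((1/4) ^ j) powr (p - 1)"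
    using M by (subst powr_mult) auto
  also have "((1/4::real) ^ j) powr (p - 1) = ((1/4) powr (p - 1)) ^ j"
    by (simp add: powr_powr powr_realpow[symmetric] mult.commute)
  finally show ?thesis by (simp add: beta_def M_def)
qed

text \<open>Above the cut-off the factor \<open>(u / s) powr (p - 1)\<close> is at least 1. This
  stands in for Hoelder's inequality, with \<open>s\<close> left free for the application.\<close>

lemma le_cut_plus_powr:
  fixes u s p :: real
  assumes "u \<ge> 0" "s > 0" "p > 1"
  shows "u \<le> s + s powr (1 - p) * u powr p"
proof (cases "u \<le> s")
  case True
  then show ?thesis by (simp add: add_increasing2)
next
  case False
  then have "s powr (p - 1) \<le> u powr (p - 1)" using assms by (intro powr_mono2) auto
  then have "s powr (1 - p) * s powr (p - 1) * u \<le> s powr (1 - p) * u powr (p - 1) * u"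
    using assms by (intro mult_right_mono mult_left_mono) auto
  moreover have "s powr (1 - p) * s powr (p - 1) = 1" using assms by (simp flip: powr_add)
  moreover have "u powr (p - 1) * u = u powr p" using assms False by (simp add: powr_diff)
  ultimately have "u \<le> s powr (1 - p) * u powr p" by (simp add: mult.assoc)
  then show ?thesis using assms by simp
qed

text \<open>The flux bound is homogeneous of degree \<open>p\<close> in \<open>X\<close> although the flux itself is linear: a
  nonzero integer is at least 1, which is where the quantisation of the flux enters.\<close>
lemma sflux_Ints_bound:
  assumes [measurable]: "X \<in> borel_measurable borel" and p: "p > 1" and d: "d > 0" "d \<le> r" "r \<le> 2 * d"
    and Z: "sflux X b r \<in> \<int>" and int: "integrable sphere_measure (\<lambda>w. X (b + r *\<^sub>R w) \<bullet> w)"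
  shows "ennreal \<bar>sflux X b r\<bar> \<le> (\<integral>\<^sup>+w. ennreal (beta p d * r\<^sup>2 * norm (X (b
      + r *\<^sub>R w)) powr p) \<partial>sphere_measure)"
proof (cases "integrable sphere_measure (\<lambda>w. norm (X (b + r *\<^sub>R w)) powr p)")
  case False
  have "(\<integral>\<^sup>+w. ennreal (norm (X (b + r *\<^sub>R w)) powr p) \<partial>sphere_measure) = \<infinity>"
    using False by (simp add: integrable_iff_bounded not_less top_unique)
  moreover have "(\<integral>\<^sup>+w. ennreal (beta p d * r\<^sup>2 * norm (X (b + r *\<^sub>R w)) powr p) \<partial>sphere_measure)
     = ennreal (beta p d * r\<^sup>2) * (\<integral>\<^sup>+w. ennreal (norm (X (b + r *\<^sub>R w)) powr p) \<partial>sphere_measure)"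
    using beta_pos[OF d(1), of p] d by (subst nn_integral_cmult[symmetric]) (auto simp: ennreal_mult)
  moreover have "ennreal (beta p d * r\<^sup>2) \<noteq> 0" using beta_pos[OF d(1), of p] d
      by (auto simp: ennreal_eq_0_iff not_le)
  ultimately show ?thesis by (simp add: ennreal_mult_eq_top_iff)
next
  case True
  define M where "M = measure sphere_measure UNIV"
  have M: "M \<ge> 0" by (simp add: M_def)
  \<comment> \<open>For \<open>r \<le> 2 * d\<close> the part of the field below the cut-off carries
    flux at most 1/2, so when the flux is at least 1 in absolute value, at least half of it comes
    from the part above. Dividing by \<open>M + 1\<close> avoids computing the mass
    \<open>M\<close>.\<close>
  define s where "s = 1 / (8 * d\<^sup>2 * (M + 1))"
  have s: "s > 0" using d M by (simp add: s_def)
  define I where "I = (LINT w|sphere_measure. norm (X (b + r *\<^sub>R w)) powr p)"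
  have I: "I \<ge> 0" unfolding I_def by simp
  have "\<bar>LINT w|sphere_measure. X (b + r *\<^sub>R w) \<bullet> w\<bar> \<le> (LINT w|sphere_measure. \<bar>X (b + r *\<^sub>R w) \<bullet> w\<bar>)"
    by (rule integral_abs_bound)
  also have "\<dots> \<le> (LINT w|sphere_measure. s + s powr (1 - p) * norm (X (b + r *\<^sub>R w)) powr p)"
  proof (rule integral_mono_AE)
    show "AE w in sphere_measure. \<bar>X (b + r *\<^sub>R w) \<bullet> w\<bar>
        \<le> s + s powr (1 - p) * norm (X (b + r *\<^sub>R w)) powr p"
      using AE_sphere_measure
    proof eventually_elim
      case (elim w)
      then have "\<bar>X (b + r *\<^sub>R w) \<bullet> w\<bar> \<le> norm (X (b + r *\<^sub>R w))"
          using Cauchy_Schwarz_ineq2[of "X (b + r *\<^sub>R w)" w] by simp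
      also have "\<dots> \<le> s + s powr (1 - p) * norm (X (b + r *\<^sub>R w)) powr p"
          by (rule le_cut_plus_powr) (use s p in auto)
      finally show ?case .
    qed
  qed (use int True in auto)
  also have "\<dots> = s * M + s powr (1 - p) * I"
    using True by (subst Bochner_Integration.integral_add) (auto simp: I_def M_def mult.commute)
  finally have "r\<^sup>2 * \<bar>LINT w|sphere_measure. X (b + r *\<^sub>R w) \<bullet> w\<bar>
      \<le> r\<^sup>2 * (s * M + s powr (1 - p) * I)"
    by (intro mult_left_mono) auto
  then have F: "\<bar>sflux X b r\<bar> \<le> r\<^sup>2 * s * M + r\<^sup>2 * s powr (1 - p) * I"
    by (simp add: sflux_def abs_mult algebra_simps)
  have "r\<^sup>2 * s * M \<le> (2 * d)\<^sup>2 * s * (M + 1)"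
    using d M s by (intro mult_mono power_mono) auto
  also have "\<dots> = (8 * d\<^sup>2 * (M + 1) / 2) * s" by (simp add: power2_eq_square algebra_simps)
  also have "\<dots> = 1/2"
  proof -
    have half: "D / 2 * (1 / D) = 1 / 2" if "D > 0" for D :: real using that by simp
    show ?thesis unfolding s_def by (rule half) (use d M in simp)
  qed
  finally have F1: "\<bar>sflux X b r\<bar> \<le> 1/2 + r\<^sup>2 * s powr (1 - p) * I" using F by simp
  have sp: "2 * s powr (1 - p) = beta p d"
    unfolding beta_def s_def M_def[symmetric] using d M
        by (simp add: powr_divide powr_minus[symmetric] powr_minus_divide[symmetric])
  have "\<bar>sflux X b r\<bar> \<le> beta p d * r\<^sup>2 * I"
  proof (cases "sflux X b r = 0")
    case True then show ?thesis using I beta_pos[OF d(1), of p] by simp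
  next
    case False
    then have "\<bar>sflux X b r\<bar> \<ge> 1" using Z Ints_nonzero_abs_ge1 by blast
    then have "\<bar>sflux X b r\<bar> \<le> 2 * (r\<^sup>2 * s powr (1 - p) * I)" using F1 by linarith
    then show ?thesis unfolding sp[symmetric] by (simp add: mult_ac)
  qed
  also have "beta p d * r\<^sup>2 * I
      = (LINT w|sphere_measure. beta p d * r\<^sup>2 * norm (X (b + r *\<^sub>R w)) powr p)"
    by (simp add: I_def)
  finally have "ennreal \<bar>sflux X b r\<bar>
      \<le> ennreal (LINT w|sphere_measure. beta p d * r\<^sup>2 * norm (X (b + r *\<^sub>R w)) powr p)"
    by (rule ennreal_leI)
  also have "\<dots> = (\<integral>\<^sup>+w. ennreal (beta p d * r\<^sup>2 * norm (X (b + r *\<^sub>R w)) powr p) \<partial>sphere_measure)"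
    using True beta_pos[OF d(1), of p] by (intro nn_integral_eq_integral[symmetric]) auto
  finally show ?thesis .
qed

text \<open>The flux condition of \<open>LpZ\<close> for Borel fields on all of space, stated with
  the total \<open>sflux\<close>; \<open>LpZ_iff\<close> translates between the two.\<close>

definition Zflux :: "(real^3 \<Rightarrow> real^3) \<Rightarrow> bool" where
  "Zflux X \<longleftrightarrow> (\<forall>a\<in>B3. AE r in lborel. 0 < r \<and> r < 1 - norm a \<longrightarrow> sflux X a r \<in> \<int>)"

context
  fixes X :: "real^3 \<Rightarrow> real^3" and p :: real
  assumes X: "integrable lborel X" and Z: "Zflux X" and p: "p > 1"
begin

text \<open>Radii stay between \<open>d\<close> and \<open>2 * d\<close>, so a single constant
  serves all spheres, and polar coordinates reassemble the sphere integrals into one over a ball.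
  The condition on \<open>b\<close> keeps these spheres inside the unit ball.\<close>

lemma Phi_Zflux_bound:
  assumes d: "d > 0" and b: "norm b < 1 - 2 * d"
  shows "ennreal \<bar>Phi d (2 * d) X b\<bar>
      \<le> (\<integral>\<^sup>+y. ennreal (beta p d) * (indicator (cball b (2 * d)) y
      * ennreal (norm (X y) powr p)) \<partial>lborel)"
proof -
  have [measurable]: "X \<in> borel_measurable borel" using X by auto
  let ?h = "\<lambda>r w. (ennreal (beta p d) * (indicator (cball b (2 * d)) (b + r *\<^sub>R w)
      * ennreal (norm (X (b + r *\<^sub>R w)) powr p)))"
  have bB: "b \<in> B3" using b d by (simp add: B3_def)
  have "ennreal \<bar>Phi d (2 * d) X b\<bar>
      \<le> (\<integral>\<^sup>+r. ennreal \<bar>indicator {0<..} r * (indicator {d..2 * d} r * sflux X b r)\<bar> \<partial>lborel)"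
    unfolding Phi_eq_sflux[OF X]
        using integral_norm_bound_ennreal[OF integrable_Phi_sflux[OF X, of d "2*d" b]] by simp
  also have "\<dots> \<le> (\<integral>\<^sup>+r. \<integral>\<^sup>+w. ennreal (indicator {0<..} r * r\<^sup>2) * (?h r w) \<partial>sphere_measure \<partial>lborel)"
  proof (rule nn_integral_mono_AE)
    show "AE r in lborel. ennreal \<bar>indicator {0<..} r * (indicator {d..2 * d} r * sflux X b r)\<bar> \<le>
       (\<integral>\<^sup>+w. ennreal (indicator {0<..} r * r\<^sup>2) * (?h r w) \<partial>sphere_measure)"
      using Z[unfolded Zflux_def, rule_format, OF bB] AE_integrable_sphere[OF X, of b]
    proof eventually_elim
      case (elim r)
      show ?case
      proof (cases "d \<le> r \<and> r \<le> 2 * d")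
        case True
        have "ennreal \<bar>sflux X b r\<bar>
            \<le> (\<integral>\<^sup>+w. ennreal (beta p d * r\<^sup>2 * norm (X (b + r *\<^sub>R w)) powr p) \<partial>sphere_measure)"
          using True elim d b p by (intro sflux_Ints_bound) auto
        also have "\<dots> = (\<integral>\<^sup>+w. ennreal (indicator {0<..} r * r\<^sup>2) * (?h r w) \<partial>sphere_measure)"
        proof (rule nn_integral_cong_AE)
          show "AE w in sphere_measure. ennreal (beta p d * r\<^sup>2 * norm (X (b + r *\<^sub>R w)) powr p)
              = ennreal (indicator {0<..} r * r\<^sup>2) * (?h r w)"
            using AE_sphere_measure
          proof eventually_elim
            case (elim w)
            then have "b + r *\<^sub>R w \<in> cball b (2 * d)" using True d by (simp add: dist_norm)
            then show ?case using True d beta_pos[OF d, of p] by (simp add: ennreal_mult mult_ac)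
          qed
        qed
        finally show ?thesis using True d by simp
      qed (auto simp: indicator_def)
    qed
  qed
  also have "\<dots> = (\<integral>\<^sup>+y. ennreal (beta p d) * (indicator (cball b (2 * d)) y
      * ennreal (norm (X y) powr p)) \<partial>lborel)"
    by (rule nn_integral_polar'[symmetric]) (intro borel_measurable_times_ennreal
        borel_measurable_const borel_measurable_indicator_times, auto)
  finally show ?thesis .
qed

text \<open>By Fubini each point \<open>y\<close> is counted for the centres within
  \<open>2 * d\<close> of it, a volume of order \<open>d ^ 3\<close>, against the normalisation
  \<open>tent_mass d\<close>, which is at least of order \<open>d ^ 4\<close>.\<close>

lemma mdiv_L1_bound:
  assumes d: "d > 0"
  shows "(\<integral>\<^sup>+b. indicator (ball 0 (1 - 2 * d)) b * ennreal \<bar>mdiv d X b\<bar> \<partial>lborel)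
      \<le> ennreal (8 * beta p d / d) * (\<integral>\<^sup>+y. ennreal (norm (X y) powr p) \<partial>lborel)"
proof -
  have [measurable]: "X \<in> borel_measurable borel" using X by auto
  let ?g = "\<lambda>b y. (indicator (cball b (2 * d)) y * ennreal (norm (X y) powr p))"
  have N: "tent_mass d > 0" by (rule tent_mass_pos[OF d])
  define V where "V = unit_ball_vol 3"
  have V: "V > 0" unfolding V_def by simp
  have "(\<integral>\<^sup>+b. indicator (ball 0 (1 - 2 * d)) b * ennreal \<bar>mdiv d X b\<bar> \<partial>lborel)
      \<le> (\<integral>\<^sup>+b. \<integral>\<^sup>+y. ennreal (beta p d / tent_mass d) * (?g b y) \<partial>lborel \<partial>lborel)"
  proof (rule nn_integral_mono)
    fix b
    show "indicator (ball 0 (1 - 2 * d)) b * ennreal \<bar>mdiv d X b\<bar>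
        \<le> (\<integral>\<^sup>+y. ennreal (beta p d / tent_mass d) * (?g b y) \<partial>lborel)"
    proof (cases "b \<in> ball 0 (1 - 2 * d)")
      case True
      have "ennreal \<bar>mdiv d X b\<bar> = ennreal (1 / tent_mass d) * ennreal \<bar>Phi d (2 * d) X b\<bar>"
        using N by (simp add: mdiv_def flip: ennreal_mult)
      also have "\<dots> \<le> ennreal (1 / tent_mass d) * (\<integral>\<^sup>+y. ennreal (beta p d) * (?g b y) \<partial>lborel)"
        using Phi_Zflux_bound[OF d, of b] True by (intro mult_left_mono) auto
      also have "\<dots> = (\<integral>\<^sup>+y. ennreal (1 / tent_mass d) * (ennreal (beta p d) * (?g b y)) \<partial>lborel)"
        by (rule nn_integral_cmult[symmetric]) (unfold measurable_lborel2, intro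
            borel_measurable_times_ennreal borel_measurable_const borel_measurable_indicator_times,
            auto)
      also have "\<dots> = (\<integral>\<^sup>+y. ennreal (beta p d / tent_mass d) * (?g b y) \<partial>lborel)"
        using N beta_pos[OF d, of p] by (simp flip: mult.assoc ennreal_mult)
      finally show ?thesis using True by simp
    qed simp
  qed
  also have "\<dots> = (\<integral>\<^sup>+y. \<integral>\<^sup>+b. ennreal (beta p d / tent_mass d) * (?g b y) \<partial>lborel \<partial>lborel)"
    by (rule lborel_pair.Fubini'[symmetric]) (unfold indicator_def case_prod_unfold mem_cball,
        measurable)
  also have "\<dots> = (\<integral>\<^sup>+y. ennreal (beta p d / tent_mass d * (V * (2 * d) ^ 3))
      * ennreal (norm (X y) powr p) \<partial>lborel)"
  proof (rule nn_integral_cong)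
    fix y :: "real^3"
    have "(\<integral>\<^sup>+b. ennreal (beta p d / tent_mass d) * (?g b y) \<partial>lborel)
       = (\<integral>\<^sup>+b. (ennreal (beta p d / tent_mass d) * ennreal (norm (X y) powr p))
           * indicator (cball y (2 * d)) b \<partial>lborel)"
      by (intro nn_integral_cong) (auto simp: indicator_def dist_commute)
    also have "\<dots> = (ennreal (beta p d / tent_mass d) * ennreal (norm (X y) powr p))
        * emeasure lborel (cball y (2 * d))"
      by (rule nn_integral_cmult_indicator) simp
    also have "emeasure lborel (cball y (2 * d)) = ennreal (V * (2 * d) ^ 3)"
      using d by (subst emeasure_cball) (auto simp: V_def)
    also have "ennreal (beta p d / tent_mass d) * ennreal (norm (X y) powr p) * ennreal (V * (2
        * d) ^ 3) = ennreal (beta p d / tent_mass d * (V * (2 * d) ^ 3))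
        * ennreal (norm (X y) powr p)"
      using N V d beta_pos[OF d, of p] by (simp flip: ennreal_mult add: mult_ac)
    finally show "(\<integral>\<^sup>+b. ennreal (beta p d / tent_mass d) * (?g b y) \<partial>lborel)
       = ennreal (beta p d / tent_mass d * (V * (2 * d) ^ 3)) * ennreal (norm (X y) powr p)" .
  qed
  also have "\<dots> = ennreal (beta p d / tent_mass d * (V * (2 * d) ^ 3))
      * (\<integral>\<^sup>+y. ennreal (norm (X y) powr p) \<partial>lborel)"
    by (rule nn_integral_cmult) simp
  also have "\<dots> \<le> ennreal (8 * beta p d / d) * (\<integral>\<^sup>+y. ennreal (norm (X y) powr p) \<partial>lborel)"
  proof (intro mult_right_mono ennreal_leI)
    have "beta p d / tent_mass d * (V * (2 * d) ^ 3) \<le> beta p d / (V * d ^ 4) * (V * (2 * d) ^ 3)"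
      using tent_mass_ge[OF d] V d beta_pos[OF d, of p]
          by (intro mult_right_mono divide_left_mono) (auto simp: V_def intro!: mult_pos_pos
          tent_mass_pos)
    also have "\<dots> = 8 * beta p d / d" using V d
        by (simp add: field_simps power3_eq_cube power4_eq_xxxx)
    finally show "beta p d / tent_mass d * (V * (2 * d) ^ 3) \<le> 8 * beta p d / d" .
  qed simp
  finally show ?thesis .
qed

text \<open>The factor 80 is 16 + 64: shells of half-width \<open>d\<close> at scale
  \<open>d\<close>, and shells of half-width \<open>2 * d\<close> at scale \<open>d / 2\<close>. In
  both cases half-width plus twice the scale is \<open>3 * d\<close>, the gap required of
  \<open>T\<close>.\<close>

lemma mflux_step:
  assumes E: "(\<integral>\<^sup>+y. ennreal (norm (X y) powr p) \<partial>lborel) \<le> ennreal E" "E \<ge> 0"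
    and d: "d > 0" and T: "T + norm a + 3 * d < 1"
  shows "(LINT r|lborel. indicator {0<..T} r * \<bar>mflux d X a r - mflux (d/2) X a r\<bar>)
      \<le> 80 * beta p d * E"
proof -
  have [measurable]: "X \<in> borel_measurable borel" using X by auto
  have d2: "d / 2 > 0" using d by simp
  have q: "(1/4::real) powr (p - 1) \<le> 1" using p by (simp add: powr_le1)
  have b2: "beta p (d/2) \<le> beta p d" "beta p d > 0" "beta p (d/2) > 0"
    using beta_div_power[OF d, of p 1] q beta_pos[OF d, of p] beta_pos[OF d2, of p]
        by (auto simp: mult_le_cancel_left2)
  have osc: "(\<integral>\<^sup>+r. indicator {0<..T} r * ennreal (osc X c e a r) \<partial>lborel)
      \<le> ennreal (2 * e * (8 * beta p c / c) * E)"
    if c: "c > 0" "e > 0" "T + norm a + e + 2 * c < 1" for c e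
  proof -
    have "(\<integral>\<^sup>+r. indicator {0<..T} r * ennreal (osc X c e a r) \<partial>lborel)
        \<le> ennreal (2 * e) * (ennreal (8 * beta p c / c) * ennreal E)"
      using nn_integral_osc[OF X c] mdiv_L1_bound[OF c(1)] E(1)
      by (meson mult_left_mono order_trans zero_le)
    also have "\<dots> = ennreal (2 * e * (8 * beta p c / c) * E)"
      using c beta_pos[OF c(1), of p] E(2) by (simp flip: ennreal_mult add: mult.assoc)
    finally show ?thesis .
  qed
  have int: "integrable lborel (\<lambda>r. indicator {0<..T} r * \<bar>mflux d X a r - mflux (d/2) X a r\<bar>)"
  proof -
    have "integrable lborel (\<lambda>r. \<bar>indicator {0<..T} r * mflux d X a r - indicator {0<..T} r
        * mflux (d/2) X a r\<bar>)"
      using integrable_mflux_cut[OF X] d d2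
          by (intro integrable_abs Bochner_Integration.integrable_diff) auto
    then show ?thesis by (rule back_subst[of "integrable lborel"]) (auto simp: indicator_def
        fun_eq_iff)
  qed
  have "ennreal (LINT r|lborel. indicator {0<..T} r * \<bar>mflux d X a r - mflux (d/2) X a r\<bar>)
      = (\<integral>\<^sup>+r. ennreal (indicator {0<..T} r * \<bar>mflux d X a r - mflux (d/2) X a r\<bar>) \<partial>lborel)"
    by (rule nn_integral_eq_integral[symmetric, OF int]) simp
  also have "\<dots> \<le> (\<integral>\<^sup>+r. indicator {0<..T} r * ennreal (osc X d (2 * (d/2)) a r) + indicator {0<..T} r
      * ennreal (osc X (d/2) (2 * d) a r) \<partial>lborel)"
  proof (rule nn_integral_mono)
    fix r
    have o: "osc X c e a r \<ge> 0" for c e unfolding osc_def[OF X] by simp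
    show "ennreal (indicator {0<..T} r * \<bar>mflux d X a r - mflux (d/2) X a r\<bar>)
        \<le> indicator {0<..T} r * ennreal (osc X d (2 * (d/2)) a r) + indicator {0<..T} r
        * ennreal (osc X (d/2) (2 * d) a r)"
      using mflux_diff_le[OF X d d2, of a r] o
          by (auto simp: indicator_def simp flip: ennreal_plus intro!: ennreal_leI)
  qed
  also have "\<dots> = (\<integral>\<^sup>+r. indicator {0<..T} r * ennreal (osc X d (2 * (d/2)) a r) \<partial>lborel)
      + (\<integral>\<^sup>+r. indicator {0<..T} r * ennreal (osc X (d/2) (2 * d) a r) \<partial>lborel)"
    using borel_measurable_osc[OF X] by (intro nn_integral_add) auto
  also have "\<dots> \<le> ennreal (2 * (2 * (d/2)) * (8 * beta p d / d) * E) + ennreal (2 * (2 * d) * (8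
      * beta p (d/2) / (d/2)) * E)"
    using d T by (intro add_mono osc) auto
  also have "\<dots> = ennreal (2 * (2 * (d/2)) * (8 * beta p d / d) * E + 2 * (2 * d) * (8 * beta p (d/2)
      / (d/2)) * E)"
    using d b2 E(2) by (intro ennreal_plus[symmetric]) auto
  also have "2 * (2 * (d/2)) * (8 * beta p d / d) * E + 2 * (2 * d) * (8 * beta p (d/2) / (d/2)) * E
      = 16 * beta p d * E + 64 * beta p (d/2) * E"
    using d by (simp add: field_simps)
  also have "ennreal \<dots> \<le> ennreal (80 * beta p d * E)"
    using b2 E(2) mult_right_mono[OF b2(1) E(2)] by (intro ennreal_leI) (simp add: algebra_simps)
  finally show ?thesis using b2 E(2) by (subst (asm) ennreal_le_iff) auto
qed

lemma mflux_close:
  assumes E: "(\<integral>\<^sup>+y. ennreal (norm (X y) powr p) \<partial>lborel) \<le> ennreal E" "E \<ge> 0"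
    and d: "d > 0" and T: "T + norm a + 3 * d < 1"
  shows "(LINT r|lborel. indicator {0<..T} r * \<bar>mflux d X a r - sflux X a r\<bar>)
      \<le> 80 * beta p d * E / (1 - (1/4) powr (p - 1))"
proof -
  let ?q = "(1/4::real) powr (p - 1)"
  have q: "0 < ?q" "?q < 1" using p by (auto simp: powr_def ln_div)
  have "(LINT r|lborel. indicator {0<..T} r * \<bar>mflux (d / 2 ^ 0) X a r - sflux X a r\<bar>)
      \<le> (\<Sum>j. 80 * beta p d * E * ?q ^ j)"
  proof (rule mflux_sflux_L1[OF X, of "\<lambda>j. d / 2 ^ j"])
    show "(\<lambda>j. d / 2 ^ j) \<longlonglongrightarrow> 0"
      by (rule LIMSEQ_divide_realpow_zero) simp
    fix j
    have le: "d / 2 ^ j \<le> d" using d by (simp add: divide_le_eq mult_le_cancel_left1)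
    have "(LINT r|lborel. indicator {0<..T} r * \<bar>mflux (d / 2 ^ j) X a r - mflux (d / 2 ^ j
        / 2) X a r\<bar>) \<le> 80 * beta p (d / 2 ^ j) * E"
      using d T le by (intro mflux_step E) auto
    then show "(LINT r|lborel. indicator {0<..T} r * \<bar>mflux (d / 2 ^ j) X a r - mflux (d
        / 2 ^ Suc j) X a r\<bar>) \<le> 80 * beta p d * E * ?q ^ j"
      unfolding beta_div_power[OF d] by (simp add: mult_ac)
  qed (use d q in \<open>auto intro!: summable_mult summable_geometric\<close>)
  also have "(\<Sum>j. 80 * beta p d * E * ?q ^ j) = 80 * beta p d * E / (1 - ?q)"
    using q by (subst suminf_mult) (auto simp: suminf_geometric summable_geometric)
  finally show ?thesis by simp
qed

end

section \<open>Weak limits of fields with integer fluxes\<close>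

lemma integrable_cball_const: "integrable lborel (\<lambda>b. indicator (cball a r) b * (c::real))"
    for a :: "'a::euclidean_space"
  by (rule integrable_bounded_support[of _ "\<bar>c\<bar>" a r]) (auto simp: indicator_def)

lemma mflux_bound:
  assumes X: "integrable lborel X" and N: "(LINT y|lborel. norm (X y)) \<le> N" and d: "d > 0" and r: "r
      \<le> T"
  shows "\<bar>mflux d X a r\<bar> \<le> (LINT b|lborel. indicator (cball a T) b * (N / tent_mass d))"
  unfolding mflux_def
proof (rule integral_abs_bound_integral)
  show "integrable lborel (\<lambda>b. indicator {..<r} (norm (a - b)) * mdiv d X b)"
    by (rule integrable_mdiv_norm[OF X d, of _ r]) auto
  fix b
  have "\<bar>mdiv d X b\<bar> \<le> N / tent_mass d"
    using mdiv_bound[OF X d, of b] divide_right_mono[OF N, of "tent_mass d"] tent_mass_pos[OF d]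
        by linarith
  then show "\<bar>indicator {..<r} (norm (a - b)) * mdiv d X b\<bar>
      \<le> indicator (cball a T) b * (N / tent_mass d)"
    using r by (auto simp: indicator_def dist_norm intro: order_trans[OF abs_ge_zero])
qed (rule integrable_cball_const)

text \<open>At a fixed scale the mollified divergences converge pointwise and are bounded uniformly
  in \<open>k\<close>, so dominated convergence on the ball applies.\<close>

lemma LIMSEQ_mflux:
  assumes Xs: "\<And>k. integrable lborel (Xs k)" and X: "integrable lborel X"
    and N: "\<And>k. (LINT y|lborel. norm (Xs k y)) \<le> N" and d: "d > 0"
    and conv: "\<And>b. (\<lambda>k. Phi d (2 * d) (Xs k) b) \<longlonglongrightarrow> Phi d (2 * d) X b"
  shows "(\<lambda>k. mflux d (Xs k) a r) \<longlonglongrightarrow> mflux d X a r"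
  unfolding mflux_def
proof (rule integral_dominated_convergence)
  have [measurable]: "X \<in> borel_measurable borel" "Xs k \<in> borel_measurable borel" for k
      using X Xs[of k] by auto
  show "(\<lambda>b. indicator {..<r} (norm (a - b)) * mdiv d X b) \<in> borel_measurable lborel"
    "(\<lambda>b. indicator {..<r} (norm (a - b)) * mdiv d (Xs k) b) \<in> borel_measurable lborel" for k
    unfolding indicator_def lessThan_iff by measurable
  show "AE b in lborel. (\<lambda>k. indicator {..<r} (norm (a - b)) * mdiv d (Xs k) b)
      \<longlonglongrightarrow> indicator {..<r} (norm (a - b)) * mdiv d X b"
    unfolding mdiv_def using conv tent_mass_pos[OF d] by (intro AE_I2 tendsto_intros) auto
  show "integrable lborel (\<lambda>b. indicator (cball a r) b * (N / tent_mass d))"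
      by (rule integrable_cball_const)
  fix k
  show "AE b in lborel. norm (indicator {..<r} (norm (a - b)) * mdiv d (Xs k) b)
      \<le> indicator (cball a r) b * (N / tent_mass d)"
  proof (rule AE_I2)
    fix b
    have "\<bar>mdiv d (Xs k) b\<bar> \<le> N / tent_mass d"
      using mdiv_bound[OF Xs d, of k b] divide_right_mono[OF N[of k], of "tent_mass d"]
          tent_mass_pos[OF d] by linarith
    then show "norm (indicator {..<r} (norm (a - b)) * mdiv d (Xs k) b)
        \<le> indicator (cball a r) b * (N / tent_mass d)"
      by (auto simp: indicator_def dist_norm intro: order_trans[OF abs_ge_zero])
  qed
qed

lemma infdist_Ints_le: "infdist (x::real) \<int> \<le> 1"
proof -
  have "infdist x \<int> \<le> dist x (of_int \<lfloor>x\<rfloor>)" by (rule infdist_le) simp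
  also have "\<dots> \<le> 1" unfolding dist_real_def by linarith
  finally show ?thesis .
qed

lemma borel_measurable_infdist_Ints [measurable]:
  assumes "f \<in> borel_measurable M"
  shows "(\<lambda>x. infdist (f x) (\<int> :: real set)) \<in> borel_measurable M"
proof -
  have "(\<lambda>x. infdist x (\<int> :: real set)) \<in> borel_measurable borel"
    by (intro borel_measurable_continuous_onI continuous_on_infdist continuous_on_id)
  from measurable_compose[OF assms this] show ?thesis .
qed

lemma infdist_le_abs_diff: "y \<in> \<int> \<Longrightarrow> infdist (x::real) \<int> \<le> \<bar>x - y\<bar>"
  using infdist_le[of y \<int> x] by (simp add: dist_real_def)

text \<open>For each \<open>j\<close> the fluxes mollified at scale \<open>d j\<close> are within
  \<open>e j\<close> of integers in the mean over the radii, uniformly in \<open>k\<close> thanks to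
  the common bound \<open>E\<close>. So \<open>k\<close> tends to infinity at fixed scale before the
  scale tends to 0.\<close>

lemma weak_limit_Zflux:
  assumes Xs: "\<And>k. integrable lborel (Xs k)" and X: "integrable lborel X"
    and Z: "\<And>k. Zflux (Xs k)" and p: "p > 1"
    and E: "\<And>k. (\<integral>\<^sup>+y. ennreal (norm (Xs k y) powr p) \<partial>lborel) \<le> ennreal E" "E \<ge> 0"
    and N: "\<And>k. (LINT y|lborel. norm (Xs k y)) \<le> N"
    and conv: "\<And>d b. d > 0 \<Longrightarrow> (\<lambda>k. Phi d (2 * d) (Xs k) b) \<longlonglongrightarrow> Phi d (2 * d) X b"
  shows "Zflux X"
proof -
  have mX [measurable]: "X \<in> borel_measurable borel"
      and mXs [measurable]: "Xs k \<in> borel_measurable borel" for k using X Xs[of k] by auto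
  define q where "q = (1/4::real) powr (p - 1)"
  have q: "0 < q" "q < 1" using p by (auto simp: q_def powr_def ln_div)
  have main: "AE r in lborel. 0 < r \<and> r \<le> T \<longrightarrow> sflux X a r \<in> \<int>"
      if a: "norm a < 1" and T: "T < 1 - norm a" for a T
  proof -
    \<comment> \<open>A quarter of the gap between \<open>T\<close> and \<open>1 - norm a\<close>
      leaves room for the three times \<open>d 0\<close> required by
      \<open>mflux_close\<close>.\<close>
    define d where "d j = (1 - norm a - T) / 4 / 2 ^ j" for j :: nat
    have d00: "d 0 = (1 - norm a - T) / 4" by (simp add: d_def)
    have d01: "d 0 > 0" using T unfolding d00 by simp
    have "4 * d 0 = 1 - norm a - T" unfolding d00 by simp
    with d01 have d02: "T + norm a + 3 * d 0 < 1" by simp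
    note d0 = d01 d02
    have dj: "d j = d 0 / 2 ^ j" for j by (simp add: d_def)
    have d: "d j > 0" "d j \<le> d 0" for j
      using d0 by (auto simp: dj[of j] divide_le_eq mult_le_cancel_left1)
    have dlim: "d \<longlonglongrightarrow> 0" unfolding d_def[abs_def] by (rule LIMSEQ_divide_realpow_zero) simp
    define c where "c = 80 * beta p (d 0) * E / (1 - q)"
    define e where "e j = c * q ^ j" for j
    have c: "c \<ge> 0" using beta_pos[OF d0(1), of p] E(2) q by (simp add: c_def)
    have elim0: "e \<longlonglongrightarrow> 0" unfolding e_def[abs_def]
      using tendsto_mult_right_zero[OF LIMSEQ_realpow_zero, of q c] q by simp
    let ?c = "\<lambda>j k. (LINT r|lborel. indicator {0<..T} r * \<bar>mflux (d j) (Xs k) a r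
        - sflux (Xs k) a r\<bar>)"
    let ?s = "\<lambda>j k. (LINT r|lborel. indicator {0<..T} r * \<bar>mflux (d j) (Xs k) a r
        - mflux (d (Suc j)) (Xs k) a r\<bar>)"
    have close: "(?c j k) \<le> e j" for j k
    proof -
      have "(?c j k) \<le> 80 * beta p (d j) * E / (1 - q)"
        unfolding q_def using d[of j] d0 by (intro mflux_close Xs Z p E) auto
      also have "\<dots> = e j"
        unfolding dj[of j] beta_div_power[OF d0(1)] by (simp add: e_def c_def q_def)
      finally show ?thesis .
    qed
    have imf: "integrable lborel (\<lambda>r. indicator {0<..T} r * \<bar>mflux x Y a r - mflux y Y a r\<bar>)"
       and isf: "integrable lborel (\<lambda>r. indicator {0<..T} r * \<bar>mflux x Y a r - sflux Y a r\<bar>)"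
       if "integrable lborel Y" "x > 0" "y > 0" for x y Y
    proof -
      have cut: "(\<lambda>r. \<bar>indicator {0<..T} r * g r - indicator {0<..T} r * h r\<bar>)
          = (\<lambda>r. indicator {0<..T} r * \<bar>g r - h r\<bar>)" for g h :: "real \<Rightarrow> real"
        by (auto simp: indicator_def fun_eq_iff)
      have "integrable lborel (\<lambda>r. \<bar>indicator {0<..T} r * mflux x Y a r - indicator {0<..T} r
          * mflux y Y a r\<bar>)"
        "integrable lborel (\<lambda>r. \<bar>indicator {0<..T} r * mflux x Y a r - indicator {0<..T} r
            * sflux Y a r\<bar>)"
        using integrable_mflux_cut integrable_sflux_cut that
            by (intro integrable_abs Bochner_Integration.integrable_diff; blast)+
      then show "integrable lborel (\<lambda>r. indicator {0<..T} r * \<bar>mflux x Y a r - mflux y Y a r\<bar>)"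
        "integrable lborel (\<lambda>r. indicator {0<..T} r * \<bar>mflux x Y a r - sflux Y a r\<bar>)"
        unfolding cut .
    qed
    have mlim: "(\<lambda>k. mflux (d j) (Xs k) a r) \<longlonglongrightarrow> mflux (d j) X a r" for j r
      by (rule LIMSEQ_mflux[OF Xs X N d(1) conv[OF d(1)]])
    have iT: "integrable lborel (\<lambda>r. indicator {0<..T} r * (B::real))" for B
      by (rule integrable_bounded_support[of _ "\<bar>B\<bar>" 0 "\<bar>T\<bar>"]) (auto simp: indicator_def)
    \<comment> \<open>Integrality of the mollified flux is lost, but its distance to the integers is
      continuous and at most 1, so its integral passes to the limit.\<close>
    have distm: "(LINT r|lborel. indicator {0<..T} r * infdist (mflux (d j) X a r) \<int>) \<le> e j" for j
    proof (rule LIMSEQ_le_const2)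
      show "(\<lambda>k. LINT r|lborel. indicator {0<..T} r * infdist (mflux (d j) (Xs k) a r) \<int>)
          \<longlonglongrightarrow> (LINT r|lborel. indicator {0<..T} r * infdist (mflux (d j) X a r) \<int>)"
      proof (rule integral_dominated_convergence[OF _ _ iT[of 1]])
        show "AE r in lborel. (\<lambda>k. indicator {0<..T} r * infdist (mflux (d j) (Xs k) a r) \<int>)
            \<longlonglongrightarrow> indicator {0<..T} r * infdist (mflux (d j) X a r) \<int>"
          by (intro AE_I2 tendsto_intros mlim)
        show "AE r in lborel. norm (indicator {0<..T} r * infdist (mflux (d j) (Xs k) a r) \<int>)
            \<le> indicator {0<..T} r * 1" for k
          by (intro AE_I2) (auto simp: indicator_def infdist_nonneg infdist_Ints_le)
      qed measurable
      show "\<exists>M. \<forall>k\<ge>M. (LINT r|lborel. indicator {0<..T} r * infdist (mflux (d j) (Xs k) a r) \<int>) \<le> e j"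
      proof (intro exI[of _ 0] allI impI)
        fix k
        have "(LINT r|lborel. indicator {0<..T} r * infdist (mflux (d j) (Xs k) a r) \<int>) \<le> (?c j k)"
        proof (rule integral_mono_AE)
          show "integrable lborel (\<lambda>r. indicator {0<..T} r * infdist (mflux (d j) (Xs k) a r) \<int>)"
            by (rule integrable_bounded_support[of _ 1 0 "\<bar>T\<bar>"]) (auto simp: indicator_def
                infdist_nonneg infdist_Ints_le)
          show "integrable lborel (\<lambda>r. indicator {0<..T} r * \<bar>mflux (d j) (Xs k) a r
              - sflux (Xs k) a r\<bar>)"
            using isf[OF Xs d(1) d(1)] .
          have "AE r in lborel. 0 < r \<and> r < 1 - norm a \<longrightarrow> sflux (Xs k) a r \<in> \<int>"
            using Z[of k] a by (simp add: Zflux_def B3_def)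
          then show "AE r in lborel. indicator {0<..T} r * infdist (mflux (d j) (Xs k) a r) \<int>
              \<le> indicator {0<..T} r * \<bar>mflux (d j) (Xs k) a r - sflux (Xs k) a r\<bar>"
            by eventually_elim (use T in \<open>auto simp: indicator_def intro!: infdist_le_abs_diff\<close>)
        qed
        also have "\<dots> \<le> e j" by (rule close)
        finally show "(LINT r|lborel. indicator {0<..T} r * infdist (mflux (d j) (Xs k) a r) \<int>)
            \<le> e j" .
      qed
    qed
    \<comment> \<open>\<open>mflux_close\<close> cannot be applied to \<open>X\<close>, whose
      integrality is the claim. The estimate for consecutive scales does survive the limit in
      \<open>k\<close>, and it is all that \<open>mflux_sflux_L1\<close> asks for.\<close>
    have step: "(LINT r|lborel. indicator {0<..T} r * \<bar>mflux (d j) X a r - mflux (d (Suc j)) X a r\<bar>)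
        \<le> e j + e (Suc j)" for j
    proof (rule LIMSEQ_le_const2)
      define N' where "N' = max N (LINT y|lborel. norm (X y))"
      define B where "B i = (LINT b|lborel. indicator (cball a T) b * (N' / tent_mass (d i)))" for i
      have mb: "\<bar>mflux (d i) (Xs k) a r\<bar> \<le> B i" if "r \<le> T" for i k r
        unfolding B_def using N[of k] by (intro mflux_bound Xs d that) (simp add: N'_def)
      show "(\<lambda>k. LINT r|lborel. indicator {0<..T} r * \<bar>mflux (d j) (Xs k) a r
          - mflux (d (Suc j)) (Xs k) a r\<bar>)
          \<longlonglongrightarrow> (LINT r|lborel. indicator {0<..T} r * \<bar>mflux (d j) X a r - mflux (d (Suc j)) X a r\<bar>)"
      proof (rule integral_dominated_convergence[OF _ _ iT[of "B j + B (Suc j)"]])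
        show "AE r in lborel. (\<lambda>k. indicator {0<..T} r * \<bar>mflux (d j) (Xs k) a r
            - mflux (d (Suc j)) (Xs k) a r\<bar>)
            \<longlonglongrightarrow> indicator {0<..T} r * \<bar>mflux (d j) X a r - mflux (d (Suc j)) X a r\<bar>"
          by (intro AE_I2 tendsto_intros mlim)
        show "AE r in lborel. norm (indicator {0<..T} r * \<bar>mflux (d j) (Xs k) a r
            - mflux (d (Suc j)) (Xs k) a r\<bar>) \<le> indicator {0<..T} r * (B j + B (Suc j))" for k
        proof (rule AE_I2)
          fix r
          show "norm (indicator {0<..T} r * \<bar>mflux (d j) (Xs k) a r - mflux (d (Suc j)) (Xs k) a r\<bar>)
              \<le> indicator {0<..T} r * (B j + B (Suc j))"
            using mb[of r j k] mb[of r "Suc j" k] by (auto simp: indicator_def)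
        qed
      qed measurable
      show "\<exists>M. \<forall>k\<ge>M. (?s j k) \<le> e j + e (Suc j)"
      proof (intro exI[of _ 0] allI impI)
        fix k
        have "(?s j k)
           \<le> (LINT r|lborel. indicator {0<..T} r * \<bar>mflux (d j) (Xs k) a r - sflux (Xs k) a r\<bar>
               + indicator {0<..T} r * \<bar>mflux (d (Suc j)) (Xs k) a r - sflux (Xs k) a r\<bar>)"
          by (rule integral_mono[OF imf[OF Xs d(1) d(1)] Bochner_Integration.integrable_add[OF isf[OF
              Xs d(1) d(1)] isf[OF Xs d(1) d(1)]]])
            (auto simp: indicator_def)
        also have "\<dots> = (?c j k) + (LINT r|lborel. indicator {0<..T} r * \<bar>mflux (d (Suc j)) (Xs k) a r
            - sflux (Xs k) a r\<bar>)"
          by (rule Bochner_Integration.integral_add[OF isf[OF Xs d(1) d(1)] isf[OF Xs d(1) d(1)]])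
        also have "\<dots> \<le> e j + e (Suc j)" by (intro add_mono close)
        finally show "(?s j k) \<le> e j + e (Suc j)" .
      qed
    qed
    \<comment> \<open>Consecutive errors satisfy \<open>e j + e (Suc j) \<le> 2 * e j\<close>;
      summing the geometric series from index \<open>i\<close> on gives the constant.\<close>
    have closeX: "(LINT r|lborel. indicator {0<..T} r * \<bar>mflux (d i) X a r - sflux X a r\<bar>)
        \<le> 2 / (1 - q) * e i" for i
    proof -
      have sm: "summable (\<lambda>j. 2 * e i * q ^ j)" using q
          by (intro summable_mult summable_geometric) auto
      have "(LINT r|lborel. indicator {0<..T} r * \<bar>mflux (d (i + 0)) X a r - sflux X a r\<bar>)
          \<le> (\<Sum>j. 2 * e i * q ^ j)"
      proof (rule mflux_sflux_L1[OF X, of "\<lambda>j. d (i + j)"])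
        show "(\<lambda>j. d (i + j)) \<longlonglongrightarrow> 0" using LIMSEQ_ignore_initial_segment[OF dlim, of i]
            by (simp add: add.commute)
        fix j
        have "e (i + j) + e (Suc (i + j)) \<le> e (i + j) + e (i + j)"
          using q c by (simp add: e_def mult_left_mono mult_le_cancel_right1 mult_left_le_one_le)
        also have "\<dots> = 2 * e i * q ^ j" by (simp add: e_def power_add)
        finally show "(LINT r|lborel. indicator {0<..T} r * \<bar>mflux (d (i + j)) X a r - mflux (d (i
            + Suc j)) X a r\<bar>) \<le> 2 * e i * q ^ j"
          using step[of "i + j"] by simp
      qed (use d sm in auto)
      also have "(\<Sum>j. 2 * e i * q ^ j) = 2 / (1 - q) * e i"
        using q by (subst suminf_mult) (auto simp: suminf_geometric summable_geometric)
      finally show ?thesis by simp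
    qed
    have iD: "integrable lborel (\<lambda>r. indicator {0<..T} r * infdist (sflux X a r) \<int>)"
      "integrable lborel (\<lambda>r. indicator {0<..T} r * infdist (mflux (d i) X a r) \<int>)" for i
      by (rule integrable_bounded_support[of _ 1 0 "\<bar>T\<bar>"]; auto simp: indicator_def infdist_nonneg
          infdist_Ints_le)+
    have "(LINT r|lborel. indicator {0<..T} r * infdist (sflux X a r) \<int>) \<le> e i + 2 / (1 - q) * e i"
        for i
    proof -
      have "(LINT r|lborel. indicator {0<..T} r * infdist (sflux X a r) \<int>)
        \<le> (LINT r|lborel. indicator {0<..T} r * infdist (mflux (d i) X a r) \<int> + indicator {0<..T} r
            * \<bar>mflux (d i) X a r - sflux X a r\<bar>)"
      proof (rule integral_mono[OF iD(1) Bochner_Integration.integrable_add[OF iD(2) isf[OF X d(1)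
          d(1)]]])
        fix r
        show "indicator {0<..T} r * infdist (sflux X a r) \<int>
            \<le> indicator {0<..T} r * infdist (mflux (d i) X a r) \<int> + indicator {0<..T} r
            * \<bar>mflux (d i) X a r - sflux X a r\<bar>"
          using infdist_triangle[of "sflux X a r" \<int> "mflux (d i) X a r"]
              by (auto simp: indicator_def dist_real_def)
      qed
      also have "\<dots> = (LINT r|lborel. indicator {0<..T} r * infdist (mflux (d i) X a r) \<int>)
          + (LINT r|lborel. indicator {0<..T} r * \<bar>mflux (d i) X a r - sflux X a r\<bar>)"
        by (rule Bochner_Integration.integral_add[OF iD(2) isf[OF X d(1) d(1)]])
      also have "\<dots> \<le> e i + 2 / (1 - q) * e i" by (intro add_mono distm closeX)
      finally show ?thesis .
    qed
    moreover have "(\<lambda>i. e i + 2 / (1 - q) * e i) \<longlonglongrightarrow> 0 + 2 / (1 - q) * 0"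
        by (intro tendsto_intros elim0)
    ultimately have "(LINT r|lborel. indicator {0<..T} r * infdist (sflux X a r) \<int>) \<le> 0"
      by (intro LIMSEQ_le_const[where X="\<lambda>i. e i + 2 / (1 - q) * e i"]) auto
    moreover have "(LINT r|lborel. indicator {0<..T} r * infdist (sflux X a r) \<int>) \<ge> 0"
      by (intro integral_nonneg_AE AE_I2) (auto simp: infdist_nonneg)
    ultimately have "AE r in lborel. indicator {0<..T} r * infdist (sflux X a r) \<int> = 0"
      using integral_nonneg_eq_0_iff_AE[OF iD(1)] by (auto simp: infdist_nonneg)
    then show ?thesis
    proof eventually_elim
      case (elim r)
      have "closed (\<int> :: real set)" "(\<int> :: real set) \<noteq> {}" by auto
      with elim show ?case by (auto simp: indicator_def in_closed_iff_infdist_zero)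
    qed
  qed
  show ?thesis unfolding Zflux_def
  proof
    fix a assume "a \<in> B3"
    then have a: "norm a < 1" by (simp add: B3_def)
    \<comment> \<open>The estimates need a positive gap between \<open>T\<close> and
      \<open>1 - norm a\<close>; countably many \<open>T\<close> exhaust all radii.\<close>
    have "AE r in lborel. \<forall>n::nat. 0 < r \<and> r \<le> 1 - norm a - inverse (real (Suc n)) \<longrightarrow> sflux X a r \<in> \<int>"
      unfolding AE_all_countable using a by (intro allI main) auto
    then show "AE r in lborel. 0 < r \<and> r < 1 - norm a \<longrightarrow> sflux X a r \<in> \<int>"
    proof eventually_elim
      case (elim r)
      show ?case
      proof
        assume r: "0 < r \<and> r < 1 - norm a"
        then obtain n where "inverse (real (Suc n)) < 1 - norm a - r"
            using reals_Archimedean[of "1 - norm a - r"] by auto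
        then have "r \<le> 1 - norm a - inverse (real (Suc n))" by linarith
        then show "sflux X a r \<in> \<int>" using elim r by blast
      qed
    qed
  qed
qed

section \<open>Weak closedness\<close>

text \<open>Jensen's inequality for weights of total mass at most 1. Young's inequality for
  \<open>t i\<close> against \<open>S powr (q - 1)\<close> leaves a term
  \<open>S powr q / q'\<close>, which is absorbed on the left.\<close>

lemma powr_suminf_le:
  fixes l t :: "nat \<Rightarrow> real"
  assumes q: "q > 1" and l: "\<And>i. l i \<ge> 0" "summable l" "suminf l \<le> 1" and t: "\<And>i. t i \<ge> 0"
    and s1: "summable (\<lambda>i. l i * t i)" and s2: "summable (\<lambda>i. l i * t i powr q)"
  shows "(\<Sum>i. l i * t i) powr q \<le> (\<Sum>i. l i * t i powr q)"
proof (cases "(\<Sum>i. l i * t i) = 0")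
  case True
  then show ?thesis using l t by (auto intro!: suminf_nonneg s2)
next
  case False
  define S where "S = (\<Sum>i. l i * t i)"
  have S: "S > 0" using False l t unfolding S_def by (simp add: suminf_nonneg s1 less_le)
  define q' where "q' = q / (q - 1)"
  have q': "q' > 1" "1 / q + 1 / q' = 1" using q by (auto simp: q'_def field_simps)
  have qq: "(q - 1) * q' = q" using q by (simp add: q'_def)
  have "S powr q = S powr (q - 1) * S" using S by (simp add: powr_diff)
  also have "\<dots> = (\<Sum>i. S powr (q - 1) * (l i * t i))" unfolding S_def
      by (rule suminf_mult[OF s1, symmetric])
  also have "\<dots> \<le> (\<Sum>i. (l i * t i powr q) / q + l i * (S powr q / q'))"
  proof (rule suminf_le)
    show "S powr (q - 1) * (l i * t i) \<le> (l i * t i powr q) / q + l i * (S powr q / q')" for i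
    proof -
      have "t i * S powr (q - 1) \<le> t i powr q / q + (S powr (q - 1)) powr q' / q'"
        using q q' t by (intro Youngs_inequality) auto
      then have "l i * (t i * S powr (q - 1)) \<le> l i * (t i powr q / q + S powr q / q')"
        using l(1)[of i] by (intro mult_left_mono) (simp_all add: powr_powr qq)
      then show ?thesis by (simp add: algebra_simps)
    qed
    show "summable (\<lambda>i. S powr (q - 1) * (l i * t i))" by (intro summable_mult s1)
    show "summable (\<lambda>i. (l i * t i powr q) / q + l i * (S powr q / q'))"
      by (intro summable_add summable_divide s2 summable_mult2 l)
  qed
  also have "\<dots> = (\<Sum>i. l i * t i powr q) / q + suminf l * (S powr q / q')"
    by (simp only: suminf_add[OF summable_divide[OF s2] summable_mult2[OF l(2)], symmetric]
        suminf_divide[OF s2] suminf_mult2[OF l(2), symmetric])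
  also have "\<dots> \<le> (\<Sum>i. l i * t i powr q) / q + 1 * (S powr q / q')"
    using l(3) q' by (intro add_left_mono mult_right_mono) auto
  finally have "S powr q * (1 - 1 / q') \<le> (\<Sum>i. l i * t i powr q) / q" by (simp add: algebra_simps)
  moreover have "1 - 1 / q' = 1 / q" using q' by simp
  ultimately have "S powr q / q \<le> (\<Sum>i. l i * t i powr q) / q" by simp
  then show ?thesis using q by (simp add: S_def divide_le_cancel)
qed

text \<open>In the application \<open>c j i\<close> is the pairing of the \<open>j\<close>-th chosen
  field with the \<open>i\<close>-th hump, so that row \<open>j\<close> tests all humps chosen
  before the \<open>j\<close>-th.\<close>

fun sgnseq :: "(nat \<Rightarrow> nat \<Rightarrow> real) \<Rightarrow> nat \<Rightarrow> real" where
  "sgnseq c j = (if (\<Sum>i<j. sgnseq c i * c j i) \<ge> 0 then 1 else -1)"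

declare sgnseq.simps [simp del]

lemma abs_sgnseq [simp]: "\<bar>sgnseq c j\<bar> = 1"
  by (subst sgnseq.simps) auto

lemma sgnseq_gain: "\<bar>\<Sum>i<Suc j. sgnseq c i * c j i\<bar> \<ge> c j j"
  using sgnseq.simps[of c j] by (cases "(\<Sum>i<j. sgnseq c i * c j i) \<ge> 0") auto

text \<open>Gliding hump: the signs in the series for the test function are chosen so that the earlier
  terms never cancel the current one.\<close>
lemma Lp_weak_bounded:
  fixes f :: "nat \<Rightarrow> 'a \<Rightarrow> 'b::euclidean_space"
  assumes M: "finite_measure M" and p: "p > 1"
    and f [measurable]: "\<And>k. f k \<in> borel_measurable M"
        and fp: "\<And>k. integrable M (\<lambda>x. norm (f k x) powr p)"
    and bounded: "\<And>g. g \<in> borel_measurable M \<Longrightarrow> integrable M (\<lambda>x. norm (g x) powr (p / (p - 1)))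
        \<Longrightarrow> Bseq (\<lambda>k. LINT x|M. f k x \<bullet> g x)"
  shows "\<exists>E. \<forall>k. (LINT x|M. norm (f k x) powr p) \<le> E"
proof (rule ccontr)
  assume "\<not> ?thesis"
  then have unb: "\<exists>k. (LINT x|M. norm (f k x) powr p) > E" for E by (metis not_le)
  interpret finite_measure M by (rule M)
  define q where "q = p / (p - 1)"
  have q: "q > 1" "1 / p + 1 / q = 1" "(p - 1) * q = p" using p by (auto simp: q_def field_simps)
  have "\<forall>j. \<exists>k. (LINT x|M. norm (f k x) powr p) > (4 ^ j) powr p" using unb by blast
  then obtain k where k: "\<And>j. (LINT x|M. norm (f (k j) x) powr p) > (4 ^ j) powr p" by metis
  define I where "I j = (LINT x|M. norm (f (k j) x) powr p)" for j
  define N where "N j = I j powr (1 / p)" for j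
  have I: "I j > 0" for j using k[of j] unfolding I_def by (smt (verit) powr_ge_zero)
  have N: "N j > 0" "N j powr p = I j" for j using I[of j] p by (auto simp: N_def powr_powr)
  have N4: "N j \<ge> 4 ^ j" for j
  proof -
    have "((4 ^ j) powr p) powr (1 / p) \<le> N j"
      unfolding N_def using k[of j] p by (intro powr_mono2) (auto simp: I_def)
    then show ?thesis using p by (simp add: powr_powr)
  qed
  \<comment> \<open>The extremal function of Hoelder's inequality for \<open>f (k i)\<close>, with
    norm 1 in the conjugate exponent \<open>q\<close>: its pairing with \<open>f (k i)\<close> is
    exactly \<open>N i\<close>.\<close>
  define g where "g i x = (norm (f (k i) x) powr (p - 2) / N i powr (p - 1)) *\<^sub>R f (k i) x" for i x
  have [measurable]: "g i \<in> borel_measurable M" for i unfolding g_def by measurable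
  have ng: "norm (g i x) = norm (f (k i) x) powr (p - 1) / N i powr (p - 1)" for i x
  proof (cases "f (k i) x = 0")
    case False
    have "norm (f (k i) x) powr (p - 2) * norm (f (k i) x) = norm (f (k i) x) powr (p - 1)"
      using False powr_add[of "norm (f (k i) x)" "p - 2" 1] by simp
    then show ?thesis using N[of i] by (simp add: g_def)
  qed (simp add: g_def)
  have ngq: "norm (g i x) powr q = norm (f (k i) x) powr p / I i" for i x
    using N[of i] by (simp add: ng powr_divide powr_powr q(3))
  have gq: "integrable M (\<lambda>x. norm (g i x) powr q)" "(LINT x|M. norm (g i x) powr q) = 1" for i
    unfolding ngq using fp[of "k i"] I[of i] by (auto simp flip: I_def)
  \<comment> \<open>Young's inequality for \<open>f (k j)\<close> divided by its norm; multiplied by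
    \<open>N j\<close> the bound integrates to exactly \<open>N j\<close>, which is Hoelder's
    inequality for this pair.\<close>
  let ?y = "\<lambda>i j x. (norm (f (k j) x) powr p / I j) / p + norm (g i x) powr q / q"
  have bd: "norm (f (k j) x) * norm (g i x) \<le> N j * ((?y i j x))" for i j x
  proof -
    have "(norm (f (k j) x) / N j) * norm (g i x)
        \<le> (norm (f (k j) x) / N j) powr p / p + norm (g i x) powr q / q"
      using p q N[of j] by (intro Youngs_inequality) auto
    then have "N j * ((norm (f (k j) x) / N j) * norm (g i x))
        \<le> N j * ((norm (f (k j) x) / N j) powr p / p + norm (g i x) powr q / q)"
      using N[of j] by (intro mult_left_mono) auto
    then show ?thesis using N[of j] by (simp add: powr_divide)
  qed
  have ibd: "integrable M (\<lambda>x. N j * ((?y i j x)))"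
     "(LINT x|M. N j * ((?y i j x))) = N j" for i j
  proof -
    show "integrable M (\<lambda>x. N j * ((?y i j x)))"
      using fp[of "k j"] gq(1)[of i] by auto
    have "(LINT x|M. N j * ((?y i j x))) = N j * ((I j / I j) / p + 1 / q)"
      using fp[of "k j"] gq[of i] by (simp add: I_def)
    then show "(LINT x|M. N j * ((?y i j x))) = N j"
      using q(2) I[of j] by simp
  qed
  have ifg: "integrable M (\<lambda>x. norm (f (k j) x) * norm (g i x))" "(LINT x|M. norm (f (k j) x)
      * norm (g i x)) \<le> N j" for i j
  proof -
    show *: "integrable M (\<lambda>x. norm (f (k j) x) * norm (g i x))"
      by (rule Bochner_Integration.integrable_bound[OF ibd(1)[of j i]]) (use bd in \<open>auto intro!: AE_I2
          order_trans[OF _ abs_ge_self]\<close>)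
    have "(LINT x|M. norm (f (k j) x) * norm (g i x)) \<le> (LINT x|M. N j * ((?y i j x)))"
      by (rule integral_mono[OF * ibd(1)]) (rule bd)
    then show "(LINT x|M. norm (f (k j) x) * norm (g i x)) \<le> N j" unfolding ibd(2) .
  qed
  \<comment> \<open>With ratio 1/3 the weights after index \<open>j\<close> add up to
    \<open>l j / 2\<close>, so the tail cancels at most half of the diagonal term
    \<open>l j * N j\<close>. Against norms of size at least \<open>4 ^ j\<close> what remains still
    grows like \<open>(4/3) ^ j\<close>.\<close>
  define l where "l i = (1/3::real) ^ Suc i" for i
  have l: "l i > 0" for i by (simp add: l_def)
  have lsum: "summable l" "suminf l = 1 / 2"
  proof -
    have "l sums (1/3 * (1 / (1 - 1/3)))" unfolding l_def power_Suc
        by (intro sums_mult geometric_sums) simp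
    then show "summable l" "suminf l = 1 / 2" by (auto simp: sums_iff)
  qed
  define c where "c j i = l i * (LINT x|M. f (k j) x \<bullet> g i x)" for j i
  have ifgi: "integrable M (\<lambda>x. f (k j) x \<bullet> g i x)" for i j
    by (rule Bochner_Integration.integrable_bound[OF ifg(1)[of j i]]) (auto intro!: AE_I2
        Cauchy_Schwarz_ineq2)
  have cle: "\<bar>c j i\<bar> \<le> l i * N j" for i j
  proof -
    have "\<bar>LINT x|M. f (k j) x \<bullet> g i x\<bar> \<le> (LINT x|M. norm (f (k j) x) * norm (g i x))"
      by (rule order_trans[OF integral_abs_bound integral_mono[OF integrable_abs[OF ifgi] ifg(1)]])
          (rule Cauchy_Schwarz_ineq2)
    then have "\<bar>LINT x|M. f (k j) x \<bullet> g i x\<bar> \<le> N j" using ifg(2)[of j i] by linarith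
    then show ?thesis unfolding c_def using l[of i] by (simp add: abs_mult)
  qed
  have cjj: "c j j = l j * N j" for j
  proof -
    have "f (k j) x \<bullet> g j x = norm (f (k j) x) powr p / N j powr (p - 1)" for x
    proof (cases "f (k j) x = 0")
      case False
      have "norm (f (k j) x) powr (p - 2) * (f (k j) x \<bullet> f (k j) x) = norm (f (k j) x) powr p"
        using False powr_add[of "norm (f (k j) x)" "p - 2" 2]
            by (simp add: power2_norm_eq_inner[symmetric])
      then show ?thesis by (simp add: g_def)
    qed (simp add: g_def)
    then have "(LINT x|M. f (k j) x \<bullet> g j x) = I j / N j powr (p - 1)" by (simp add: I_def)
    also have "\<dots> = N j" unfolding N(2)[symmetric] using N(1)[of j] by (simp add: powr_diff)
    finally show ?thesis by (simp add: c_def)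
  qed
  define u where "u i x = (sgnseq c i * l i) *\<^sub>R g i x" for i x
  have [measurable]: "u i \<in> borel_measurable M" for i unfolding u_def by measurable
  have nu: "norm (u i x) = l i * norm (g i x)" for i x using l[of i] by (simp add: u_def abs_mult)
  have gle: "norm (g i x) \<le> 1 + norm (g i x) powr q" for i x
    using le_cut_plus_powr[of "norm (g i x)" 1 q] q by simp
  have ig: "integrable M (\<lambda>x. norm (g i x))" "(LINT x|M. norm (g i x)) \<le> measure M (space M) + 1"
      for i
  proof -
    have i1: "integrable M (\<lambda>x. 1 + norm (g i x) powr q)" using gq(1)[of i] by auto
    show *: "integrable M (\<lambda>x. norm (g i x))"
      by (rule Bochner_Integration.integrable_bound[OF i1]) (use gle in \<open>auto intro!: AE_I2
          order_trans[OF _ abs_ge_self]\<close>)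
    have "(LINT x|M. norm (g i x)) \<le> (LINT x|M. 1 + norm (g i x) powr q)"
      by (rule integral_mono[OF * i1]) (rule gle)
    then show "(LINT x|M. norm (g i x)) \<le> measure M (space M) + 1" using gq[of i] by simp
  qed
  have ae_sum: "AE x in M. summable (\<lambda>i. l i * F i x)"
    if F: "\<And>i. integrable M (F i)" "\<And>i x. F i x \<ge> 0" "\<And>i. (LINT x|M. F i x) \<le> C"
        for F :: "nat \<Rightarrow> 'a \<Rightarrow> real" and C
  proof -
    have [measurable]: "F i \<in> borel_measurable M" for i using F(1) by auto
    have l0: "l i \<ge> 0" for i using l[of i] by simp
    have lF: "l i * F i x \<ge> 0" for i x using l0 F(2) by simp
    have C: "C \<ge> 0" using F(3)[of 0] integral_nonneg_AE[of "F 0" M] F(2) by (smt (verit) AE_I2)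
    have "(\<integral>\<^sup>+x. (\<Sum>i. ennreal (l i * F i x)) \<partial>M) = (\<Sum>i. \<integral>\<^sup>+x. ennreal (l i * F i x) \<partial>M)"
      by (rule nn_integral_suminf) auto
    also have "\<dots> = (\<Sum>i. ennreal (l i * (LINT x|M. F i x)))"
      by (intro suminf_cong, subst nn_integral_eq_integral) (use F(1) lF in auto)
    also have "\<dots> \<le> (\<Sum>i. ennreal (l i * C))"
      using F(3) l0 by (intro suminf_le ennreal_leI mult_left_mono) auto
    also have "\<dots> = ennreal (\<Sum>i. l i * C)"
      using l0 C lsum(1) by (intro suminf_ennreal2 summable_mult2) auto
    finally have "(\<integral>\<^sup>+x. (\<Sum>i. ennreal (l i * F i x)) \<partial>M) \<noteq> \<infinity>" by (auto simp: top_unique)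
    then have "AE x in M. (\<Sum>i. ennreal (l i * F i x)) \<noteq> \<infinity>" by (intro nn_integral_PInf_AE) auto
    then show ?thesis
    proof eventually_elim
      case (elim x)
      show ?case by (rule summable_suminf_not_top) (use l[THEN less_imp_le] F(2) elim in auto)
    qed
  qed
  have ae1: "AE x in M. summable (\<lambda>i. l i * norm (g i x))" by (rule ae_sum[OF ig(1) _ ig(2)]) simp
  have ae2: "AE x in M. summable (\<lambda>i. l i * norm (g i x) powr q)"
      by (rule ae_sum[where C=1, OF gq(1)]) (auto simp: gq)
  define h where "h x = (\<Sum>i. u i x)" for x
  have [measurable]: "h \<in> borel_measurable M" unfolding h_def by measurable
  have ih: "integrable M (\<lambda>x. norm (h x) powr q)"
  proof (rule Bochner_Integration.integrable_bound)
    show "integrable M (\<lambda>x. \<Sum>i. l i * norm (g i x) powr q)"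
    proof (rule integrable_suminf)
      show "integrable M (\<lambda>x. l i * norm (g i x) powr q)" for i using gq(1) by simp
      show "AE x in M. summable (\<lambda>i. norm (l i * norm (g i x) powr q))"
        using ae2 l[THEN less_imp_le] by (simp add: abs_mult)
      show "summable (\<lambda>i. LINT x|M. norm (l i * norm (g i x) powr q))"
        using lsum(1) l[THEN less_imp_le] by (simp add: abs_mult gq)
    qed
    show "AE x in M. norm (norm (h x) powr q) \<le> norm (\<Sum>i. l i * norm (g i x) powr q)"
      using ae1 ae2
    proof eventually_elim
      case (elim x)
      have "norm (h x) \<le> (\<Sum>i. norm (u i x))" unfolding h_def
          by (rule summable_norm) (use elim in \<open>simp add: nu\<close>)
      then have "norm (h x) powr q \<le> (\<Sum>i. l i * norm (g i x)) powr q" unfolding nu using q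
          by (intro powr_mono2) auto
      also have "\<dots> \<le> (\<Sum>i. l i * norm (g i x) powr q)"
        using q l[THEN less_imp_le] lsum elim by (intro powr_suminf_le) auto
      finally show ?case by simp
    qed
  qed measurable
  have Th: "(\<lambda>i. sgnseq c i * c j i) sums (LINT x|M. f (k j) x \<bullet> h x)" for j
  proof -
    have i1: "integrable M (\<lambda>x. f (k j) x \<bullet> u i x)" for i unfolding u_def using ifgi[of j i] by simp
    have nb: "\<bar>f (k j) x \<bullet> u i x\<bar> \<le> l i * (norm (f (k j) x) * norm (g i x))" for x i
      using Cauchy_Schwarz_ineq2[of "f (k j) x" "u i x"] by (simp add: nu mult_ac)
    have 1: "AE x in M. summable (\<lambda>i. norm (f (k j) x \<bullet> u i x))"
      using ae1
    proof eventually_elim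
      case (elim x)
      have "summable (\<lambda>i. norm (f (k j) x) * (l i * norm (g i x)))" by (intro summable_mult elim)
      then show ?case by (rule summable_comparison_test'[where N=0]) (use nb[of x] in \<open>auto simp:
          mult_ac\<close>)
    qed
    have 2: "summable (\<lambda>i. LINT x|M. norm (f (k j) x \<bullet> u i x))"
    proof (rule summable_comparison_test')
      show "summable (\<lambda>i. l i * N j)" by (intro summable_mult2 lsum)
      fix i
      have "(LINT x|M. \<bar>f (k j) x \<bullet> u i x\<bar>) \<le> (LINT x|M. l i * (norm (f (k j) x) * norm (g i x)))"
        by (rule integral_mono[OF integrable_abs[OF i1]]) (use ifg(1)[of j i] nb in auto)
      also have "\<dots> \<le> l i * N j" using ifg(2)[of j i] l[of i] by simp
      finally show "norm (LINT x|M. norm (f (k j) x \<bullet> u i x)) \<le> l i * N j" by simp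
    qed
    have "(\<lambda>i. LINT x|M. f (k j) x \<bullet> u i x) sums (LINT x|M. (\<Sum>i. f (k j) x \<bullet> u i x))"
      by (rule sums_integral[OF i1 1 2])
    also have "(LINT x|M. (\<Sum>i. f (k j) x \<bullet> u i x)) = (LINT x|M. f (k j) x \<bullet> h x)"
    proof (rule integral_cong_AE)
      show "AE x in M. (\<Sum>i. f (k j) x \<bullet> u i x) = f (k j) x \<bullet> h x"
        using ae1
      proof eventually_elim
        case (elim x)
        have "summable (\<lambda>i. u i x)" by (rule summable_norm_cancel) (use elim in \<open>simp add: nu\<close>)
        then show ?case unfolding h_def
            by (rule bounded_linear.suminf[OF bounded_linear_inner_right, symmetric])
      qed
    qed measurable
    also have "(\<lambda>i. LINT x|M. f (k j) x \<bullet> u i x) = (\<lambda>i. sgnseq c i * c j i)"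
      by (simp add: u_def c_def mult_ac)
    finally show ?thesis .
  qed
  have low: "\<bar>LINT x|M. f (k j) x \<bullet> h x\<bar> \<ge> (4/3) ^ j / 6" for j
  proof -
    have s: "summable (\<lambda>i. sgnseq c i * c j i)" using Th[of j] by (simp add: sums_iff)
    have lt: "(\<lambda>i. l (i + Suc j) * N j) sums (l j / 2 * N j)"
    proof (rule sums_mult2)
      have "(\<lambda>i. l (i + Suc j)) = (\<lambda>i. l j * l i)" by (auto simp: l_def power_add)
      then show "(\<lambda>i. l (i + Suc j)) sums (l j / 2)"
          using sums_mult[OF summable_sums[OF lsum(1)], of "l j"] lsum(2) by simp
    qed
    have "\<bar>\<Sum>i. sgnseq c (i + Suc j) * c j (i + Suc j)\<bar> \<le> (\<Sum>i. l (i + Suc j) * N j)"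
    proof (rule order_trans[OF summable_rabs suminf_le])
      have le: "\<bar>sgnseq c (i + Suc j) * c j (i + Suc j)\<bar> \<le> l (i + Suc j) * N j" for i
        using cle[of j "i + Suc j"] by (simp add: abs_mult)
      show "\<bar>sgnseq c (i + Suc j) * c j (i + Suc j)\<bar> \<le> l (i + Suc j) * N j" for i by (rule le)
      show "summable (\<lambda>i. \<bar>sgnseq c (i + Suc j) * c j (i + Suc j)\<bar>)"
        by (rule summable_comparison_test'[where N=0, OF sums_summable[OF lt]]) (use le in auto)
      then show "summable (\<lambda>i. \<bar>sgnseq c (i + Suc j) * c j (i + Suc j)\<bar>)" .
      show "summable (\<lambda>i. l (i + Suc j) * N j)" by (rule sums_summable[OF lt])
    qed
    also have "\<dots> = l j / 2 * N j" using lt by (simp add: sums_iff)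
    finally have tail: "\<bar>\<Sum>i. sgnseq c (i + Suc j) * c j (i + Suc j)\<bar> \<le> l j / 2 * N j" .
    have "(LINT x|M. f (k j) x \<bullet> h x)
        = (\<Sum>i. sgnseq c (i + Suc j) * c j (i + Suc j)) + (\<Sum>i<Suc j. sgnseq c i * c j i)"
      using Th[of j] suminf_split_initial_segment[OF s, of "Suc j"] by (simp add: sums_iff)
    then have "\<bar>LINT x|M. f (k j) x \<bullet> h x\<bar> \<ge> l j * N j / 2"
      using tail sgnseq_gain[of c j] unfolding cjj by linarith
    moreover have "l j * N j \<ge> l j * 4 ^ j" using N4[of j] l[of j] by simp
    moreover have "l j * 4 ^ j / 2 = (4/3) ^ j / 6" by (simp add: l_def power_divide)
    ultimately show ?thesis by linarith
  qed
  have "Bseq (\<lambda>k. LINT x|M. f k x \<bullet> h x)" using ih by (intro bounded) (auto simp: q_def)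
  then obtain B where B: "\<And>n. \<bar>LINT x|M. f n x \<bullet> h x\<bar> \<le> B" unfolding Bseq_def by auto
  obtain j where "(4/3::real) ^ j > 6 * B" using real_arch_pow[of "4/3" "6 * B"] by auto
  then show False using low[of j] B[of "k j"] by linarith
qed

section \<open>Fields on the ball and their Borel extensions by zero\<close>

lemma B3_sets [measurable]: "B3 \<in> sets borel" by (simp add: B3_def)

lemma finite_measure_B3: "finite_measure (lebesgue_on B3)"
  unfolding B3_def by (intro finite_measure_lebesgue_on lmeasurable_ball)

lemma
  fixes h h' :: "real^3 \<Rightarrow> 'b::euclidean_space"
  assumes [measurable]: "h' \<in> borel_measurable borel" and ae: "AE y in lborel. y \<in> B3 \<longrightarrow> h y = h' y"
    and z: "\<And>y. y \<notin> B3 \<Longrightarrow> h' y = 0"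
  shows integrable_B3_iff: "integrable (lebesgue_on B3) h \<longleftrightarrow> integrable lborel h'"
    and integral_B3_eq: "integral\<^sup>L (lebesgue_on B3) h = integral\<^sup>L lborel h'"
    and measurable_B3: "h \<in> borel_measurable (lebesgue_on B3)"
proof -
  have "AE y in lborel. h' y = indicator B3 y *\<^sub>R h y"
    using ae by eventually_elim (auto simp: indicator_def z)
  then have ae': "AE y in lebesgue. h' y = indicator B3 y *\<^sub>R h y" by (rule AE_completion)
  have B: "B3 \<inter> space lebesgue \<in> sets lebesgue" by simp
  have m: "h' \<in> borel_measurable lebesgue" by (rule measurable_completion) simp
  have m': "(\<lambda>y. indicator B3 y *\<^sub>R h y) \<in> borel_measurable lebesgue"
    by (rule borel_measurable_AE[OF m ae'])
  show "integrable (lebesgue_on B3) h \<longleftrightarrow> integrable lborel h'"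
    unfolding integrable_restrict_space[OF B] integrable_cong_AE[OF m m' ae', symmetric]
    by (rule integrable_completion) simp
  show "integral\<^sup>L (lebesgue_on B3) h = integral\<^sup>L lborel h'"
    unfolding integral_restrict_space[OF B] integral_cong_AE[OF m m' ae', symmetric]
    by (rule integral_completion) simp
  show "h \<in> borel_measurable (lebesgue_on B3)"
    unfolding borel_measurable_restrict_space_iff[OF B] by (rule m')
qed

text \<open>The ball is bounded and \<open>norm (Y y) \<le> 1 + norm (Y y) powr p\<close>, so the
  extension is integrable on the whole space, which is what the flux lemmas assume.\<close>

lemma Lp_borel_version:
  assumes X: "X \<in> Lp p" and p: "p \<ge> 1"
  shows "\<exists>Y. Y \<in> borel_measurable borel \<and> (AE y in lborel. y \<in> B3 \<longrightarrow> X y = Y y) \<and> (\<forall>y. y \<notin> B3 \<longrightarrow> Y y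
      = 0) \<and>
    integrable lborel Y \<and> integrable lborel (\<lambda>y. norm (Y y) powr p) \<and>
    (LINT y|lborel. norm (Y y) powr p) = (LINT y|lebesgue_on B3. norm (X y) powr p)"
proof -
  have X': "X \<in> borel_measurable (lebesgue_on B3)"
      "integrable (lebesgue_on B3) (\<lambda>x. norm (X x) powr p)" using X by (auto simp: Lp_def)
  obtain Y where Y [measurable]: "Y \<in> borel_measurable borel" and ae: "AE y in lborel. y \<in> B3 \<longrightarrow> X y
      = Y y" and Y0: "\<And>y. y \<notin> B3 \<Longrightarrow> Y y = 0"
    by (rule ex_borel_version[OF X'(1) B3_sets]) blast
  have ae': "AE y in lborel. y \<in> B3 \<longrightarrow> norm (X y) powr p = norm (Y y) powr p" using ae
      by eventually_elim auto
  have Yp: "integrable lborel (\<lambda>y. norm (Y y) powr p)" "(LINT y|lborel. norm (Y y) powr p)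
      = (LINT y|lebesgue_on B3. norm (X y) powr p)"
    using integrable_B3_iff[OF _ ae'] integral_B3_eq[OF _ ae'] X' Y0 by auto
  have "integrable lborel (\<lambda>y. indicator (cball (0::real^3) 1) y * 1 + norm (Y y) powr p)"
    using Yp integrable_cball_const[of 0 1 1] by auto
  then have "integrable lborel Y"
  proof (rule Bochner_Integration.integrable_bound)
    show "AE y in lborel. norm (Y y)
        \<le> norm (indicator (cball (0::real^3) 1) y * 1 + norm (Y y) powr p)"
    proof (rule AE_I2)
      fix y
      have "norm (Y y) \<le> 1 + norm (Y y) powr p"
      proof (cases "p = 1")
        case False then show ?thesis using le_cut_plus_powr[of "norm (Y y)" 1 p] p by simp
      qed simp
      then show "norm (Y y) \<le> norm (indicator (cball (0::real^3) 1) y * 1 + norm (Y y) powr p)"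
        using Y0[of y] by (cases "y \<in> B3") (auto simp: B3_def indicator_def intro: order_trans[OF _
            abs_ge_self])
    qed
  qed simp
  with Y ae Y0 Yp show ?thesis by blast
qed

lemma LpZ_iff:
  assumes Y: "integrable lborel Y" and ae: "AE y in lborel. y \<in> B3 \<longrightarrow> X y = Y y"
  shows "X \<in> LpZ p \<longleftrightarrow> X \<in> Lp p \<and> Zflux Y"
proof -
  have "(AE r in lborel. 0 < r \<and> r < 1 - norm a \<longrightarrow> flux_defined X a r \<and> flux X a r \<in> \<int>) \<longleftrightarrow>
    (AE r in lborel. 0 < r \<and> r < 1 - norm a \<longrightarrow> sflux Y a r \<in> \<int>)" for a
    by (rule AE_cong_simp[of lborel, OF refl, THEN trans, rotated])
       (use flux_AE_sflux[OF Y ae, of a] in \<open>auto elim: eventually_elim2\<close>)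
  then show ?thesis by (simp add: LpZ_def Zflux_def)
qed

text \<open>Weak convergence enters twice: convergent pairings are bounded, which yields the common
  bound in \<open>L\<^sup>p\<close>, and the bounded test fields \<open>rad d (2 * d)\<close>,
  shifted to \<open>b\<close>, yield pointwise convergence of \<open>Phi\<close>.\<close>

theorem LpZ_weakly_closed:
  assumes p: "p > 1" and Xs: "\<And>k. Xs k \<in> LpZ p" and w: "weak_Lp_conv p Xs X"
  shows "X \<in> LpZ p"
proof -
  have XLp: "X \<in> Lp p" and XsLp: "\<And>k. Xs k \<in> Lp p"
    and conv: "\<And>g. g \<in> Lp (p / (p - 1)) \<Longrightarrow> (\<lambda>k. LINT x|lebesgue_on B3. Xs k x \<bullet> g x)
        \<longlonglongrightarrow> (LINT x|lebesgue_on B3. X x \<bullet> g x)"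
    using w by (auto simp: weak_Lp_conv_def)
  have "\<exists>E. \<forall>k. (LINT x|lebesgue_on B3. norm (Xs k x) powr p) \<le> E"
  proof (rule Lp_weak_bounded[OF finite_measure_B3 p])
    show "Bseq (\<lambda>k. LINT x|lebesgue_on B3. Xs k x \<bullet> g x)"
      if "g \<in> borel_measurable (lebesgue_on B3)" "integrable (lebesgue_on B3) (\<lambda>x. norm (g x) powr (p
          / (p - 1)))" for g
      using conv[of g] that by (auto simp: Lp_def intro!: convergent_imp_Bseq convergentI)
  qed (use XsLp in \<open>auto simp: Lp_def\<close>)
  then obtain E where E: "\<And>k. (LINT x|lebesgue_on B3. norm (Xs k x) powr p) \<le> E" by blast
  have E0: "E \<ge> 0" using E[of 0] by (rule order_trans[rotated]) simp
  obtain Y where Y: "Y \<in> borel_measurable borel" "AE y in lborel. y \<in> B3 \<longrightarrow> X y = Y y" "\<And>y. y \<notin> B3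
      \<Longrightarrow> Y y = 0" "integrable lborel Y"
    using Lp_borel_version[OF XLp] p by auto
  define Q where "Q k Y \<longleftrightarrow> Y \<in> borel_measurable borel \<and> (AE y in lborel. y \<in> B3 \<longrightarrow> Xs k y
      = Y y) \<and> (\<forall>y. y \<notin> B3 \<longrightarrow> Y y = 0) \<and>
    integrable lborel Y \<and> integrable lborel (\<lambda>y. norm (Y y) powr p) \<and>
    (LINT y|lborel. norm (Y y) powr p) = (LINT y|lebesgue_on B3. norm (Xs k y) powr p)" for k Y
  have "\<exists>Y. Q k Y" for k
    unfolding Q_def using Lp_borel_version[OF XsLp[of k]] p by simp
  then obtain Ys where "\<And>k. Q k (Ys k)" by metis
  then have Ys: "\<And>k. Ys k \<in> borel_measurable borel" "\<And>k. AE y in lborel. y \<in> B3 \<longrightarrow> Xs k y = Ys k y"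
    "\<And>k y. y \<notin> B3 \<Longrightarrow> Ys k y = 0" "\<And>k. integrable lborel (Ys k)"
        "\<And>k. integrable lborel (\<lambda>y. norm (Ys k y) powr p)"
    "\<And>k. (LINT y|lborel. norm (Ys k y) powr p) = (LINT y|lebesgue_on B3. norm (Xs k y) powr p)"
    unfolding Q_def by blast+
  have "Zflux Y"
  proof (rule weak_limit_Zflux[OF Ys(4) Y(4) _ p _ E0])
    show "Zflux (Ys k)" for k using LpZ_iff[OF Ys(4) Ys(2), of k p] Xs by simp
    show "(\<integral>\<^sup>+y. ennreal (norm (Ys k y) powr p) \<partial>lborel) \<le> ennreal E" for k
      using E[of k] by (subst nn_integral_eq_integral) (auto simp: Ys intro!: ennreal_leI)
    show "(LINT y|lborel. norm (Ys k y)) \<le> (LINT y|lborel. indicator (cball (0::real^3) 1) y * 1) + E"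
        for k
    proof -
      have "(LINT y|lborel. norm (Ys k y))
          \<le> (LINT y|lborel. indicator (cball (0::real^3) 1) y * 1 + norm (Ys k y) powr p)"
      proof (rule integral_mono)
        show "integrable lborel (\<lambda>y. indicator (cball (0::real^3) 1) y * 1 + norm (Ys k y) powr p)"
          using Ys(5)[of k] integrable_cball_const[of "0::real^3" 1 1] by auto
        show "norm (Ys k y) \<le> indicator (cball (0::real^3) 1) y * 1 + norm (Ys k y) powr p" for y
          using le_cut_plus_powr[of "norm (Ys k y)" 1 p] p Ys(3)[of y k]
              by (cases "y \<in> B3") (auto simp: B3_def indicator_def)
      qed (use Ys in auto)
      also have "\<dots> = (LINT y|lborel. indicator (cball (0::real^3) 1) y * 1)
          + (LINT y|lborel. norm (Ys k y) powr p)"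
        using Ys(5)[of k] integrable_cball_const[of "0::real^3" 1 1]
            by (intro Bochner_Integration.integral_add) auto
      finally show ?thesis using E[of k] Ys(6)[of k] by simp
    qed
    fix d :: real and b :: "real^3" assume d: "d > 0"
    have g: "(\<lambda>y. rad d (2 * d) (y - b)) \<in> Lp (p / (p - 1))"
    proof -
      interpret finite_measure "lebesgue_on B3" by (rule finite_measure_B3)
      have m: "(\<lambda>y. rad d (2 * d) (y - b)) \<in> borel_measurable (lebesgue_on B3)"
        by (intro measurable_restrict_space1 measurable_completion) simp
      have "norm (norm (rad d (2 * d) (y - b)) powr (p / (p - 1))) \<le> 1" for y
        using powr_mono2[of "p / (p - 1)" "norm (rad d (2 * d) (y - b))" 1] norm_rad_le[of d "2*d" "y
            - b"] p by simp
      then have "integrable (lebesgue_on B3) (\<lambda>y. norm (rad d (2 * d) (y - b)) powr (p / (p - 1)))"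
        using m by (intro integrable_const_bound[of _ 1]) auto
      with m show ?thesis by (simp add: Lp_def)
    qed
    have T: "(LINT x|lebesgue_on B3. Z x \<bullet> rad d (2 * d) (x - b)) = Phi d (2 * d) W b"
      if [measurable]: "W \<in> borel_measurable borel" and ae: "AE y in lborel. y \<in> B3 \<longrightarrow> Z y
          = W y" and W0: "\<And>y. y \<notin> B3 \<Longrightarrow> W y = 0" for Z W
      unfolding Phi_def
    proof (rule integral_B3_eq)
      show "AE y in lborel. y \<in> B3 \<longrightarrow> Z y \<bullet> rad d (2 * d) (y - b) = W y \<bullet> rad d (2 * d) (y - b)"
        using ae by eventually_elim auto
    qed (auto simp: W0)
    show "(\<lambda>k. Phi d (2 * d) (Ys k) b) \<longlonglongrightarrow> Phi d (2 * d) Y b"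
    proof -
      have "(LINT x|lebesgue_on B3. Xs k x \<bullet> rad d (2 * d) (x - b)) = Phi d (2 * d) (Ys k) b" for k
        by (rule T[OF Ys(1,2)]) (rule Ys(3))
      moreover have "(LINT x|lebesgue_on B3. X x \<bullet> rad d (2 * d) (x - b)) = Phi d (2 * d) Y b"
        by (rule T[OF Y(1,2)]) (rule Y(3))
      ultimately show ?thesis using conv[OF g] by simp
    qed
  qed
  then show ?thesis using LpZ_iff[OF Y(4) Y(2)] XLp by simp
qed

section \<open>Dipoles\<close>

text \<open>The squared norm along a line is a quadratic polynomial with leading coefficient
  \<open>v \<bullet> v\<close>. Hence a segment meets the kinks of a tent only finitely
  often.\<close>

lemma finite_norm_line:
  fixes w v :: "'a::real_inner"
  assumes v: "v \<noteq> 0"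
  shows "finite {t. norm (w + t *\<^sub>R v) = c}"
proof -
  let ?P = "[:w \<bullet> w - c\<^sup>2, 2 * (w \<bullet> v), v \<bullet> v:]"
  have "?P \<noteq> 0" using v by simp
  then have "finite {t. poly ?P t = 0}" by (rule poly_roots_finite)
  moreover have "{t. norm (w + t *\<^sub>R v) = c} \<subseteq> {t. poly ?P t = 0}"
  proof
    fix t assume "t \<in> {t. norm (w + t *\<^sub>R v) = c}"
    then have "(w + t *\<^sub>R v) \<bullet> (w + t *\<^sub>R v) = c\<^sup>2" by (simp flip: power2_norm_eq_inner)
    then show "t \<in> {t. poly ?P t = 0}"
      by (simp add: inner_add_left inner_add_right inner_commute[of v w] algebra_simps)
  qed
  ultimately show ?thesis by (rule finite_subset[rotated])
qed

text \<open>The fundamental theorem of calculus for the tent along the segment from \<open>x\<close>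
  to \<open>s\<close>, with the finitely many kinks as exceptional points.\<close>

lemma integral_rad_segment:
  fixes x s a :: "'a::euclidean_space"
  assumes st: "s1 \<le> s2"
  shows "(LINT t|lborel. indicator {0<..<1} t * (rad s1 s2 (x + t *\<^sub>R (s - x) - a) \<bullet> (s - x)))
      = tent s1 s2 (x - a) - tent s1 s2 (s - a)"
proof (cases "s = x")
  case False
  define v where "v = s - x"
  define w where "w = x - a"
  have v: "v \<noteq> 0" using False by (simp add: v_def)
  define F where "F = {t. norm (w + t *\<^sub>R v) = 0} \<union> {t. norm (w + t *\<^sub>R v)
      = s1} \<union> {t. norm (w + t *\<^sub>R v) = s2}"
  have "finite F" unfolding F_def by (intro finite_UnI finite_norm_line v)
  have "((\<lambda>t. - (rad s1 s2 (w + t *\<^sub>R v) \<bullet> v)) has_integral tent s1 s2 (w + 1 *\<^sub>R v) - tent s1 s2 (w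
      + 0 *\<^sub>R v)) {0..1}"
  proof (rule fundamental_theorem_of_calculus_interior_strong[OF \<open>finite F\<close>])
    fix t assume t: "t \<in> {0<..<1} - F"
    have "((\<lambda>t. w + t *\<^sub>R v) has_derivative (\<lambda>h. h *\<^sub>R v)) (at t)"
      by (auto intro!: derivative_eq_intros)
    then have "((\<lambda>t. tent s1 s2 (w + t *\<^sub>R v)) has_derivative (\<lambda>h. - (rad s1 s2 (w + t *\<^sub>R v)
        \<bullet> (h *\<^sub>R v)))) (at t)"
      by (rule has_derivative_compose) (use t st in \<open>auto simp: F_def intro!: has_derivative_tent\<close>)
    then show "((\<lambda>t. tent s1 s2 (w + t *\<^sub>R v)) has_vector_derivative - (rad s1 s2 (w + t *\<^sub>R v)
        \<bullet> v)) (at t)"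
      by (simp add: has_vector_derivative_def)
  next
    show "continuous_on {0..1} (\<lambda>t. tent s1 s2 (w + t *\<^sub>R v))"
      unfolding tent_def by (intro continuous_intros)
  qed simp
  from has_integral_neg[OF this]
  have "((\<lambda>t. rad s1 s2 (w + t *\<^sub>R v) \<bullet> v) has_integral tent s1 s2 w - tent s1 s2 (w + v)) {0..1}"
    by simp
  then have "integral {0..1} (\<lambda>t. rad s1 s2 (w + t *\<^sub>R v) \<bullet> v) = tent s1 s2 w - tent s1 s2 (w + v)"
    by (rule integral_unique)
  moreover have "(LINT t:{0..1}|lborel. rad s1 s2 (w + t *\<^sub>R v) \<bullet> v)
      = integral {0..1} (\<lambda>t. rad s1 s2 (w + t *\<^sub>R v) \<bullet> v)"
  proof (rule set_borel_integral_eq_integral)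
    show "set_integrable lborel {0..1} (\<lambda>t. rad s1 s2 (w + t *\<^sub>R v) \<bullet> v)"
      unfolding set_integrable_def
    proof (rule integrable_bounded_support[of _ "norm v" 0 1])
      show "norm (indicat_real {0..1} t *\<^sub>R (rad s1 s2 (w + t *\<^sub>R v) \<bullet> v)) \<le> norm v" for t
        using order_trans[OF Cauchy_Schwarz_ineq2[of "rad s1 s2 (w
            + t *\<^sub>R v)" v] mult_right_mono[OF norm_rad_le, of "norm v"]]
        by (auto simp: indicator_def)
    qed (auto simp: indicator_def)
  qed
  moreover have "(LINT t|lborel. indicator {0<..<1} t * (rad s1 s2 (w + t *\<^sub>R v) \<bullet> v))
      = (LINT t:{0..1}|lborel. rad s1 s2 (w + t *\<^sub>R v) \<bullet> v)"
    unfolding set_lebesgue_integral_def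
  proof (rule integral_cong_AE)
    show "AE t in lborel. indicator {0<..<1} t * (rad s1 s2 (w + t *\<^sub>R v) \<bullet> v)
        = indicat_real {0..1} t *\<^sub>R (rad s1 s2 (w + t *\<^sub>R v) \<bullet> v)"
      using AE_lborel_singleton[of 0] AE_lborel_singleton[of 1]
          by eventually_elim (auto simp: indicator_def)
  qed measurable
  ultimately show ?thesis by (simp add: v_def w_def algebra_simps)
qed simp

section \<open>Fields along straight segments into a ball\<close>

lemma lborel_scale:
  fixes x :: "'a::euclidean_space"
  assumes t: "t > 0"
  shows "lborel = density (distr lborel borel (\<lambda>s. x + t *\<^sub>R (s - x))) (\<lambda>_. ennreal (t ^ DIM('a)))"
  using lborel_affine[of t "x - t *\<^sub>R x"] t by (simp add: algebra_simps)

lemma nn_integral_lborel_scale: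
  fixes x :: "'a::euclidean_space"
  assumes t: "t > 0" and [measurable]: "f \<in> borel_measurable borel"
  shows "(\<integral>\<^sup>+y. f y \<partial>lborel) = ennreal (t ^ DIM('a)) * (\<integral>\<^sup>+s. f (x + t *\<^sub>R (s - x)) \<partial>lborel)"
  by (subst lborel_scale[OF t, of x]) (simp add: nn_integral_density nn_integral_distr
      nn_integral_cmult)

lemma integral_lborel_scale:
  fixes x :: "'a::euclidean_space" and f :: "'a \<Rightarrow> real"
  assumes t: "t > 0" and [measurable]: "f \<in> borel_measurable borel"
  shows "(LINT y|lborel. f y) = t ^ DIM('a) * (LINT s|lborel. f (x + t *\<^sub>R (s - x)))"
  by (subst lborel_scale[OF t, of x]) (use t in \<open>simp add: integral_density integral_distr\<close>)

text \<open>The vector field carried by the straight flow lines from \<open>x\<close> to the points of a ball, each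
  point of the ball receiving the same amount of flow.\<close>
definition cone_ker :: "real^3 \<Rightarrow> real \<Rightarrow> real^3 \<Rightarrow> real^3 \<Rightarrow> real \<Rightarrow> real" where
  "cone_ker c e x y t = indicator {0<..<1} t * inverse (t ^ 4) * indicator (ball c e) (x
      + inverse t *\<^sub>R (y - x))"

text \<open>The weight \<open>inverse (t ^ 4)\<close> comes from substituting
  \<open>y = x + t *\<^sub>R (s - x)\<close> in the mean over \<open>s\<close> of line integrals:
  \<open>t ^ 3\<close> from the volume and one more \<open>t\<close> from
  \<open>s - x = (y - x) / t\<close>. Averaging over the ball turns measures on segments into an
  integrable field.\<close>

definition cone_field :: "real^3 \<Rightarrow> real \<Rightarrow> real^3 \<Rightarrow> real^3 \<Rightarrow> real^3" where
  "cone_field c e x y = ((LINT t|lborel. cone_ker c e x y t) / measure lborel (ball c e)) *\<^sub>R (y - x)"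

lemma cone_ker_nonneg: "cone_ker c e x y t \<ge> 0"
  by (simp add: cone_ker_def)

lemma borel_measurable_cone_ker [measurable]:
  assumes [measurable]: "f \<in> borel_measurable M" "g \<in> borel_measurable M"
  shows "(\<lambda>z. cone_ker c e x (f z) (g z)) \<in> borel_measurable M"
  unfolding cone_ker_def indicator_def mem_ball greaterThanLessThan_iff by measurable

lemma borel_measurable_cone_field [measurable]: "cone_field c e x \<in> borel_measurable borel"
  unfolding cone_field_def by measurable

lemma cone_scale_cancel: "t > 0 \<Longrightarrow> t ^ 3 * (inverse (t ^ 4) * t) = (1::real)"
  by (simp add: field_simps power3_eq_cube power4_eq_xxxx)

lemma cone_ker_scale: "t > 0 \<Longrightarrow> cone_ker c e x (x + t *\<^sub>R (s - x)) t
    = indicator {0<..<1} t * inverse (t ^ 4) * indicator (ball c e) s"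
  by (simp add: cone_ker_def)

context
  fixes c x :: "real^3" and e :: real
  assumes e: "e > 0"
begin

text \<open>After the substitution the powers of \<open>t\<close> cancel, and every slice has mass
  at most \<open>B\<close> times the volume of the ball, uniformly in \<open>t\<close>; a
  singularity at \<open>x\<close> does no harm.\<close>

lemma integrable_cone_pair: "integrable (lborel \<Otimes>\<^sub>M lborel) (\<lambda>(t, y). cone_ker c e x y t *\<^sub>R (y - x))"
proof (rule integrableI_bounded)
  show "(\<lambda>(t, y). cone_ker c e x y t *\<^sub>R (y - x)) \<in> borel_measurable (lborel \<Otimes>\<^sub>M lborel)"
    unfolding case_prod_unfold by measurable
  let ?N = "\<lambda>s t. cone_ker c e x (x + t *\<^sub>R (s - x)) t * norm (x + t *\<^sub>R (s - x) - x)"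
  define B where "B = norm (c - x) + e"
  have "(\<integral>\<^sup>+z. ennreal (norm (case z of (t, y) \<Rightarrow> cone_ker c e x y t *\<^sub>R (y
      - x))) \<partial>(lborel \<Otimes>\<^sub>M lborel))
      = (\<integral>\<^sup>+t. \<integral>\<^sup>+y. ennreal (cone_ker c e x y t * norm (y - x)) \<partial>lborel \<partial>lborel)"
    by (subst lborel.nn_integral_fst[symmetric]) (auto simp: case_prod_unfold cone_ker_nonneg)
  also have "\<dots> \<le> (\<integral>\<^sup>+t. indicator {0<..<1} (t::real) * (ennreal B
      * emeasure lborel (ball c e)) \<partial>lborel)"
  proof (rule nn_integral_mono)
    fix t :: real
    show "(\<integral>\<^sup>+y. ennreal (cone_ker c e x y t * norm (y - x)) \<partial>lborel)
        \<le> indicator {0<..<1} t * (ennreal B * emeasure lborel (ball c e))"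
    proof (cases "t \<in> {0<..<1}")
      case True
      then have t: "t > 0" by simp
      have "(\<integral>\<^sup>+y. ennreal (cone_ker c e x y t * norm (y - x)) \<partial>lborel)
         = ennreal (t ^ 3) * (\<integral>\<^sup>+s. ennreal (?N s t) \<partial>lborel)"
        using nn_integral_lborel_scale[OF t, of "\<lambda>y. ennreal (cone_ker c e x y t * norm (y - x))" x]
            by simp
      also have "\<dots> = (\<integral>\<^sup>+s. ennreal (t ^ 3) * ennreal (?N s t) \<partial>lborel)"
        by (rule nn_integral_cmult[symmetric]) measurable
      also have "\<dots> \<le> (\<integral>\<^sup>+s. ennreal B * indicator (ball c e) s \<partial>lborel)"
      proof (rule nn_integral_mono)
        fix s
        have "t ^ 3 * (?N s t) = indicator (ball c e) s * norm (s - x)"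
        proof -
          have "t ^ 3 * (?N s t)
              = (t ^ 3 * (inverse (t ^ 4) * t)) * (indicator (ball c e) s * norm (s - x))"
            unfolding cone_ker_scale[OF t] add_diff_cancel_left' norm_scaleR using True by simp
          then show ?thesis unfolding cone_scale_cancel[OF t] by simp
        qed
        also have "\<dots> \<le> B * indicator (ball c e) s"
          using norm_triangle_ineq[of "s - c" "c - x"]
              by (auto simp: B_def indicator_def dist_norm norm_minus_commute)
        finally have that: "ennreal (t ^ 3 * (?N s t)) \<le> ennreal (B * indicator (ball c e) s)"
          by (rule ennreal_leI)
        then show "ennreal (t ^ 3) * ennreal (?N s t) \<le> ennreal B * indicator (ball c e) s"
        proof -
          have "ennreal (t ^ 3) * ennreal (?N s t)
            = ennreal (t ^ 3 * (?N s t))"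
            by (rule ennreal_mult[symmetric]) (use t cone_ker_nonneg in auto)
          moreover have "ennreal (B * indicator (ball c e) s) = ennreal B * indicator (ball c e) s"
            by (cases "s \<in> ball c e") auto
          ultimately show ?thesis using that by simp
        qed
      qed
      also have "\<dots> = ennreal B * emeasure lborel (ball c e)"
          by (rule nn_integral_cmult_indicator) simp
      finally show ?thesis using True by simp
    next
      case False
      then show ?thesis by (simp add: cone_ker_def)
    qed
  qed
  also have "\<dots> = ennreal B * emeasure lborel (ball c e)"
    by (simp add: nn_integral_multc)
  also have "\<dots> < \<infinity>" by (simp add: ennreal_mult_less_top emeasure_lborel_ball_finite[unfolded
      infinity_ennreal_def])
  finally show "(\<integral>\<^sup>+z. ennreal (norm (case z of (t, y) \<Rightarrow> cone_ker c e x y t *\<^sub>R (y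
      - x))) \<partial>(lborel \<Otimes>\<^sub>M lborel)) < \<infinity>" .
qed

text \<open>Where the kernel is not integrable in \<open>t\<close>, and \<open>y\<close> differs
  from \<open>x\<close>, both sides are 0 by the convention for the Bochner integral.\<close>

lemma cone_field_eq: "cone_field c e x y
    = (LINT t|lborel. cone_ker c e x y t *\<^sub>R (y - x)) /\<^sub>R measure lborel (ball c e)"
proof (cases "y = x \<or> integrable lborel (cone_ker c e x y)")
  case True
  then show ?thesis by (auto simp: cone_field_def divide_inverse mult.commute)
next
  case False
  have "\<not> integrable lborel (\<lambda>t. cone_ker c e x y t *\<^sub>R (y - x))"
  proof
    assume "integrable lborel (\<lambda>t. cone_ker c e x y t *\<^sub>R (y - x))"
    then have "integrable lborel (\<lambda>t. (cone_ker c e x y t *\<^sub>R (y - x)) \<bullet> (y - x))"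
        by (rule integrable_inner_left)
    then show False using False by simp
  qed
  with False show ?thesis by (simp add: cone_field_def not_integrable_integral_eq)
qed

lemma integrable_cone_field: "integrable lborel (cone_field c e x)"
  unfolding cone_field_eq[abs_def] using lborel_pair.integrable_snd[OF integrable_cone_pair] by simp

text \<open>Fubini and, in each slice \<open>t\<close>, the substitution undo the kernel; what
  remains are line integrals along the segments from \<open>x\<close>, averaged over the
  ball.\<close>

lemma integral_cone_field:
  fixes \<Phi> :: "real^3 \<Rightarrow> real^3"
  assumes [measurable]: "\<Phi> \<in> borel_measurable borel" and B: "\<And>y. norm (\<Phi> y) \<le> B"
  shows "(LINT y|lborel. \<Phi> y \<bullet> cone_field c e x y) =
     (LINT s|lborel. indicator (ball c e) s * (LINT t|lborel. indicator {0<..<1} t * (\<Phi> (x + t *\<^sub>R (s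
         - x)) \<bullet> (s - x)))) / measure lborel (ball c e)"
proof -
  let ?F = "\<lambda>s t. indicator {0<..<1} t * (\<Phi> (x + t *\<^sub>R (s - x)) \<bullet> (s - x))"
  let ?G = "\<lambda>t y. \<Phi> y \<bullet> (cone_ker c e x y t *\<^sub>R (y - x))"
  let ?H = "\<lambda>s t. \<Phi> (x + t *\<^sub>R (s - x)) \<bullet> (cone_ker c e x (x + t *\<^sub>R (s - x)) t *\<^sub>R (x + t *\<^sub>R (s - x)
      - x))"
  define v where "v = measure lborel (ball c e)"
  let ?f = "\<lambda>(t, y). ?G t y"
  have if1: "integrable (lborel \<Otimes>\<^sub>M lborel) ?f"
  proof -
    have "(\<lambda>z. \<Phi> (snd z)) \<in> borel_measurable (lborel \<Otimes>\<^sub>M lborel)" by measurable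
    from integrable_inner_bounded[OF integrable_cone_pair this, of B] B show ?thesis
      by (simp add: case_prod_unfold inner_commute)
  qed
  have B0: "B \<ge> 0" using order_trans[OF norm_ge_zero B] .
  have "(LINT y|lborel. \<Phi> y \<bullet> cone_field c e x y) = (LINT y|lborel. (LINT t|lborel. ?G t y) / v)"
  proof (rule integral_cong_AE)
    show "AE y in lborel. \<Phi> y \<bullet> cone_field c e x y = (LINT t|lborel. ?G t y) / v"
      using lborel_pair.AE_integrable_snd[OF integrable_cone_pair]
    proof eventually_elim
      case (elim y)
      then have "(LINT t|lborel. ?G t y) = \<Phi> y \<bullet> (LINT t|lborel. cone_ker c e x y t *\<^sub>R (y - x))"
        by (intro integral_inner_right) auto
      then show ?case by (simp add: cone_field_eq v_def divide_inverse)
    qed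
  qed measurable
  also have "\<dots> = (LINT y|lborel. LINT t|lborel. ?G t y) / v" by simp
  also have "(LINT y|lborel. LINT t|lborel. ?G t y) = (LINT t|lborel. LINT y|lborel. ?G t y)"
    using lborel_pair.Fubini_integral[OF if1] by simp
  also have "\<dots> = (LINT t|lborel. LINT s|lborel. indicator (ball c e) s * (?F s t))"
  proof (rule Bochner_Integration.integral_cong[OF refl])
    fix t :: real
    show "(LINT y|lborel. ?G t y) = (LINT s|lborel. indicator (ball c e) s * (?F s t))"
    proof (cases "t \<in> {0<..<1}")
      case True
      then have t: "t > 0" by simp
      have "(LINT y|lborel. ?G t y)
        = t ^ 3 * (LINT s|lborel. ?H s t)"
        using integral_lborel_scale[OF t, of "\<lambda>y. ?G t y" x] by simp
      also have "\<dots> = (LINT s|lborel. t ^ 3 * (?H s t))"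
        by simp
      also have "\<dots> = (LINT s|lborel. indicator (ball c e) s * (?F s t))"
      proof (rule Bochner_Integration.integral_cong[OF refl])
        fix s
        have "t ^ 3 * (?H s t)
          = (t ^ 3 * (inverse (t ^ 4) * t)) * (indicator (ball c e) s * (\<Phi> (x + t *\<^sub>R (s - x)) \<bullet> (s
              - x)))"
          unfolding cone_ker_scale[OF t] add_diff_cancel_left' inner_scaleR_right using True by simp
        then show "t ^ 3 * (?H s t)
          = indicator (ball c e) s * (?F s t)"
          unfolding cone_scale_cancel[OF t] using True by simp
      qed
      finally show ?thesis .
    next
      case False then show ?thesis by (simp add: cone_ker_def)
    qed
  qed
  also have "\<dots> = (LINT s|lborel. LINT t|lborel. indicator (ball c e) s * (?F s t))"
  proof (rule lborel_pair.Fubini_integral[symmetric], unfold lborel_prod)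
    show "integrable lborel (\<lambda>(t, s). indicator (ball c e) s * (?F s t))"
    proof (rule integrable_bounded_support[of _ "B * (norm (c - x) + e)" "(0, c)" "1 + e"])
      show "(\<lambda>(t, s). indicator (ball c e) s * (?F s t)) \<in> borel_measurable borel"
        unfolding case_prod_unfold indicator_def mem_ball greaterThanLessThan_iff by measurable
      fix z :: "real \<times> (real^3)"
      obtain t s where z: "z = (t, s)" by force
      show "norm (case z of (t, s) \<Rightarrow> indicator (ball c e) s * (?F s t)) \<le> B * (norm (c - x) + e)"
      proof (cases "s \<in> ball c e")
        case True
        have "\<bar>\<Phi> (x + t *\<^sub>R (s - x)) \<bullet> (s - x)\<bar> \<le> norm (\<Phi> (x + t *\<^sub>R (s - x))) * norm (s - x)"
            by (rule Cauchy_Schwarz_ineq2)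
        also have "\<dots> \<le> B * (norm (c - x) + e)"
          using B B0 True norm_triangle_ineq[of "s - c" "c - x"]
              by (intro mult_mono) (auto simp: dist_norm norm_minus_commute)
        finally show ?thesis using B0 e by (auto simp: z indicator_def)
      qed (use B0 e in \<open>simp add: z\<close>)
      show "(case z of (t, s) \<Rightarrow> indicator (ball c e) s * (?F s t)) = 0"
        if out: "z \<notin> cball (0, c) (1 + e)"
      proof (rule ccontr)
        assume "\<not> ?thesis"
        then have "\<bar>t\<bar> < 1" "norm (c - s) < e"
            by (auto simp: z indicator_def dist_norm split: if_splits)
        then have "dist (0, c) (t, s) \<le> 1 + e" using norm_Pair_le[of "- t" "c - s"]
            by (auto simp: dist_norm)
        with out show False by (simp add: z)
      qed
    qed
  qed
  finally show ?thesis by (simp add: v_def)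
qed

end

text \<open>By \<open>integral_rad_segment\<close> the divergence is a unit charge at
  \<open>x\<close> minus the uniform probability measure on the ball. The latter does not depend on
  \<open>x\<close>, so it cancels in the difference of two such fields.\<close>

lemma Phi_cone_field:
  assumes e: "e > 0" and st: "s1 \<le> s2"
  shows "Phi s1 s2 (cone_field c e x) a
      = tent s1 s2 (x - a) - (LINT s|lborel. indicator (ball c e) s * tent s1 s2 (s - a))
      / measure lborel (ball c e)"
proof -
  define v where "v = measure lborel (ball c e)"
  have v: "v > 0" unfolding v_def using e by (simp add: content_ball)
  have int1: "integrable lborel (\<lambda>s. indicator (ball c e) s * k)" for k :: real
    by (rule integrable_bounded_support[of _ "\<bar>k\<bar>" c e]) (auto simp: indicator_def)
  have int2: "integrable lborel (\<lambda>s. indicator (ball c e) s * tent s1 s2 (s - a))"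
    by (rule integrable_bounded_support[of _ "s2
        - s1" c e]) (use st tent_le[OF st] in \<open>auto simp: indicator_def\<close>)
  have "Phi s1 s2 (cone_field c e x) a = (LINT y|lborel. rad s1 s2 (y - a) \<bullet> cone_field c e x y)"
    by (simp add: Phi_def inner_commute)
  also have "\<dots> = (LINT s|lborel. indicator (ball c e) s * (LINT t|lborel. indicator {0<..<1} t
      * (rad s1 s2 (x + t *\<^sub>R (s - x) - a) \<bullet> (s - x)))) / v"
    unfolding v_def by (rule integral_cone_field[OF e, where B=1]) (auto intro: norm_rad_le)
  also have "\<dots> = (LINT s|lborel. indicator (ball c e) s * tent s1 s2 (x - a) - indicator (ball c e) s
      * tent s1 s2 (s - a)) / v"
    by (simp add: integral_rad_segment[OF st] right_diff_distrib)
  also have "\<dots> = (v * tent s1 s2 (x - a) - (LINT s|lborel. indicator (ball c e) s * tent s1 s2 (s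
      - a))) / v"
    by (subst Bochner_Integration.integral_diff[OF int1 int2]) (simp add: v_def)
  also have "\<dots> = tent s1 s2 (x - a) - (LINT s|lborel. indicator (ball c e) s * tent s1 s2 (s - a))
      / v"
    using v by (simp add: diff_divide_distrib)
  finally show ?thesis by (simp add: v_def)
qed

text \<open>The integrals over \<open>{s..T}\<close> determine the flux at almost every radius, and
  the charge \<open>N r\<close> enclosed by the sphere has the same integrals.\<close>

lemma Zflux_if_Phi:
  fixes n :: int
  assumes X: "integrable lborel X"
    and Phi: "\<And>s t a. s \<le> t \<Longrightarrow> Phi s t X a = of_int n * (tent s t (x - a) - tent s t (z - a))"
  shows "Zflux X"
  unfolding Zflux_def
proof
  fix a assume "a \<in> B3"
  define T where "T = 1 - norm a"
  define N :: "real \<Rightarrow> real" where "N r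
      = of_int n * (indicator {..<r} (norm (x - a)) - indicator {..<r} (norm (z - a)))" for r
  have NZ: "N r \<in> \<int>" for r unfolding N_def by (auto simp: indicator_def)
  have iN: "integrable lborel (\<lambda>r. indicator A r * indicator {..<r} (norm (y - a)) :: real)"
    if "A \<subseteq> {0..T}" "A \<in> sets borel" for A y
    by (rule integrable_bounded_support[of _ 1 0 T])
      (use that in \<open>auto simp: indicator_def lessThan_iff intro!: measurable_If\<close>)
  have "AE r in lborel. indicator {0<..T} r * sflux X a r - indicator {0<..T} r * N r = 0"
  proof (rule AE_zero_if_intervals_zero[where T=T])
    have "integrable lborel (\<lambda>r. of_int n * (indicator {0<..T} r * indicator {..<r} (norm (x - a))
        - indicator {0<..T} r * indicator {..<r} (norm (z - a))) :: real)"
      by (intro integrable_mult_right Bochner_Integration.integrable_diff iN) auto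
    then have "integrable lborel (\<lambda>r. indicator {0<..T} r * N r)" by (simp add: N_def algebra_simps)
    then show "integrable lborel (\<lambda>r. indicator {0<..T} r * sflux X a r - indicator {0<..T} r * N r)"
      using integrable_sflux_cut[OF X] by simp
    fix s assume s: "0 \<le> s" "s < T"
    have 1: "(LINT r|lborel. indicator {0<..} r * (indicator {s..T} r * sflux X a r))
        = of_int n * (tent s T (x - a) - tent s T (z - a))"
      using Phi[of s T a] s Phi_eq_sflux[OF X, of s T a] by simp
    have i: "integrable lborel (\<lambda>r. indicator {s..T} r * indicator {..<r} (norm (y - a)) :: real)"
        for y
      by (rule iN) (use s in auto)
    let ?M = "\<lambda>r. (indicator {s..T} r * indicator {..<r} (norm (x - a)) - indicator {s..T} r
        * indicator {..<r} (norm (z - a)))"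
    have i2: "integrable lborel (\<lambda>r. of_int n * (?M r) :: real)"
      using i by simp
    have 2: "(LINT r|lborel. of_int n * (?M r))
        = of_int n * (tent s T (x - a) - tent s T (z - a))"
      using s i by (simp add: integral_tent_slices)
    have "(LINT r|lborel. indicator {s..T} r * (indicator {0<..T} r * sflux X a r
        - indicator {0<..T} r * N r))
       = (LINT r|lborel. indicator {0<..} r * (indicator {s..T} r * sflux X a r) - of_int n * (?M r))"
    proof (rule Bochner_Integration.integral_cong[OF refl])
      fix r
      have "N 0 = 0" by (simp add: N_def)
      then show "indicator {s..T} r * (indicator {0<..T} r * sflux X a r - indicator {0<..T} r * N r)
         = indicator {0<..} r * (indicator {s..T} r * sflux X a r) - of_int n * (?M r)"
        using s by (cases "r = 0"; cases "r \<in> {s..T}") (auto simp: N_def right_diff_distrib)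
    qed
    also have "\<dots> = 0"
      unfolding Bochner_Integration.integral_diff[OF integrable_Phi_sflux[OF X] i2] 1 2 by simp
    finally show "(LINT r|lborel. indicator {s..T} r * (indicator {0<..T} r * sflux X a r
        - indicator {0<..T} r * N r)) = 0" .
  qed auto
  then show "AE r in lborel. 0 < r \<and> r < 1 - norm a \<longrightarrow> sflux X a r \<in> \<int>"
  proof eventually_elim
    case (elim r)
    then show ?case using NZ[of r] by (auto simp: T_def)
  qed
qed

section \<open>Sums of fields with integer fluxes, and dipoles as approximate point masses\<close>

lemma Zflux_zero: "Zflux (\<lambda>_. 0)"
  by (simp add: Zflux_def sflux_def)

lemma Zflux_add:
  assumes X: "integrable lborel X" "Zflux X" and Y: "integrable lborel Y" "Zflux Y"
  shows "Zflux (\<lambda>y. X y + Y y)"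
  unfolding Zflux_def
proof
  fix a assume a: "a \<in> B3"
  show "AE r in lborel. 0 < r \<and> r < 1 - norm a \<longrightarrow> sflux (\<lambda>y. X y + Y y) a r \<in> \<int>"
    using X(2)[unfolded Zflux_def, rule_format, OF a] Y(2)[unfolded Zflux_def, rule_format, OF a]
      AE_integrable_sphere[OF X(1), of a] AE_integrable_sphere[OF Y(1), of a]
  proof eventually_elim
    case (elim r)
    show ?case
    proof
      assume r: "0 < r \<and> r < 1 - norm a"
      with elim have "sflux (\<lambda>y. X y + Y y) a r = sflux X a r + sflux Y a r"
        by (simp add: sflux_def inner_add_left distrib_left)
      then show "sflux (\<lambda>y. X y + Y y) a r \<in> \<int>" using elim r by simp
    qed
  qed
qed

lemma Zflux_sum:
  assumes "finite P" "\<And>z. z \<in> P \<Longrightarrow> integrable lborel (F z) \<and> Zflux (F z)"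
  shows "Zflux (\<lambda>y. \<Sum>z\<in>P. F z y)"
  using assms by (induction P rule: finite_induct) (auto simp: Zflux_zero intro!: Zflux_add)

text \<open>The segments from \<open>x'\<close> into the ball stay in the closed ball by convexity
  and have length at most \<open>2 * e\<close>, so replacing \<open>\<phi>\<close> by the constant
  \<open>k\<close> costs at most \<open>2 * e * \<omega>\<close>.\<close>

lemma cone_field_test:
  fixes \<phi> :: "real^3 \<Rightarrow> real"
  assumes [measurable]: "\<phi> \<in> borel_measurable borel" and B: "\<And>y. \<bar>\<phi> y\<bar>
      \<le> B" and e: "e > 0" and x': "x' \<in> cball x e"
    and \<omega>: "\<And>y. y \<in> cball x e \<Longrightarrow> \<bar>\<phi> y - k\<bar> \<le> \<omega>"
  shows "\<bar>(LINT y|lborel. \<phi> y * cone_field x e x' y $ i) - (LINT s|lborel. indicator (ball x e) s * (k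
      * (s - x') $ i)) / measure lborel (ball x e)\<bar> \<le> 2 * e * \<omega>"
proof -
  define v where "v = measure lborel (ball x e)"
  have v: "v > 0" unfolding v_def using e by (simp add: content_ball)
  have B0: "B \<ge> 0" using B[of 0] by linarith
  have \<omega>0: "\<omega> \<ge> 0" using \<omega>[of x] e by simp
  define J where "J s = (LINT t|lborel. indicator {0<..<1} t * (\<phi> (x' + t *\<^sub>R (s - x')) * (s
      - x') $ i))" for s
  have mJ [measurable]: "J \<in> borel_measurable borel" unfolding J_def[abs_def] by measurable
  have comp: "\<bar>(s - x') $ i\<bar> \<le> 2 * e" if "s \<in> ball x e" for s
  proof -
    have "norm (s - x') \<le> norm (s - x) + norm (x - x')" using norm_triangle_ineq[of "s - x" "x - x'"]
        by simp
    also have "\<dots> \<le> 2 * e" using that x' by (auto simp: dist_norm norm_minus_commute)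
    finally show ?thesis using component_le_norm_cart[of "s - x'" i] by linarith
  qed
  have it: "integrable lborel (\<lambda>t. indicator {0<..<1} t * (\<phi> (x' + t *\<^sub>R (s - x')) * (s - x') $ i))"
      for s
  proof (rule integrable_bounded_support[of _ "B * \<bar>(s - x') $ i\<bar>" 0 1])
    show "norm (indicator {0<..<1} t * (\<phi> (x' + t *\<^sub>R (s - x')) * (s - x') $ i)) \<le> B * \<bar>(s - x') $ i\<bar>"
        for t
      using B0 mult_right_mono[OF B[of "x' + t *\<^sub>R (s - x')"], of "\<bar>(s - x') $ i\<bar>"]
          by (auto simp: indicator_def abs_mult)
  qed (auto simp: indicator_def)
  have it0: "integrable lborel (\<lambda>t. indicator {0<..<1} (t::real) * (c::real))" for c
    by (rule integrable_bounded_support[of _ "\<bar>c\<bar>" 0 1]) (auto simp: indicator_def)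
  have J1: "\<bar>J s - k * (s - x') $ i\<bar> \<le> \<omega> * (2 * e)" if s: "s \<in> ball x e" for s
  proof -
    have "J s - k * (s - x') $ i
        = (LINT t|lborel. indicator {0<..<1} t * (\<phi> (x' + t *\<^sub>R (s - x')) * (s - x') $ i)
        - indicator {0<..<1} t * (k * (s - x') $ i))"
      unfolding J_def by (subst Bochner_Integration.integral_diff[OF it it0]) simp
    also have "\<bar>\<dots>\<bar> \<le> (LINT t|lborel. indicator {0<..<1} (t::real) * (\<omega> * (2 * e)))"
    proof (rule integral_abs_bound_integral[OF Bochner_Integration.integrable_diff[OF it it0] it0])
      fix t :: real
      show "\<bar>indicator {0<..<1} t * (\<phi> (x' + t *\<^sub>R (s - x')) * (s - x') $ i) - indicator {0<..<1} t
          * (k * (s - x') $ i)\<bar> \<le> indicator {0<..<1} t * (\<omega> * (2 * e))"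
      proof (cases "t \<in> {0<..<1}")
        case True
        have "x' + t *\<^sub>R (s - x') = (1 - t) *\<^sub>R x' + t *\<^sub>R s" by (simp add: algebra_simps)
        also have "\<dots> \<in> cball x e" using True s x' by (intro convexD_alt[OF convex_cball]) auto
        finally have "\<bar>\<phi> (x' + t *\<^sub>R (s - x')) - k\<bar> * \<bar>(s - x') $ i\<bar> \<le> \<omega> * (2 * e)"
          using \<omega> comp[OF s] \<omega>0 by (intro mult_mono) auto
        then show ?thesis using True by (simp add: abs_mult[symmetric] left_diff_distrib)
      qed simp
    qed
    also have "\<dots> = \<omega> * (2 * e)" by simp
    finally show ?thesis .
  qed
  have is1: "integrable lborel (\<lambda>s. indicator (ball x e) s * J s)"
  proof (rule integrable_bounded_support[of _ "\<bar>k\<bar> * (2 * e) + \<omega> * (2 * e)" x e])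
    show "norm (indicator (ball x e) s * J s) \<le> \<bar>k\<bar> * (2 * e) + \<omega> * (2 * e)" for s
    proof (cases "s \<in> ball x e")
      case True
      have "\<bar>k * (s - x') $ i\<bar> \<le> \<bar>k\<bar> * (2 * e)" using comp[OF True]
          by (simp add: abs_mult mult_left_mono)
      then show ?thesis using J1[OF True] True by simp
    qed (use e \<omega>0 in simp)
  qed (auto simp: indicator_def)
  have is2: "integrable lborel (\<lambda>s. indicator (ball x e) s * (k * (s - x') $ i))"
  proof (rule integrable_bounded_support[of _ "\<bar>k\<bar> * (2 * e)" x e])
    show "norm (indicator (ball x e) s * (k * (s - x') $ i)) \<le> \<bar>k\<bar> * (2 * e)" for s
      using comp[of s] e by (cases "s \<in> ball x e") (auto simp: abs_mult mult_left_mono)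
  qed (auto simp: indicator_def)
  have is3: "integrable lborel (\<lambda>s. indicator (ball x e) s * (\<omega> * (2 * e)))"
    by (rule integrable_bounded_support[of _ "\<omega> * (2
        * e)" x e]) (use e \<omega>0 in \<open>auto simp: indicator_def\<close>)
  have "(LINT y|lborel. \<phi> y * cone_field x e x' y $ i)
      = (LINT y|lborel. (\<phi> y *\<^sub>R axis i 1) \<bullet> cone_field x e x' y)"
    by (simp add: inner_axis')
  also have "\<dots> = (LINT s|lborel. indicator (ball x e) s * (LINT t|lborel. indicator {0<..<1} t
      * ((\<phi> (x' + t *\<^sub>R (s - x')) *\<^sub>R axis i 1) \<bullet> (s - x')))) / v"
    unfolding v_def by (rule integral_cone_field[OF e, where B=B]) (use B in auto)
  also have "\<dots> = (LINT s|lborel. indicator (ball x e) s * J s) / v"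
    by (simp add: J_def inner_axis')
  finally have "(LINT y|lborel. \<phi> y * cone_field x e x' y $ i)
      - (LINT s|lborel. indicator (ball x e) s * (k * (s - x') $ i)) / v
     = (LINT s|lborel. indicator (ball x e) s * J s - indicator (ball x e) s * (k * (s - x') $ i))
         / v"
    by (simp only: Bochner_Integration.integral_diff[OF is1 is2] diff_divide_distrib)
  also have "\<bar>\<dots>\<bar> \<le> (LINT s|lborel. indicator (ball x e) s * (\<omega> * (2 * e))) / v"
  proof -
    have "\<bar>LINT s|lborel. indicator (ball x e) s * J s - indicator (ball x e) s * (k * (s - x') $ i)\<bar>
        \<le> (LINT s|lborel. indicator (ball x e) s * (\<omega> * (2 * e)))"
    proof (rule integral_abs_bound_integral[OF Bochner_Integration.integrable_diff[OF is1 is2] is3])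
      fix s
      show "\<bar>indicator (ball x e) s * J s - indicator (ball x e) s * (k * (s - x') $ i)\<bar>
          \<le> indicator (ball x e) s * (\<omega> * (2 * e))"
        using J1[of s] by (cases "s \<in> ball x e") auto
    qed
    then show ?thesis using v by (simp add: abs_divide divide_right_mono)
  qed
  also have "\<dots> = 2 * e * \<omega>" using v by (simp add: v_def[symmetric])
  finally show ?thesis by (simp add: v_def)
qed

text \<open>The dipole imitates a point mass \<open>w\<close> at \<open>x\<close>. The factor 4
  collects two cone fields, each with error \<open>2 * e * \<omega>\<close> and multiplied by
  \<open>n\<close>, where \<open>n * e = norm w\<close>. It does not depend on
  \<open>\<delta>\<close>, so the dipole may be made as small as desired.\<close>

lemma ex_dipole:
  fixes x w :: "real^3"
  assumes \<delta>: "\<delta> > 0"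
  shows "\<exists>X. integrable lborel X \<and> Zflux X \<and>
    (\<forall>\<phi> B \<omega> i. \<phi> \<in> borel_measurable borel \<longrightarrow> (\<forall>y. \<bar>\<phi> y\<bar> \<le> B) \<longrightarrow> (\<forall>y\<in>cball x \<delta>. \<bar>\<phi> y - \<phi> x\<bar> \<le> \<omega>) \<longrightarrow>
       \<bar>(LINT y|lborel. \<phi> y * X y $ i) - \<phi> x * w $ i\<bar> \<le> 4 * norm w * \<omega>)"
proof (cases "w = 0")
  case True
  then show ?thesis by (intro exI[of _ "\<lambda>_. 0"]) (auto simp: Zflux_zero)
next
  case False
  \<comment> \<open>Large charge, short distance: \<open>n * e = norm w\<close> stays fixed while
    \<open>n\<close> is taken so large that \<open>e \<le> \<delta>\<close>.\<close>
  obtain n :: nat where n: "norm w / \<delta> < real n" using reals_Archimedean2 by blast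
  then have n0: "n > 0" using \<delta> False by (intro gr0I) (auto simp: divide_less_0_iff)
  define e where "e = norm w / real n"
  have e: "e > 0" "e \<le> \<delta>" using n n0 \<delta> False by (auto simp: e_def field_simps)
  define z where "z = x + w /\<^sub>R real n"
  have z: "z \<in> cball x e" using n0 by (simp add: z_def e_def dist_norm divide_inverse mult.commute)
  \<comment> \<open>The uniform charges on the common ball cancel, leaving charge \<open>n\<close>
    at \<open>x\<close> and \<open>- n\<close> at \<open>z\<close>; the moment is \<open>n\<close>
    times \<open>z - x\<close>, that is \<open>w\<close>.\<close>
  define X where "X y = real n *\<^sub>R (cone_field x e x y - cone_field x e z y)" for y
  note ic = integrable_cone_field[OF e(1)]
  have X: "integrable lborel X" unfolding X_def using ic by auto
  have ZX: "Zflux X"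
  proof (rule Zflux_if_Phi[OF X, of "int n" x z])
    fix s t a assume st: "(s::real) \<le> t"
    have "Phi s t X a = (LINT y|lborel. real n * (cone_field x e x y \<bullet> rad s t (y - a)) - real n
        * (cone_field x e z y \<bullet> rad s t (y - a)))"
      unfolding Phi_def X_def by (simp add: inner_diff_left right_diff_distrib)
    also have "\<dots> = real n * Phi s t (cone_field x e x) a - real n * Phi s t (cone_field x e z) a"
      using integrable_Phi[OF ic] by (simp add: Phi_def)
    also have "\<dots> = real_of_int (int n) * (tent s t (x - a) - tent s t (z - a))"
      unfolding Phi_cone_field[OF e(1) st] by (simp add: algebra_simps)
    finally show "Phi s t X a = real_of_int (int n) * (tent s t (x - a) - tent s t (z - a))" .
  qed
  have test: "\<bar>(LINT y|lborel. \<phi> y * X y $ i) - \<phi> x * w $ i\<bar> \<le> 4 * norm w * \<omega>"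
    if [measurable]: "\<phi> \<in> borel_measurable borel" and B: "\<And>y. \<bar>\<phi> y\<bar> \<le> B" and \<omega>: "\<And>y. y \<in> cball x \<delta>
        \<Longrightarrow> \<bar>\<phi> y - \<phi> x\<bar> \<le> \<omega>" for \<phi> B \<omega> i
  proof -
    define v where "v = measure lborel (ball x e)"
    have v: "v > 0" unfolding v_def using e by (simp add: content_ball)
    define G where "G x' = (LINT s|lborel. indicator (ball x e) s * (\<phi> x * (s - x') $ i)) / v" for x'
    define H where "H x' = (LINT y|lborel. \<phi> y * cone_field x e x' y $ i)" for x'
    have \<omega>': "\<bar>\<phi> y - \<phi> x\<bar> \<le> \<omega>" if "y \<in> cball x e" for y using \<omega>[of y] that e by simp
    have HG: "\<bar>H x' - G x'\<bar> \<le> 2 * e * \<omega>" if "x' \<in> cball x e" for x'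
      unfolding H_def G_def v_def by (rule cone_field_test[where B=B]) (use B e \<omega>' that in auto)
    have ic': "integrable lborel (\<lambda>y. \<phi> y * cone_field x e x' y $ i)" for x'
      using integrable_inner_bounded[OF ic[of x x'], of "\<lambda>y. \<phi> y *\<^sub>R axis i 1" B] B
          by (simp add: inner_axis mult.commute)
    have "(LINT y|lborel. \<phi> y * X y $ i)
        = (LINT y|lborel. real n * (\<phi> y * cone_field x e x y $ i) - real n * (\<phi> y
        * cone_field x e z y $ i))"
      by (simp add: X_def algebra_simps)
    also have "\<dots> = real n * (H x - H z)" using ic' by (simp add: H_def right_diff_distrib)
    finally have 1: "(LINT y|lborel. \<phi> y * X y $ i) = real n * (H x - H z)" .
    have iG: "integrable lborel (\<lambda>s. indicator (ball x e) s * (\<phi> x * (s - x') $ i))" for x'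
    proof (rule integrable_bounded_support[of _ "\<bar>\<phi> x\<bar> * (e + norm (x - x'))" x e])
      show "(\<lambda>s. indicator (ball x e) s * (\<phi> x * (s - x') $ i)) \<in> borel_measurable borel"
        unfolding indicator_def mem_ball by measurable
      show "norm (indicator (ball x e) s * (\<phi> x * (s - x') $ i)) \<le> \<bar>\<phi> x\<bar> * (e + norm (x - x'))" for s
      proof (cases "s \<in> ball x e")
        case True
        have "\<bar>(s - x') $ i\<bar> \<le> norm (s - x')" by (rule component_le_norm_cart)
        also have "\<dots> \<le> e + norm (x - x')" using True norm_triangle_ineq[of "s - x" "x - x'"]
            by (simp add: dist_norm norm_minus_commute)
        finally show ?thesis using True by (simp add: abs_mult mult_left_mono)
      qed (use e in simp)
    qed (auto simp: indicator_def)
    have "G x - G z = (LINT s|lborel. indicator (ball x e) s * (\<phi> x * (s - x) $ i)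
        - indicator (ball x e) s * (\<phi> x * (s - z) $ i)) / v"
      by (simp only: G_def Bochner_Integration.integral_diff[OF iG iG] diff_divide_distrib)
    also have "\<dots> = (LINT s|lborel. indicator (ball x e) s * (\<phi> x * (z - x) $ i)) / v"
      by (simp add: algebra_simps)
    also have "\<dots> = \<phi> x * (z - x) $ i" using v by (simp add: v_def)
    finally have 2: "real n * (G x - G z) = \<phi> x * w $ i" using n0 by (simp add: z_def)
    have "(LINT y|lborel. \<phi> y * X y $ i) - \<phi> x * w $ i = real n * ((H x - G x) - (H z - G z))"
      unfolding 1 2[symmetric] by (simp add: algebra_simps)
    then have "\<bar>(LINT y|lborel. \<phi> y * X y $ i) - \<phi> x * w $ i\<bar> = real n * \<bar>(H x - G x) - (H z - G z)\<bar>"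
      by (simp only: abs_mult abs_of_nat)
    also have "\<dots> \<le> real n * (2 * e * \<omega> + 2 * e * \<omega>)"
    proof -
      have "\<bar>(H x - G x) - (H z - G z)\<bar> \<le> 2 * e * \<omega> + 2 * e * \<omega>"
      proof -
        have "\<bar>H x - G x\<bar> \<le> 2 * e * \<omega>" by (rule HG) (use e in simp)
        then show ?thesis using HG[OF z] by linarith
      qed
      then show ?thesis by (intro mult_left_mono) auto
    qed
    also have "\<dots> = 4 * norm w * \<omega>" using n0 by (simp add: e_def)
    finally show ?thesis .
  qed
  show ?thesis
  proof (intro exI[of _ X] conjI allI impI)
    fix \<phi> :: "real^3 \<Rightarrow> real" and B \<omega> i
    assume "\<phi> \<in> borel_measurable borel" "\<forall>y. \<bar>\<phi> y\<bar> \<le> B" "\<forall>y\<in>cball x \<delta>. \<bar>\<phi> y - \<phi> x\<bar> \<le> \<omega>"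
    then show "\<bar>(LINT y|lborel. \<phi> y * X y $ i) - \<phi> x * w $ i\<bar> \<le> 4 * norm w * \<omega>"
      by (intro test[of \<phi> B \<omega> i]) simp_all
  qed (rule X ZX)+
qed

section \<open>Approximation of measures\<close>

definition grid :: "real \<Rightarrow> real^3 \<Rightarrow> real^3" where
  "grid d x = (\<chi> i. d * real_of_int \<lfloor>x $ i / d\<rfloor>)"

text \<open>The factor 3 is the dimension: the norm is bounded by the sum of the
  coordinates.\<close>

lemma norm_diff_grid:
  assumes d: "d > 0"
  shows "norm (x - grid d x) \<le> 3 * d"
proof -
  have "\<bar>(x - grid d x) $ i\<bar> \<le> d" for i
  proof -
    have "d * real_of_int \<lfloor>x $ i / d\<rfloor> \<le> d * (x $ i / d)" "d * (x $ i / d)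
        \<le> d * (real_of_int \<lfloor>x $ i / d\<rfloor> + 1)"
      using d by (intro mult_left_mono; linarith)+
    then show ?thesis using d by (simp add: grid_def distrib_left)
  qed
  then have "(\<Sum>i\<in>UNIV. \<bar>(x - grid d x) $ i\<bar>) \<le> (\<Sum>i\<in>(UNIV::3 set). d)" by (intro sum_mono) auto
  then show ?thesis using norm_le_l1_cart[of "x - grid d x"] by simp
qed

lemma finite_grid:
  assumes d: "d > 0"
  shows "finite (grid d ` cball 0 R)"
proof -
  define m where "m = \<lceil>R / d\<rceil> + 1"
  have "grid d ` cball 0 R \<subseteq> (\<lambda>f. \<chi> i. d * real_of_int (f i)) ` (UNIV \<rightarrow>\<^sub>E {- m..m})"
  proof
    fix z assume "z \<in> grid d ` cball 0 R"
    then obtain x where x: "norm x \<le> R" "z = grid d x" by (auto simp: dist_norm)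
    have "\<lfloor>x $ i / d\<rfloor> \<in> {- m..m}" for i
    proof -
      have "\<bar>x $ i / d\<bar> \<le> R / d" using component_le_norm_cart[of x i] x d
          by (simp add: abs_divide divide_right_mono)
      then have "x $ i / d \<le> R / d" "- (R / d) \<le> x $ i / d" by (simp_all only: abs_le_iff) linarith
      then have "\<lfloor>x $ i / d\<rfloor> \<le> \<lceil>R / d\<rceil>" "- \<lceil>R / d\<rceil> - 1 \<le> \<lfloor>x $ i / d\<rfloor>" by linarith+
      then show ?thesis unfolding m_def by simp
    qed
    then show "z \<in> (\<lambda>f. \<chi> i. d * real_of_int (f i)) ` (UNIV \<rightarrow>\<^sub>E {- m..m})"
      unfolding x(2) grid_def by (intro image_eqI[of _ _ "\<lambda>i. \<lfloor>x $ i / d\<rfloor>"]) auto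
  qed
  then show ?thesis by (rule finite_subset) (auto intro!: finite_PiE)
qed

lemma borel_measurable_grid [measurable]: "grid d \<in> borel_measurable borel"
proof -
  have "(\<lambda>x. grid d x \<bullet> b) \<in> borel_measurable borel" if "b \<in> Basis" for b
    using that unfolding grid_def by (auto simp: Basis_vec_def inner_axis)
  then show ?thesis by (subst borel_measurable_euclidean_space) auto
qed

lemma Cc_B3_support:
  assumes "\<phi> \<in> Cc_B3"
  obtains \<rho> where "0 \<le> \<rho>" "\<rho> < 1" "\<And>y. \<phi> y \<noteq> 0 \<Longrightarrow> norm y \<le> \<rho>"
proof -
  define S where "S = closure {x. \<phi> x \<noteq> 0}"
  have S: "compact S" "S \<subseteq> B3" using assms by (auto simp: Cc_B3_def S_def)
  show ?thesis
  proof (cases "S = {}")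
    case True
    then show ?thesis using that[of 0] closure_subset[of "{x. \<phi> x \<noteq> 0}"] by (auto simp: S_def)
  next
    case False
    obtain z where z: "z \<in> S" "\<And>y. y \<in> S \<Longrightarrow> norm y \<le> norm z"
      using continuous_attains_sup[OF S(1) False, of norm] continuous_on_norm_id by blast
    have "norm z < 1" using z(1) S(2) by (auto simp: B3_def)
    then show ?thesis using that[of "norm z"] z(2) closure_subset[of "{x. \<phi> x \<noteq> 0}"]
        by (auto simp: S_def)
  qed
qed

lemma Cc_B3_bounded:
  assumes "\<phi> \<in> Cc_B3"
  obtains B where "\<And>y. \<bar>\<phi> y\<bar> \<le> B"
proof -
  have c: "continuous_on UNIV \<phi>" using assms by (simp add: Cc_B3_def)
  have "compact (\<phi> ` cball 0 1)" by (intro compact_continuous_image continuous_on_subset[OF c]) auto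
  then obtain B where B: "\<And>y. y \<in> cball 0 1 \<Longrightarrow> \<bar>\<phi> y\<bar> \<le> B"
    using compact_imp_bounded[THEN bounded_iff[THEN iffD1]] by force
  obtain \<rho> where \<rho>: "\<rho> < 1" "\<And>y. \<phi> y \<noteq> 0 \<Longrightarrow> norm y \<le> \<rho>" using Cc_B3_support[OF assms] by blast
  have "\<bar>\<phi> y\<bar> \<le> max B 0" for y
    using B[of y] \<rho>(1) \<rho>(2)[of y] by (cases "\<phi> y = 0") auto
  then show ?thesis using that by blast
qed

text \<open>Every grid cell carries one dipole at its corner with moment the mass of the cell times
  \<open>u\<close>. The mass of \<open>M\<close> may be infinite near the unit sphere, so errors are
  charged only to the cells inside a compact ball \<open>L\<close> adapted to the test
  function.\<close>

lemma radon_dipole_approx: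
  fixes u :: "real^3"
  assumes M: "radon_on_B3 M" and u: "norm u \<le> 1"
  shows "\<exists>Xs. (\<forall>k. integrable lborel (Xs k) \<and> Zflux (Xs k)) \<and>
    (\<forall>\<phi>\<in>Cc_B3. \<forall>i. (\<lambda>k. LINT y|lborel. \<phi> y * Xs k y $ i) \<longlonglongrightarrow> integral\<^sup>L M \<phi> * u $ i)"
proof -
  have sM [measurable_cong, simp]: "sets M = sets borel" and finM: "\<And>K. compact K \<Longrightarrow> K \<subseteq> B3
      \<Longrightarrow> emeasure M K < \<infinity>"
    using M by (auto simp: radon_on_B3_def)
  have spM [simp]: "space M = UNIV" using sets_eq_imp_space_eq[OF sM] by simp
  define d where "d k = inverse (real (Suc k))" for k
  have d: "d k > 0" "d k \<le> 1" for k by (auto simp: d_def inverse_le_1_iff)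
  have dlim: "d \<longlonglongrightarrow> 0" unfolding d_def[abs_def] by (rule LIMSEQ_inverse_real_of_nat)
  \<comment> \<open>Exhaustion by compact balls, on which \<open>M\<close> is finite; each
    \<open>k\<close> then needs finitely many cells of finite mass.\<close>
  define K where "K k = cball (0::real^3) (1 - d k)" for k
  define A where "A k z = {y \<in> K k. grid (d k) y = z}" for k z
  define P where "P k = grid (d k) ` K k" for k
  have finP: "finite (P k)" for k unfolding P_def K_def by (rule finite_grid[OF d(1)])
  have Am [measurable]: "A k z \<in> sets borel" for k z unfolding A_def K_def by measurable
  have cB: "cball (0::real^3) r \<subseteq> B3" if "r < 1" for r using that by (auto simp: B3_def)
  have finA: "emeasure M S < \<infinity>" if "S \<subseteq> cball 0 r" "r < 1" "S \<in> sets borel" for S r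
    using finM[OF compact_cball cB[OF that(2)]] emeasure_mono[OF that(1), of M]
        by (auto intro: le_less_trans)
  have AK: "A k z \<subseteq> cball 0 (1 - d k)" for k z by (auto simp: A_def K_def)
  have iA: "integrable M (indicat_real S)" if "S \<subseteq> cball 0 r" "r < 1" "S \<in> sets borel" for S r
    using finA[OF that] that by (intro integrable_real_indicator) auto
  have dk1: "1 - d k < 1" for k using d(1)[of k] by simp
  define m where "m k z = measure M (A k z)" for k z
  define Q where "Q k z X \<longleftrightarrow> integrable lborel X \<and> Zflux X \<and>
    (\<forall>\<phi> B \<omega> i. \<phi> \<in> borel_measurable borel \<longrightarrow> (\<forall>y. \<bar>\<phi> y\<bar> \<le> B) \<longrightarrow> (\<forall>y\<in>cball z (d k). \<bar>\<phi> y - \<phi> z\<bar> \<le> \<omega>) \<longrightarrow>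
       \<bar>(LINT y|lborel. \<phi> y * X y $ i) - \<phi> z * (m k z *\<^sub>R u) $ i\<bar>
           \<le> 4 * norm (m k z *\<^sub>R u) * \<omega>)" for k z X
  have "\<exists>X. Q k z X" for k z unfolding Q_def by (rule ex_dipole[OF d(1)])
  then obtain D where QD: "\<And>k z. Q k z (D k z)" by metis
  have D: "integrable lborel (D k z)" "Zflux (D k z)" for k z
    using QD[of k z] unfolding Q_def by blast+
  have Dt: "\<bar>(LINT y|lborel. \<phi> y * D k z y $ i) - \<phi> z * (m k z *\<^sub>R u) $ i\<bar>
      \<le> 4 * norm (m k z *\<^sub>R u) * \<omega>"
    if "\<phi> \<in> borel_measurable borel" "\<And>y. \<bar>\<phi> y\<bar> \<le> B" "\<And>y. y \<in> cball z (d k) \<Longrightarrow> \<bar>\<phi> y - \<phi> z\<bar> \<le> \<omega>"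
        for k z \<phi> B \<omega> i
  proof -
    have "\<forall>y. \<bar>\<phi> y\<bar> \<le> B" "\<forall>y\<in>cball z (d k). \<bar>\<phi> y - \<phi> z\<bar> \<le> \<omega>" using that by blast+
    with QD[of k z, unfolded Q_def, THEN conjunct2, THEN conjunct2, rule_format, OF that(1)] show
        ?thesis by blast
  qed
  define Xs where "Xs k y = (\<Sum>z\<in>P k. D k z y)" for k y
  have "integrable lborel (Xs k) \<and> Zflux (Xs k)" for k
    unfolding Xs_def using D finP by (auto intro!: Zflux_sum)
  moreover have "(\<lambda>k. LINT y|lborel. \<phi> y * Xs k y $ i) \<longlonglongrightarrow> integral\<^sup>L M \<phi> * u $ i" if \<phi>: "\<phi> \<in> Cc_B3"
      for \<phi> i
  proof (rule LIMSEQ_I)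
    fix \<epsilon> :: real assume \<epsilon>: "\<epsilon> > 0"
    have c: "continuous_on UNIV \<phi>" using \<phi> by (simp add: Cc_B3_def)
    have m\<phi> [measurable]: "\<phi> \<in> borel_measurable borel" by (rule borel_measurable_continuous_onI[OF c])
    obtain B where B: "\<And>y. \<bar>\<phi> y\<bar> \<le> B" using Cc_B3_bounded[OF \<phi>] by blast
    obtain \<rho> where \<rho>: "0 \<le> \<rho>" "\<rho> < 1" "\<And>y. \<phi> y \<noteq> 0 \<Longrightarrow> norm y \<le> \<rho>" using Cc_B3_support[OF \<phi>] by blast
    \<comment> \<open>A slightly larger ball than the support: for small cells, whatever sticks out
      of it is far from the support.\<close>
    define \<rho>' where "\<rho>' = (1 + \<rho>) / 2"
    have \<rho>': "\<rho> < \<rho>'" "\<rho>' < 1" using \<rho> by (auto simp: \<rho>'_def)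
    define L where "L = cball (0::real^3) \<rho>'"
    have iL: "integrable M (indicat_real L)" unfolding L_def by (rule iA[OF order_refl \<rho>'(2)]) simp
    \<comment> \<open>Per unit of mass a cell errs by at most \<open>5 * \<epsilon>'\<close>, 4 from
      the dipole and 1 from freezing \<open>\<phi>\<close> at the corner; the 10 leaves
      \<open>\<epsilon> / 2\<close> in total, and adding 1 allows for \<open>L\<close> of mass
      0.\<close>
    define \<epsilon>' where "\<epsilon>' = \<epsilon> / (10 * (measure M L + 1))"
    have \<epsilon>': "\<epsilon>' > 0" using \<epsilon> measure_nonneg[of M L]
        by (auto simp: \<epsilon>'_def intro!: divide_pos_pos add_nonneg_pos)
    \<comment> \<open>Corners of cells and points near them may lie outside the unit ball; radius 10
      has room for both since \<open>d k \<le> 1\<close>.\<close>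
    have "uniformly_continuous_on (cball 0 10) \<phi>"
      by (intro compact_uniformly_continuous continuous_on_subset[OF c]) auto
    then obtain \<eta> where \<eta>: "\<eta> > 0" "\<And>x y. x \<in> cball 0 10 \<Longrightarrow> y \<in> cball 0 10 \<Longrightarrow> dist y x < \<eta>
        \<Longrightarrow> dist (\<phi> y) (\<phi> x) < \<epsilon>'"
      unfolding uniformly_continuous_on_def using \<epsilon>' by metis
    \<comment> \<open>Two points within \<open>3 * d k\<close> of one corner are at most
      \<open>6 * d k\<close> apart, and uniform continuity is used at distance
      \<open>3 * d k < \<eta>\<close>; hence the divisors 6 and 4.\<close>
    define \<tau> where "\<tau> = min ((\<rho>' - \<rho>) / 6) (\<eta> / 4)"
    have \<tau>: "\<tau> > 0" using \<rho>' \<eta> by (simp add: \<tau>_def)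
    obtain k0 where k0: "\<And>k. k \<ge> k0 \<Longrightarrow> d k < \<tau>"
      using order_tendstoD(2)[OF dlim \<tau>] unfolding eventually_sequentially by blast
    show "\<exists>no. \<forall>k\<ge>no. norm ((LINT y|lborel. \<phi> y * Xs k y $ i) - integral\<^sup>L M \<phi> * u $ i) < \<epsilon>"
    proof (intro exI[of _ k0] allI impI)
      fix k assume "k \<ge> k0"
      then have dk: "6 * d k < \<rho>' - \<rho>" "4 * d k < \<eta>" using k0[of k] by (auto simp: \<tau>_def)
      have near: "\<bar>\<phi> y - \<phi> z\<bar> \<le> \<epsilon>'" if zP: "z \<in> P k" and yz: "norm (y - z) \<le> 3 * d k" for y z
      proof -
        obtain x where x': "x \<in> K k" "z = grid (d k) x" using zP unfolding P_def by blast
        then have x: "norm x \<le> 1" "z = grid (d k) x" using d(1)[of k] by (auto simp: K_def)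
        have nz: "norm z \<le> 4" using norm_diff_grid[OF d(1), of x k] norm_triangle_ineq2[of z x] x
            d(2)[of k] by (simp add: norm_minus_commute)
        then have "norm y \<le> 10" using norm_triangle_ineq2[of y z] yz d(2)[of k] by simp
        then have "dist (\<phi> y) (\<phi> z) < \<epsilon>'" using nz yz dk(2) d(1)[of k]
            by (intro \<eta>(2)) (auto simp: dist_norm)
        then show ?thesis by (simp add: dist_real_def)
      qed
      have iA\<phi>: "integrable M (\<lambda>y. \<phi> y * indicator (A k z) y)" for z
        by (rule integrable_bounded_mult[OF iA[OF AK dk1 Am], of \<phi> B]) (use B in auto)
      have Anear: "norm (y - z) \<le> 3 * d k" if "y \<in> A k z" for y z
        using that norm_diff_grid[OF d(1), of y k] by (auto simp: A_def)
      \<comment> \<open>The error is bounded by the mass of the cell inside \<open>L\<close>, so the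
        bounds sum to at most \<open>measure M L\<close>. This works because for a cell not
        contained in \<open>L\<close> the function \<open>\<phi>\<close> vanishes within
        \<open>3 * d k\<close> of the corner, and both terms are 0.\<close>
      have piece: "\<bar>(LINT y|lborel. \<phi> y * D k z y $ i) - (LINT y|M. \<phi> y * indicator (A k z) y)
          * u $ i\<bar> \<le> 5 * \<epsilon>' * (LINT y|M. indicator (A k z) y * indicator L y)"
        if z: "z \<in> P k" for z
      proof (cases "A k z \<subseteq> L")
        case True
        have ml: "(LINT y|M. indicator (A k z) y * indicator L y) = m k z"
        proof -
          have "(LINT y|M. indicator (A k z) y * indicator L y)
              = (LINT y|M. indicator (A k z) y :: real)"
            by (rule Bochner_Integration.integral_cong) (use True in \<open>auto simp: indicator_def\<close>)
          then show ?thesis by (simp add: m_def)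
        qed
        have m0: "m k z \<ge> 0" by (simp add: m_def)
        have "\<bar>(LINT y|lborel. \<phi> y * D k z y $ i) - \<phi> z * (m k z *\<^sub>R u) $ i\<bar>
            \<le> 4 * norm (m k z *\<^sub>R u) * \<epsilon>'"
          by (rule Dt[OF m\<phi> B]) (use near[OF z] d(1)[of k] in \<open>auto simp: dist_norm
              norm_minus_commute\<close>)
        also have "\<dots> \<le> 4 * m k z * \<epsilon>'"
        proof -
          have "norm (m k z *\<^sub>R u) \<le> m k z" using mult_left_le[OF u m0] m0 by simp
          then show ?thesis using \<epsilon>' by (intro mult_right_mono mult_left_mono) auto
        qed
        finally have 1: "\<bar>(LINT y|lborel. \<phi> y * D k z y $ i) - \<phi> z * m k z * u $ i\<bar> \<le> 4 * m k z * \<epsilon>'"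
            by (simp add: mult.assoc)
        have "\<phi> z * m k z - (LINT y|M. \<phi> y * indicator (A k z) y)
            = (LINT y|M. \<phi> z * indicator (A k z) y - \<phi> y * indicator (A k z) y)"
          using iA\<phi>[of z] iA[OF AK dk1 Am, of k z]
              by (subst Bochner_Integration.integral_diff) (auto simp: m_def)
        also have "\<bar>\<dots>\<bar> \<le> (LINT y|M. \<epsilon>' * indicator (A k z) y)"
        proof (rule integral_abs_bound_integral)
          fix y
          show "\<bar>\<phi> z * indicator (A k z) y - \<phi> y * indicator (A k z) y\<bar> \<le> \<epsilon>' * indicator (A k z) y"
            using near[OF z Anear, of y] by (auto simp: indicator_def abs_minus_commute)
        qed (use iA\<phi>[of z] iA[OF AK dk1 Am, of k z] in auto)
        also have "\<dots> = \<epsilon>' * m k z" by (simp add: m_def)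
        finally have 2: "\<bar>\<phi> z * m k z - (LINT y|M. \<phi> y * indicator (A k z) y)\<bar> \<le> \<epsilon>' * m k z" .
        have ui: "\<bar>u $ i\<bar> \<le> 1" using component_le_norm_cart[of u i] u by simp
        have "\<bar>\<phi> z * m k z * u $ i - (LINT y|M. \<phi> y * indicator (A k z) y) * u $ i\<bar>
            = \<bar>\<phi> z * m k z - (LINT y|M. \<phi> y * indicator (A k z) y)\<bar> * \<bar>u $ i\<bar>"
          by (simp only: left_diff_distrib[symmetric] abs_mult)
        also have "\<dots> \<le> \<epsilon>' * m k z * 1" using 2 ui by (intro mult_mono) auto
        finally have "\<bar>(LINT y|lborel. \<phi> y * D k z y $ i) - (LINT y|M. \<phi> y * indicator (A k z) y)
            * u $ i\<bar> \<le> 4 * m k z * \<epsilon>' + \<epsilon>' * m k z * 1"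
          using 1 by linarith
        then show ?thesis unfolding ml by simp
      next
        case False
        then obtain x where "x \<in> A k z" "x \<notin> L" by blast
        then have x: "x \<in> A k z" "norm x > \<rho>'" by (simp_all add: L_def)
        have z0: "\<phi> y = 0" if "norm (y - z) \<le> 3 * d k" for y
        proof (rule ccontr)
          assume "\<phi> y \<noteq> 0"
          then have "norm y \<le> \<rho>" by (rule \<rho>(3))
          moreover have "norm (x - y) \<le> 6 * d k"
              using Anear[OF x(1)] that norm_triangle_ineq4[of "x - z" "y - z"] by simp
          ultimately show False using x(2) dk(1) norm_triangle_ineq2[of x y] by linarith
        qed
        have "\<phi> z = 0" using z0[of z] d(1)[of k] by simp
        moreover have "\<bar>(LINT y|lborel. \<phi> y * D k z y $ i) - \<phi> z * (m k z *\<^sub>R u) $ i\<bar>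
            \<le> 4 * norm (m k z *\<^sub>R u) * 0"
          by (rule Dt[OF m\<phi> B]) (use z0 d(1)[of k] in \<open>auto simp: dist_norm norm_minus_commute\<close>)
        moreover have "(\<lambda>y. \<phi> y * indicator (A k z) y) = (\<lambda>y. 0)"
          using z0 Anear by (auto simp: indicator_def fun_eq_iff)
        moreover have "5 * \<epsilon>' * (LINT y|M. indicator (A k z) y * indicator L y) \<ge> 0"
          using \<epsilon>' by (intro mult_nonneg_nonneg integral_nonneg_AE) auto
        ultimately show ?thesis by simp
      qed
      have S: "(\<Sum>z\<in>P k. indicator (A k z) y * f) = (indicator (K k) y * f :: real)" for y f
      proof (cases "y \<in> K k")
        case True
        then have "(\<Sum>z\<in>P k. indicator (A k z) y * f) = (\<Sum>z\<in>P k. if grid (d k) y = z then f else 0)"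
          by (intro sum.cong) (auto simp: A_def indicator_def)
        also have "\<dots> = f" using True finP[of k] by (simp add: P_def)
        finally show ?thesis using True by simp
      next
        case False
        then show ?thesis by (auto simp: A_def)
      qed
      have mS: "(\<Sum>z\<in>P k. LINT y|M. indicator (A k z) y * indicator L y) \<le> measure M L"
      proof -
        have iAL: "integrable M (\<lambda>y. indicator (A k z) y * indicator L y :: real)" for z
          by (rule integrable_bounded_mult[OF iL, of _ 1]) (auto simp: indicator_def)
        have "(\<Sum>z\<in>P k. LINT y|M. indicator (A k z) y * indicator L y)
            = (LINT y|M. (\<Sum>z\<in>P k. indicator (A k z) y * indicator L y) :: real)"
          using iAL by (subst Bochner_Integration.integral_sum) auto
        also have "\<dots> = (LINT y|M. indicator (K k) y * indicator L y)" unfolding S ..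
        also have "\<dots> \<le> (LINT y|M. indicator L y)"
        proof (rule integral_mono[OF _ iL])
          have "K k \<in> sets borel" by (simp add: K_def)
          then show "integrable M (\<lambda>y. indicator (K k) y * indicator L y :: real)"
            by (intro integrable_bounded_mult[OF iL, of _ 1]) (auto simp: indicator_def)
        qed (auto simp: indicator_def)
        finally show ?thesis by simp
      qed
      have iD: "integrable lborel (\<lambda>y. \<phi> y * D k z y $ i)" for z
        using integrable_inner_bounded[OF D(1)[of k z], of "\<lambda>y. \<phi> y *\<^sub>R axis i 1" B] B
            by (simp add: inner_axis mult.commute)
      have X: "(LINT y|lborel. \<phi> y * Xs k y $ i) = (\<Sum>z\<in>P k. LINT y|lborel. \<phi> y * D k z y $ i)"
      proof -
        have "(LINT y|lborel. \<phi> y * Xs k y $ i) = (LINT y|lborel. (\<Sum>z\<in>P k. \<phi> y * D k z y $ i))"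
          by (simp add: Xs_def sum_distrib_left)
        also have "\<dots> = (\<Sum>z\<in>P k. LINT y|lborel. \<phi> y * D k z y $ i)"
          using iD by (intro Bochner_Integration.integral_sum)
        finally show ?thesis .
      qed
      have Y: "integral\<^sup>L M \<phi> = (\<Sum>z\<in>P k. LINT y|M. \<phi> y * indicator (A k z) y)"
      proof -
        have "integral\<^sup>L M \<phi> = (LINT y|M. (\<Sum>z\<in>P k. \<phi> y * indicator (A k z) y))"
        proof (rule Bochner_Integration.integral_cong[OF refl])
          fix y
          have "\<phi> y = 0" if "y \<notin> K k" using \<rho>(3)[of y] that dk(1) \<rho>' by (auto simp: K_def)
          then show "\<phi> y = (\<Sum>z\<in>P k. \<phi> y * indicator (A k z) y)"
            using S[of y "\<phi> y"] by (cases "y \<in> K k") (auto simp: mult.commute)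
        qed
        also have "\<dots> = (\<Sum>z\<in>P k. LINT y|M. \<phi> y * indicator (A k z) y)"
          using iA\<phi> by (intro Bochner_Integration.integral_sum)
        finally show ?thesis .
      qed
      have "\<bar>(LINT y|lborel. \<phi> y * Xs k y $ i) - integral\<^sup>L M \<phi> * u $ i\<bar>
         = \<bar>\<Sum>z\<in>P k. (LINT y|lborel. \<phi> y * D k z y $ i) - (LINT y|M. \<phi> y * indicator (A k z) y)
             * u $ i\<bar>"
        unfolding X Y sum_distrib_right sum_subtractf ..
      also have "\<dots> \<le> (\<Sum>z\<in>P k. 5 * \<epsilon>' * (LINT y|M. indicator (A k z) y * indicator L y))"
        by (rule order_trans[OF sum_abs sum_mono[OF piece]])
      also have "\<dots> = 5 * \<epsilon>' * (\<Sum>z\<in>P k. LINT y|M. indicator (A k z) y * indicator L y)"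
        by (simp only: sum_distrib_left)
      also have "\<dots> \<le> 5 * \<epsilon>' * (measure M L + 1)"
        using mS \<epsilon>' by (intro mult_left_mono) auto
      also have "\<dots> = \<epsilon> / 2"
      proof -
        have "measure M L + 1 > 0" by (rule add_nonneg_pos) auto
        then show ?thesis by (simp add: \<epsilon>'_def field_simps)
      qed
      finally show "norm ((LINT y|lborel. \<phi> y * Xs k y $ i) - integral\<^sup>L M \<phi> * u $ i) < \<epsilon>"
        using \<epsilon> by simp
    qed
  qed
  ultimately show ?thesis by blast
qed

lemma Zflux_LpZ1:
  assumes X: "integrable lborel X" "Zflux X"
  shows "X \<in> LpZ 1"
proof -
  have [measurable]: "X \<in> borel_measurable borel" using X by auto
  have "integrable lborel (\<lambda>y. indicator B3 y * norm (X y))"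
    by (rule integrable_bounded_mult[of _ _ _ 1]) (use X in \<open>auto simp: indicator_def\<close>)
  then have "integrable (lebesgue_on B3) (\<lambda>y. norm (X y) powr 1)"
    by (subst integrable_B3_iff[where h'="\<lambda>y. indicator B3 y
        * norm (X y)"]) (auto simp: indicator_def)
  moreover have "X \<in> borel_measurable (lebesgue_on B3)"
    by (rule measurable_B3[where h'="\<lambda>y. indicator B3 y *\<^sub>R X y"]) (auto simp: indicator_def)
  ultimately have "X \<in> Lp 1" by (simp add: Lp_def)
  then show ?thesis using X LpZ_iff[OF X(1), of X 1] by simp
qed

text \<open>Six scalar approximations are superposed, two for each coordinate. The sign of
  \<open>\<mu>neg i\<close> is put into the direction \<open>- axis i 1\<close>, so only sums of
  fields with integer fluxes are formed.\<close>

theorem L1Z_weakly_dense: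
  fixes \<mu>pos \<mu>neg :: "3 \<Rightarrow> (real^3) measure"
  assumes \<mu>: "\<And>i. radon_on_B3 (\<mu>pos i)" "\<And>i. radon_on_B3 (\<mu>neg i)"
  shows "\<exists>Xs. (\<forall>k. Xs k \<in> LpZ 1) \<and>
    (\<forall>\<phi>\<in>Cc_B3. \<forall>i. (\<lambda>k. integral\<^sup>L (lebesgue_on B3) (\<lambda>x. \<phi> x * (Xs k x $ i)))
       \<longlonglongrightarrow> integral\<^sup>L (\<mu>pos i) \<phi> - integral\<^sup>L (\<mu>neg i) \<phi>)"
proof -
  have "\<forall>i. \<exists>Xs. (\<forall>k. integrable lborel (Xs k) \<and> Zflux (Xs k)) \<and>
    (\<forall>\<phi>\<in>Cc_B3. \<forall>j. (\<lambda>k. LINT y|lborel. \<phi> y * Xs k y $ j)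
        \<longlonglongrightarrow> integral\<^sup>L (\<mu>pos i) \<phi> * (axis i 1 :: real^3) $ j)"
    by (intro allI radon_dipole_approx \<mu>) simp
  from choice[OF this] obtain U where U: "\<And>i k. integrable lborel (U i k)" "\<And>i k. Zflux (U i k)"
    "\<And>i \<phi> j. \<phi> \<in> Cc_B3 \<Longrightarrow> (\<lambda>k. LINT y|lborel. \<phi> y * U i k y $ j)
        \<longlonglongrightarrow> integral\<^sup>L (\<mu>pos i) \<phi> * (axis i 1 :: real^3) $ j"
    by blast
  have "\<forall>i. \<exists>Xs. (\<forall>k. integrable lborel (Xs k) \<and> Zflux (Xs k)) \<and>
    (\<forall>\<phi>\<in>Cc_B3. \<forall>j. (\<lambda>k. LINT y|lborel. \<phi> y * Xs k y $ j)
        \<longlonglongrightarrow> integral\<^sup>L (\<mu>neg i) \<phi> * (- axis i 1 :: real^3) $ j)"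
    by (intro allI radon_dipole_approx \<mu>) simp
  from choice[OF this] obtain V where V: "\<And>i k. integrable lborel (V i k)" "\<And>i k. Zflux (V i k)"
    "\<And>i \<phi> j. \<phi> \<in> Cc_B3 \<Longrightarrow> (\<lambda>k. LINT y|lborel. \<phi> y * V i k y $ j)
        \<longlonglongrightarrow> integral\<^sup>L (\<mu>neg i) \<phi> * (- axis i 1 :: real^3) $ j"
    by blast
  define Xs where "Xs k y = (\<Sum>i\<in>UNIV. U i k y + V i k y)" for k y
  have iX: "integrable lborel (Xs k)" and ZX: "Zflux (Xs k)" for k
    unfolding Xs_def using U(1,2) V(1,2) by (auto intro!: Zflux_sum Zflux_add)
  have "Xs k \<in> LpZ 1" for k by (rule Zflux_LpZ1[OF iX ZX])
  moreover have "(\<lambda>k. integral\<^sup>L (lebesgue_on B3) (\<lambda>x. \<phi> x * (Xs k x $ j)))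
      \<longlonglongrightarrow> integral\<^sup>L (\<mu>pos j) \<phi> - integral\<^sup>L (\<mu>neg j) \<phi>"
    if \<phi>: "\<phi> \<in> Cc_B3" for \<phi> j
  proof -
    have c: "continuous_on UNIV \<phi>" using \<phi> by (simp add: Cc_B3_def)
    have [measurable]: "\<phi> \<in> borel_measurable borel" by (rule borel_measurable_continuous_onI[OF c])
    obtain B where B: "\<And>y. \<bar>\<phi> y\<bar> \<le> B" using Cc_B3_bounded[OF \<phi>] by blast
    obtain \<rho> where \<rho>: "\<rho> < 1" "\<And>y. \<phi> y \<noteq> 0 \<Longrightarrow> norm y \<le> \<rho>" using Cc_B3_support[OF \<phi>] by blast
    have \<phi>0: "\<phi> y = 0" if "y \<notin> B3" for y using \<rho>(1) \<rho>(2)[of y] that by (auto simp: B3_def)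
    have int: "integrable lborel (\<lambda>y. \<phi> y * F y $ j)" if "integrable lborel F"
        for F :: "real^3 \<Rightarrow> real^3"
      using integrable_inner_bounded[OF that, of "\<lambda>y. \<phi> y *\<^sub>R axis j 1" B] B
          by (simp add: inner_axis mult.commute)
    have eq: "integral\<^sup>L (lebesgue_on B3) (\<lambda>x. \<phi> x * (Xs k x $ j))
        = (\<Sum>i\<in>UNIV. (LINT y|lborel. \<phi> y * U i k y $ j) + (LINT y|lborel. \<phi> y * V i k y $ j))" for k
    proof -
      have [measurable]: "Xs k \<in> borel_measurable borel" using iX[of k] by auto
      have "integral\<^sup>L (lebesgue_on B3) (\<lambda>x. \<phi> x * (Xs k x $ j)) = (LINT y|lborel. \<phi> y * Xs k y $ j)"
        by (rule integral_B3_eq) (auto simp: \<phi>0)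
      also have "\<dots> = (LINT y|lborel. (\<Sum>i\<in>UNIV. \<phi> y * U i k y $ j + \<phi> y * V i k y $ j))"
        by (simp add: Xs_def sum_distrib_left distrib_left)
      also have "\<dots> = (\<Sum>i\<in>UNIV. LINT y|lborel. \<phi> y * U i k y $ j + \<phi> y * V i k y $ j)"
        using int U(1) V(1) by (intro Bochner_Integration.integral_sum) auto
      also have "\<dots> = (\<Sum>i\<in>UNIV. (LINT y|lborel. \<phi> y * U i k y $ j) + (LINT y|lborel. \<phi> y
          * V i k y $ j))"
        using int U(1) V(1) by (intro sum.cong refl Bochner_Integration.integral_add) auto
      finally show ?thesis .
    qed
    have "(\<lambda>k. \<Sum>i\<in>UNIV. (LINT y|lborel. \<phi> y * U i k y $ j) + (LINT y|lborel. \<phi> y * V i k y $ j))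
       \<longlonglongrightarrow> (\<Sum>i\<in>UNIV. integral\<^sup>L (\<mu>pos i) \<phi> * (axis i 1 :: real^3) $ j + integral\<^sup>L (\<mu>neg i) \<phi>
           * (- axis i 1 :: real^3) $ j)"
      by (intro tendsto_sum tendsto_add U(3) V(3) \<phi>)
    also have "(\<Sum>i\<in>UNIV. integral\<^sup>L (\<mu>pos i) \<phi> * (axis i 1 :: real^3) $ j + integral\<^sup>L (\<mu>neg i) \<phi>
        * (- axis i 1 :: real^3) $ j)
       = (\<Sum>i\<in>UNIV. if j = i then integral\<^sup>L (\<mu>pos i) \<phi> - integral\<^sup>L (\<mu>neg i) \<phi> else 0)"
      by (intro sum.cong) (auto simp: axis_def)
    also have "\<dots> = integral\<^sup>L (\<mu>pos j) \<phi> - integral\<^sup>L (\<mu>neg j) \<phi>" by simp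
    finally show ?thesis unfolding eq .
  qed
  ultimately show ?thesis by blast
qed

theorem theorem1p1:
  shows "(\<forall>p::real. 1 < p \<and> p < 3/2 \<longrightarrow>
            (\<forall>Xs X. (\<forall>k. Xs k \<in> LpZ p) \<and> weak_Lp_conv p Xs X \<longrightarrow> X \<in> LpZ p))
       \<and> (\<forall>(\<mu>pos :: 3 \<Rightarrow> (real^3) measure) (\<mu>neg :: 3 \<Rightarrow> (real^3) measure).
            (\<forall>i. radon_on_B3 (\<mu>pos i) \<and> radon_on_B3 (\<mu>neg i)) \<longrightarrow>
            (\<exists>Xs. (\<forall>k. Xs k \<in> LpZ 1) \<and>
               (\<forall>\<phi>\<in>Cc_B3. \<forall>i.
                  (\<lambda>k. integral\<^sup>L (lebesgue_on B3) (\<lambda>x. \<phi> x * (Xs k x $ i)))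
                    \<longlonglongrightarrow> integral\<^sup>L (\<mu>pos i) \<phi> - integral\<^sup>L (\<mu>neg i) \<phi>)))"
  by (intro conjI allI impI L1Z_weakly_dense) (auto intro: LpZ_weakly_closed)

end
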